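(* Let $(\mathcal{A},\boxtimes,I)$ be a monoidal abelian category which admits sequential colimits and such that the monoidal product preserves sequential colimits and reflexive coequalizers. Let $V$ be an object of $\mathcal{A}$. Then the monoid $(\mathcal{F}(V),\bar{\mu},\bar{\eta})$ constructed in the context is the free monoid on $V$ in $(\mathcal{A},\boxtimes,I)$; that is, with respect to the canonical morphism $u_V : V\hookrightarrow I\oplus V = V_1\xrightarrow{j_1}\mathcal{F}(V)$, for every monoid $M$ in $(\mathcal{A},\boxtimes,I)$ and every morphism $f:V\to M$ in $\mathcal{A}$ there is a unique morphism of monoids $\varphi:\mathcal{F}(V)\to M$ with $\varphi\circ u_V=f$.
   Context: A monoidal abelian category $(\mathcal{A},\boxtimes,I)$ is an abelian category with a monoidal structure; $\boxtimes$ is not assumed to be additive or to preserve coproducts. Associativity isomorphisms are suppressed; $\lambda_A:I\boxtimes A\to A$ and $\rho_A:A\boxtimes I\to A$ are the unit isomorphisms. For maps $f:A\to C$, $g:B\to C$, $f+g:A\oplus B\to C$ is the induced map on the coproduct. A reflexive coequalizer is a coequalizer of a pair $d_0,d_1:X_1\to X_0$ admitting $s_0:X_0\to X_1$ with $d_0s_0=d_1s_0=\mathrm{id}_{X_0}$. The monoidal product preserves reflexive coequalizers (resp. sequential colimits) if for every object $A$ the functors $X\mapsto A\boxtimes X$ and $X\mapsto X\boxtimes A$ do. Multilinear part: $A\boxtimes(\underline{X}\oplus Y)\boxtimes B$ is the cokernel of $A\boxtimes i_Y\boxtimes B: A\boxtimes Y\boxtimes B\to A\boxtimes(X\oplus Y)\boxtimes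 B$ ($i_Y$ the inclusion); it is naturally isomorphic to the kernel of $A\boxtimes\pi_Y\boxtimes B: A\boxtimes(X\oplus Y)\boxtimes B\to A\boxtimes Y\boxtimes B$ ($\pi_Y$ the projection), and is thereby regarded as a subobject of $A\boxtimes(X\oplus Y)\boxtimes B$. Construction. Let $V_+:=I\oplus V$, with inclusions $\eta:I\hookrightarrow V_+$ and $i_V:V\hookrightarrow V_+$, and $V_n:=(V_+)^{\boxtimes n}$, $V_0:=I$. For $0\le i\le n$ let $\eta_i:V_n\cong V_i\boxtimes I\boxtimes V_{n-i}\xrightarrow{V_i\boxtimes\eta\boxtimes V_{n-i}}V_{n+1}$. Let $\tau:=(\eta\boxtimes i_V)\circ\lambda_V^{-1}-(i_V\boxtimes\eta)\circ\rho_V^{-1}:V\to V_2$. For objects $A,B$ let $R_{A,B}\subset A\boxtimes V_2\boxtimes B$ be the image of the composite $A\boxtimes(\underline{V}\oplus V_2)\boxtimes B\hookrightarrow A\boxtimes(V\oplus V_2)\boxtimes B\xrightarrow{A\boxtimes(\tau+\mathrm{id}_{V_2})\boxtimes B}A\boxtimes V_2\boxtimes B$. For $0\le i\le n-2$ let $R_{i,n-i-2}:=R_{V_i,V_{n-i-2}}\subset V_n$, let $R_n:=\sum_{i=0}^{n-2}R_{i,n-i-2}\subset V_n$ (so $R_0=R_1=0$), and let $\widetilde V_n:=V_n/R_n$ with projection $\pi_n:V_n\to\widetilde V_n$. All the maps $\eta_i$ ($0\le i\le n$) induce one and the same morphism $\widetilde\eta:\widetilde V_n\to\widetilde V_{n+1}$.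 Set $\mathcal{F}(V):=\mathrm{Colim}_{\mathbb N}\,(\widetilde V_0\xrightarrow{\widetilde\eta}\widetilde V_1\xrightarrow{\widetilde\eta}\widetilde V_2\to\cdots)$ with structure maps $j_n:\widetilde V_n\to\mathcal{F}(V)$. Monoid structure. The unit is $\bar\eta:=j_0:I\to\mathcal{F}(V)$. Let $\mu_{n,m}:V_n\boxtimes V_m\cong V_{n+m}\xrightarrow{\pi_{n+m}}\widetilde V_{n+m}\xrightarrow{j_{n+m}}\mathcal{F}(V)$. There is a unique $\widetilde\mu_{n,m}:\widetilde V_n\boxtimes\widetilde V_m\to\mathcal{F}(V)$ with $\widetilde\mu_{n,m}\circ(\pi_n\boxtimes\pi_m)=\mu_{n,m}$. Since $\boxtimes$ preserves sequential colimits, these induce $\widetilde\mu_{n,*}:\widetilde V_n\boxtimes\mathcal{F}(V)\to\mathcal{F}(V)$ with $\widetilde\mu_{n,*}\circ(\widetilde V_n\boxtimes j_m)=\widetilde\mu_{n,m}$ for all $m$, and then $\bar\mu:\mathcal{F}(V)\boxtimes\mathcal{F}(V)\to\mathcal{F}(V)$ with $\bar\mu\circ(j_n\boxtimes\mathcal{F}(V))=\widetilde\mu_{n,*}$ for all $n$. *)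

theory Defs
  imports "HOL-Algebra.Group"
begin

section \<open>Categories\<close>

record ('o, 'm) category =
  Obj :: "'o set"
  Arr :: "'m set"
  Dom :: "'m \<Rightarrow> 'o"
  Cod :: "'m \<Rightarrow> 'o"
  Id :: "'o \<Rightarrow> 'm" ("\<^bold>1\<index>")
  Comp :: "'m \<Rightarrow> 'm \<Rightarrow> 'm" (infixr "\<cdot>\<index>" 70)

definition Hom :: "('o, 'm, 'x) category_scheme \<Rightarrow> 'o \<Rightarrow> 'o \<Rightarrow> 'm set" where
  "Hom C A B = {f \<in> Arr C. Dom C f = A \<and> Cod C f = B}"

locale category =
  fixes C :: "('o, 'm, 'x) category_scheme" (structure)
  assumes Dom_in_Obj: "f \<in> Arr C \<Longrightarrow> Dom C f \<in> Obj C"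
    and Cod_in_Obj: "f \<in> Arr C \<Longrightarrow> Cod C f \<in> Obj C"
    and Id_in_Hom: "A \<in> Obj C \<Longrightarrow> \<^bold>1 A \<in> Hom C A A"
    and Comp_in_Hom: "\<lbrakk>f \<in> Hom C A B; g \<in> Hom C B D\<rbrakk> \<Longrightarrow> g \<cdot> f \<in> Hom C A D"
    and Comp_Id: "f \<in> Hom C A B \<Longrightarrow> f \<cdot> \<^bold>1 A = f"
    and Id_Comp: "f \<in> Hom C A B \<Longrightarrow> \<^bold>1 B \<cdot> f = f"
    and Comp_assoc: "\<lbrakk>f \<in> Hom C A B; g \<in> Hom C B D; h \<in> Hom C D E\<rbrakk>
          \<Longrightarrow> (h \<cdot> g) \<cdot> f = h \<cdot> (g \<cdot> f)"

context
  fixes C :: "('o, 'm, 'x) category_scheme" (structure)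
begin

definition inverse_arrows :: "'m \<Rightarrow> 'm \<Rightarrow> bool" where
  "inverse_arrows f g \<longleftrightarrow> f \<in> Arr C \<and> g \<in> Hom C (Cod C f) (Dom C f) \<and>
     g \<cdot> f = \<^bold>1 (Dom C f) \<and> f \<cdot> g = \<^bold>1 (Cod C f)"

definition iso_arrow :: "'m \<Rightarrow> bool" where
  "iso_arrow f \<longleftrightarrow> (\<exists>g. inverse_arrows f g)"

definition inv_arrow :: "'m \<Rightarrow> 'm" where
  "inv_arrow f = (THE g. inverse_arrows f g)"

definition monic :: "'m \<Rightarrow> bool" where
  "monic f \<longleftrightarrow> f \<in> Arr C \<and>
     (\<forall>A. \<forall>g \<in> Hom C A (Dom C f). \<forall>h \<in> Hom C A (Dom C f). f \<cdot> g = f \<cdot> h \<longrightarrow> g = h)"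

definition epic :: "'m \<Rightarrow> bool" where
  "epic f \<longleftrightarrow> f \<in> Arr C \<and>
     (\<forall>A. \<forall>g \<in> Hom C (Cod C f) A. \<forall>h \<in> Hom C (Cod C f) A. g \<cdot> f = h \<cdot> f \<longrightarrow> g = h)"

definition zero_object :: "'o \<Rightarrow> bool" where
  "zero_object Z \<longleftrightarrow> Z \<in> Obj C \<and>
     (\<forall>A \<in> Obj C. (\<exists>!f. f \<in> Hom C A Z) \<and> (\<exists>!f. f \<in> Hom C Z A))"

definition coequalizer :: "'m \<Rightarrow> 'm \<Rightarrow> 'm \<Rightarrow> bool" where
  "coequalizer d0 d1 q \<longleftrightarrow> q \<in> Arr C \<and> Dom C q = Cod C d0 \<and> q \<cdot> d0 = q \<cdot> d1 \<and>
     (\<forall>B. \<forall>g \<in> Hom C (Cod C d0) B. g \<cdot> d0 = g \<cdot> d1 \<longrightarrow>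
        (\<exists>!h. h \<in> Hom C (Cod C q) B \<and> h \<cdot> q = g))"

definition reflexive_pair :: "'m \<Rightarrow> 'm \<Rightarrow> bool" where
  "reflexive_pair d0 d1 \<longleftrightarrow> (\<exists>X1 X0. d0 \<in> Hom C X1 X0 \<and> d1 \<in> Hom C X1 X0 \<and>
     (\<exists>s0 \<in> Hom C X0 X1. d0 \<cdot> s0 = \<^bold>1 X0 \<and> d1 \<cdot> s0 = \<^bold>1 X0))"

definition sequential_diagram :: "(nat \<Rightarrow> 'm) \<Rightarrow> bool" where
  "sequential_diagram x \<longleftrightarrow> (\<forall>n. x n \<in> Arr C \<and> Cod C (x n) = Dom C (x (Suc n)))"

definition sequential_cocone :: "(nat \<Rightarrow> 'm) \<Rightarrow> 'o \<Rightarrow> (nat \<Rightarrow> 'm) \<Rightarrow> bool" where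
  "sequential_cocone x L j \<longleftrightarrow> L \<in> Obj C \<and>
     (\<forall>n. j n \<in> Hom C (Dom C (x n)) L \<and> j (Suc n) \<cdot> x n = j n)"

definition sequential_colimit :: "(nat \<Rightarrow> 'm) \<Rightarrow> 'o \<Rightarrow> (nat \<Rightarrow> 'm) \<Rightarrow> bool" where
  "sequential_colimit x L j \<longleftrightarrow> sequential_cocone x L j \<and>
     (\<forall>B g. sequential_cocone x B g \<longrightarrow> (\<exists>!h. h \<in> Hom C L B \<and> (\<forall>n. h \<cdot> j n = g n)))"

definition has_sequential_colimits :: bool where
  "has_sequential_colimits \<longleftrightarrow>
     (\<forall>x. sequential_diagram x \<longrightarrow> (\<exists>L j. sequential_colimit x L j))"

definition seq_colim :: "(nat \<Rightarrow> 'm) \<Rightarrow> 'o \<times> (nat \<Rightarrow> 'm)" where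
  "seq_colim x = (SOME (L, j). sequential_colimit x L j)"

text \<open>A functor is given by its effect \<open>Fo\<close> on objects and \<open>Fm\<close> on arrows.\<close>

definition preserves_sequential_colimits :: "('o \<Rightarrow> 'o) \<Rightarrow> ('m \<Rightarrow> 'm) \<Rightarrow> bool" where
  "preserves_sequential_colimits Fo Fm \<longleftrightarrow>
     (\<forall>x L j. sequential_diagram x \<and> sequential_colimit x L j \<longrightarrow>
        sequential_colimit (\<lambda>n. Fm (x n)) (Fo L) (\<lambda>n. Fm (j n)))"

definition preserves_reflexive_coequalizers :: "('m \<Rightarrow> 'm) \<Rightarrow> bool" where
  "preserves_reflexive_coequalizers Fm \<longleftrightarrow>
     (\<forall>d0 d1 q. reflexive_pair d0 d1 \<and> coequalizer d0 d1 q \<longrightarrow>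
        coequalizer (Fm d0) (Fm d1) (Fm q))"

end

section \<open>Abelian categories\<close>

record ('o, 'm) preadditive_category = "('o, 'm) category" +
  plus_arrow :: "'m \<Rightarrow> 'm \<Rightarrow> 'm"
  zero_arrow :: "'o \<Rightarrow> 'o \<Rightarrow> 'm"

definition hom_group ::
    "('o, 'm, 'x) preadditive_category_scheme \<Rightarrow> 'o \<Rightarrow> 'o \<Rightarrow> 'm monoid" where
  "hom_group C A B = \<lparr>carrier = Hom C A B, mult = plus_arrow C, one = zero_arrow C A B\<rparr>"

definition minus_arrow ::
    "('o, 'm, 'x) preadditive_category_scheme \<Rightarrow> 'm \<Rightarrow> 'm \<Rightarrow> 'm" where
  "minus_arrow C f g = plus_arrow C f (inv\<^bsub>hom_group C (Dom C g) (Cod C g)\<^esub> g)"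

locale preadditive_category = category C
  for C :: "('o, 'm, 'x) preadditive_category_scheme" (structure) +
  assumes comm_group_Hom: "\<lbrakk>A \<in> Obj C; B \<in> Obj C\<rbrakk> \<Longrightarrow> comm_group (hom_group C A B)"
    and Comp_plus: "\<lbrakk>f \<in> Hom C A B; g \<in> Hom C A B; h \<in> Hom C B D\<rbrakk>
          \<Longrightarrow> h \<cdot> plus_arrow C f g = plus_arrow C (h \<cdot> f) (h \<cdot> g)"
    and plus_Comp: "\<lbrakk>h \<in> Hom C A B; f \<in> Hom C B D; g \<in> Hom C B D\<rbrakk>
          \<Longrightarrow> plus_arrow C f g \<cdot> h = plus_arrow C (f \<cdot> h) (g \<cdot> h)"

context
  fixes C :: "('o, 'm, 'x) preadditive_category_scheme" (structure)
begin

definition biproduct :: "'o \<Rightarrow> 'o \<Rightarrow> 'o \<Rightarrow> 'm \<Rightarrow> 'm \<Rightarrow> 'm \<Rightarrow> 'm \<Rightarrow> bool" where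
  "biproduct A B S i1 i2 p1 p2 \<longleftrightarrow>
     i1 \<in> Hom C A S \<and> i2 \<in> Hom C B S \<and> p1 \<in> Hom C S A \<and> p2 \<in> Hom C S B \<and>
     p1 \<cdot> i1 = \<^bold>1 A \<and> p2 \<cdot> i2 = \<^bold>1 B \<and>
     p1 \<cdot> i2 = zero_arrow C B A \<and> p2 \<cdot> i1 = zero_arrow C A B \<and>
     plus_arrow C (i1 \<cdot> p1) (i2 \<cdot> p2) = \<^bold>1 S"

definition is_kernel :: "'m \<Rightarrow> 'm \<Rightarrow> bool" where
  "is_kernel f k \<longleftrightarrow> k \<in> Arr C \<and> Cod C k = Dom C f \<and>
     f \<cdot> k = zero_arrow C (Dom C k) (Cod C f) \<and>
     (\<forall>B. \<forall>g \<in> Hom C B (Dom C f). f \<cdot> g = zero_arrow C B (Cod C f) \<longrightarrow>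
        (\<exists>!h. h \<in> Hom C B (Dom C k) \<and> k \<cdot> h = g))"

definition is_cokernel :: "'m \<Rightarrow> 'm \<Rightarrow> bool" where
  "is_cokernel f q \<longleftrightarrow> q \<in> Arr C \<and> Dom C q = Cod C f \<and>
     q \<cdot> f = zero_arrow C (Dom C f) (Cod C q) \<and>
     (\<forall>B. \<forall>g \<in> Hom C (Cod C f) B. g \<cdot> f = zero_arrow C (Dom C f) B \<longrightarrow>
        (\<exists>!h. h \<in> Hom C (Cod C q) B \<and> h \<cdot> q = g))"

text \<open>Universal objects are fixed by choice; kernels, cokernels and images are
  represented by their structure arrows.\<close>

definition biprod :: "'o \<Rightarrow> 'o \<Rightarrow> 'o \<times> 'm \<times> 'm \<times> 'm \<times> 'm" where
  "biprod A B = (SOME (S, i1, i2, p1, p2). biproduct A B S i1 i2 p1 p2)"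

definition dsum :: "'o \<Rightarrow> 'o \<Rightarrow> 'o" where
  "dsum A B = (case biprod A B of (S, i1, i2, p1, p2) \<Rightarrow> S)"

definition inj1 :: "'o \<Rightarrow> 'o \<Rightarrow> 'm" where
  "inj1 A B = (case biprod A B of (S, i1, i2, p1, p2) \<Rightarrow> i1)"

definition inj2 :: "'o \<Rightarrow> 'o \<Rightarrow> 'm" where
  "inj2 A B = (case biprod A B of (S, i1, i2, p1, p2) \<Rightarrow> i2)"

definition proj2 :: "'o \<Rightarrow> 'o \<Rightarrow> 'm" where
  "proj2 A B = (case biprod A B of (S, i1, i2, p1, p2) \<Rightarrow> p2)"

definition copair :: "'m \<Rightarrow> 'm \<Rightarrow> 'm" where
  "copair f g = (THE h. h \<in> Hom C (dsum (Dom C f) (Dom C g)) (Cod C f) \<and>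
     h \<cdot> inj1 (Dom C f) (Dom C g) = f \<and> h \<cdot> inj2 (Dom C f) (Dom C g) = g)"

definition ker :: "'m \<Rightarrow> 'm" where
  "ker f = (SOME k. is_kernel f k)"

definition coker :: "'m \<Rightarrow> 'm" where
  "coker f = (SOME q. is_cokernel f q)"

definition img :: "'m \<Rightarrow> 'm" where
  "img f = ker (coker f)"

definition zero_subobject :: "'o \<Rightarrow> 'm" where
  "zero_subobject A = zero_arrow C (SOME Z. zero_object C Z) A"

text \<open>The sum of the subobjects \<open>r 0, \<dots>, r (k - 1)\<close> of \<open>A\<close>.\<close>

primrec subobject_sum :: "'o \<Rightarrow> (nat \<Rightarrow> 'm) \<Rightarrow> nat \<Rightarrow> 'm" where
  "subobject_sum A r 0 = zero_subobject A"
| "subobject_sum A r (Suc k) = img (copair (subobject_sum A r k) (r k))"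

end

locale abelian_category = preadditive_category +
  assumes ex_zero_object: "\<exists>Z. zero_object C Z"
    and ex_biproduct: "\<lbrakk>A \<in> Obj C; B \<in> Obj C\<rbrakk> \<Longrightarrow> \<exists>S i1 i2 p1 p2. biproduct C A B S i1 i2 p1 p2"
    and ex_kernel: "f \<in> Arr C \<Longrightarrow> \<exists>k. is_kernel C f k"
    and ex_cokernel: "f \<in> Arr C \<Longrightarrow> \<exists>q. is_cokernel C f q"
    and monic_is_kernel: "monic C m \<Longrightarrow> \<exists>f \<in> Arr C. is_kernel C f m"
    and epic_is_cokernel: "epic C e \<Longrightarrow> \<exists>f \<in> Arr C. is_cokernel C f e"

section \<open>Monoidal abelian categories\<close>

record ('o, 'm) monoidal_category = "('o, 'm) preadditive_category" +
  tensor_obj :: "'o \<Rightarrow> 'o \<Rightarrow> 'o" (infixl "\<boxtimes>\<index>" 75)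
  tensor_arr :: "'m \<Rightarrow> 'm \<Rightarrow> 'm" (infixl "\<star>\<index>" 75)
  unit_obj :: 'o ("\<I>\<index>")
  associator :: "'o \<Rightarrow> 'o \<Rightarrow> 'o \<Rightarrow> 'm" ("\<a>\<index>")
  left_unitor :: "'o \<Rightarrow> 'm" ("\<l>\<index>")
  right_unitor :: "'o \<Rightarrow> 'm" ("\<r>\<index>")

text \<open>The tensor product is a bifunctor only: no additivity is required of it.\<close>

locale monoidal_abelian_category = abelian_category C
  for C :: "('o, 'm, 'x) monoidal_category_scheme" (structure) +
  assumes tensor_obj: "\<lbrakk>A \<in> Obj C; B \<in> Obj C\<rbrakk> \<Longrightarrow> A \<boxtimes> B \<in> Obj C"
    and tensor_arr: "\<lbrakk>f \<in> Hom C A A'; g \<in> Hom C B B'\<rbrakk> \<Longrightarrow> f \<star> g \<in> Hom C (A \<boxtimes> B) (A' \<boxtimes> B')"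
    and tensor_Id: "\<lbrakk>A \<in> Obj C; B \<in> Obj C\<rbrakk> \<Longrightarrow> \<^bold>1 A \<star> \<^bold>1 B = \<^bold>1 (A \<boxtimes> B)"
    and tensor_Comp: "\<lbrakk>f \<in> Hom C A A'; f' \<in> Hom C A' A''; g \<in> Hom C B B'; g' \<in> Hom C B' B''\<rbrakk>
          \<Longrightarrow> (f' \<cdot> f) \<star> (g' \<cdot> g) = (f' \<star> g') \<cdot> (f \<star> g)"
    and unit_obj: "\<I> \<in> Obj C"
    and associator: "\<lbrakk>X \<in> Obj C; Y \<in> Obj C; Z \<in> Obj C\<rbrakk>
          \<Longrightarrow> \<a> X Y Z \<in> Hom C ((X \<boxtimes> Y) \<boxtimes> Z) (X \<boxtimes> (Y \<boxtimes> Z)) \<and> iso_arrow C (\<a> X Y Z)"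
    and associator_natural: "\<lbrakk>f \<in> Hom C X X'; g \<in> Hom C Y Y'; h \<in> Hom C Z Z'\<rbrakk>
          \<Longrightarrow> \<a> X' Y' Z' \<cdot> ((f \<star> g) \<star> h) = (f \<star> (g \<star> h)) \<cdot> \<a> X Y Z"
    and left_unitor: "X \<in> Obj C \<Longrightarrow> \<l> X \<in> Hom C (\<I> \<boxtimes> X) X \<and> iso_arrow C (\<l> X)"
    and left_unitor_natural: "f \<in> Hom C X X' \<Longrightarrow> \<l> X' \<cdot> (\<^bold>1 \<I> \<star> f) = f \<cdot> \<l> X"
    and right_unitor: "X \<in> Obj C \<Longrightarrow> \<r> X \<in> Hom C (X \<boxtimes> \<I>) X \<and> iso_arrow C (\<r> X)"
    and right_unitor_natural: "f \<in> Hom C X X' \<Longrightarrow> \<r> X' \<cdot> (f \<star> \<^bold>1 \<I>) = f \<cdot> \<r> X"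
    and pentagon: "\<lbrakk>W \<in> Obj C; X \<in> Obj C; Y \<in> Obj C; Z \<in> Obj C\<rbrakk>
          \<Longrightarrow> (\<^bold>1 W \<star> \<a> X Y Z) \<cdot> \<a> W (X \<boxtimes> Y) Z \<cdot> (\<a> W X Y \<star> \<^bold>1 Z)
            = \<a> W X (Y \<boxtimes> Z) \<cdot> \<a> (W \<boxtimes> X) Y Z"
    and triangle: "\<lbrakk>X \<in> Obj C; Y \<in> Obj C\<rbrakk>
          \<Longrightarrow> (\<^bold>1 X \<star> \<l> Y) \<cdot> \<a> X \<I> Y = \<r> X \<star> \<^bold>1 Y"

context
  fixes C :: "('o, 'm, 'x) monoidal_category_scheme" (structure)
begin

definition tensor_preserves_sequential_colimits :: bool where
  "tensor_preserves_sequential_colimits \<longleftrightarrow> (\<forall>A \<in> Obj C.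
     preserves_sequential_colimits C (\<lambda>X. A \<boxtimes> X) (\<lambda>f. \<^bold>1 A \<star> f) \<and>
     preserves_sequential_colimits C (\<lambda>X. X \<boxtimes> A) (\<lambda>f. f \<star> \<^bold>1 A))"

definition tensor_preserves_reflexive_coequalizers :: bool where
  "tensor_preserves_reflexive_coequalizers \<longleftrightarrow> (\<forall>A \<in> Obj C.
     preserves_reflexive_coequalizers C (\<lambda>f. \<^bold>1 A \<star> f) \<and>
     preserves_reflexive_coequalizers C (\<lambda>f. f \<star> \<^bold>1 A))"

definition monoid_object :: "'o \<Rightarrow> 'm \<Rightarrow> 'm \<Rightarrow> bool" where
  "monoid_object M \<mu> \<eta> \<longleftrightarrow> M \<in> Obj C \<and> \<mu> \<in> Hom C (M \<boxtimes> M) M \<and> \<eta> \<in> Hom C \<I> M \<and>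
     \<mu> \<cdot> (\<mu> \<star> \<^bold>1 M) = \<mu> \<cdot> (\<^bold>1 M \<star> \<mu>) \<cdot> \<a> M M M \<and>
     \<mu> \<cdot> (\<eta> \<star> \<^bold>1 M) = \<l> M \<and> \<mu> \<cdot> (\<^bold>1 M \<star> \<eta>) = \<r> M"

definition monoid_morphism :: "'o \<Rightarrow> 'm \<Rightarrow> 'm \<Rightarrow> 'o \<Rightarrow> 'm \<Rightarrow> 'm \<Rightarrow> 'm \<Rightarrow> bool" where
  "monoid_morphism M \<mu> \<eta> M' \<mu>' \<eta>' \<phi> \<longleftrightarrow>
     \<phi> \<in> Hom C M M' \<and> \<phi> \<cdot> \<mu> = \<mu>' \<cdot> (\<phi> \<star> \<phi>) \<and> \<phi> \<cdot> \<eta> = \<eta>'"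

definition free_monoid_on :: "'o \<Rightarrow> 'o \<Rightarrow> 'm \<Rightarrow> 'm \<Rightarrow> 'm \<Rightarrow> bool" where
  "free_monoid_on V F \<mu> \<eta> u \<longleftrightarrow> monoid_object F \<mu> \<eta> \<and> u \<in> Hom C V F \<and>
     (\<forall>M \<mu>' \<eta>' f. monoid_object M \<mu>' \<eta>' \<and> f \<in> Hom C V M \<longrightarrow>
        (\<exists>!\<phi>. monoid_morphism F \<mu> \<eta> M \<mu>' \<eta>' \<phi> \<and> \<phi> \<cdot> u = f))"

section \<open>Multilinear parts\<close>

text \<open>A threefold product \<open>A \<boxtimes> X \<boxtimes> B\<close> is bracketed as \<open>(A \<boxtimes> X) \<boxtimes> B\<close>.\<close>

abbreviation between :: "'o \<Rightarrow> 'm \<Rightarrow> 'o \<Rightarrow> 'm" where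
  "between A f B \<equiv> (\<^bold>1 A \<star> f) \<star> \<^bold>1 B"

text \<open>The multilinear part in \<open>X\<close> of \<open>A \<boxtimes> (X \<oplus> Y) \<boxtimes> B\<close>: the quotient arrow onto it
  and its embedding into \<open>A \<boxtimes> (X \<oplus> Y) \<boxtimes> B\<close>. The composite of the kernel of
  \<open>A \<boxtimes> \<pi>\<^sub>Y \<boxtimes> B\<close> with the quotient arrow is the isomorphism along which the cokernel
  becomes a subobject.\<close>

definition multilinear_quot :: "'o \<Rightarrow> 'o \<Rightarrow> 'o \<Rightarrow> 'o \<Rightarrow> 'm" where
  "multilinear_quot A X Y B = coker C (between A (inj2 C X Y) B)"

definition multilinear_incl :: "'o \<Rightarrow> 'o \<Rightarrow> 'o \<Rightarrow> 'o \<Rightarrow> 'm" where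
  "multilinear_incl A X Y B =
     (let k = ker C (between A (proj2 C X Y) B)
      in k \<cdot> inv_arrow C (multilinear_quot A X Y B \<cdot> k))"

section \<open>Tensor powers\<close>

text \<open>The powers are bracketed to the right, \<open>W \<boxtimes> (W \<boxtimes> (\<dots> \<boxtimes> W))\<close>, without a trailing unit,
  so that the first power of \<open>W\<close> is \<open>W\<close> itself.\<close>

fun tensor_pow :: "'o \<Rightarrow> nat \<Rightarrow> 'o" where
  "tensor_pow W 0 = \<I>"
| "tensor_pow W (Suc 0) = W"
| "tensor_pow W (Suc (Suc n)) = W \<boxtimes> tensor_pow W (Suc n)"

text \<open>The canonical isomorphism from the product of the \<open>n\<close>-th and the \<open>m\<close>-th power to
  the \<open>(n + m)\<close>-th power.\<close>

fun pow_iso :: "'o \<Rightarrow> nat \<Rightarrow> nat \<Rightarrow> 'm" where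
  "pow_iso W 0 m = \<l> (tensor_pow W m)"
| "pow_iso W (Suc 0) 0 = \<r> W"
| "pow_iso W (Suc 0) (Suc m) = \<^bold>1 (W \<boxtimes> tensor_pow W (Suc m))"
| "pow_iso W (Suc (Suc n)) m =
     (\<^bold>1 W \<star> pow_iso W (Suc n) m) \<cdot> \<a> W (tensor_pow W (Suc n)) (tensor_pow W m)"

section \<open>The construction\<close>

definition V_plus :: "'o \<Rightarrow> 'o" where
  "V_plus V = dsum C \<I> V"

definition eta :: "'o \<Rightarrow> 'm" where
  "eta V = inj1 C \<I> V"

definition incl_V :: "'o \<Rightarrow> 'm" where
  "incl_V V = inj2 C \<I> V"

abbreviation Vn :: "'o \<Rightarrow> nat \<Rightarrow> 'o" where
  "Vn V n \<equiv> tensor_pow (V_plus V) n"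

definition eta_i :: "'o \<Rightarrow> nat \<Rightarrow> nat \<Rightarrow> 'm" where
  "eta_i V n i =
     pow_iso (V_plus V) (Suc i) (n - i)
     \<cdot> (pow_iso (V_plus V) i 1 \<star> \<^bold>1 (Vn V (n - i)))
     \<cdot> between (Vn V i) (eta V) (Vn V (n - i))
     \<cdot> (inv_arrow C (\<r> (Vn V i)) \<star> \<^bold>1 (Vn V (n - i)))
     \<cdot> inv_arrow C (pow_iso (V_plus V) i (n - i))"

definition tau :: "'o \<Rightarrow> 'm" where
  "tau V = minus_arrow C ((eta V \<star> incl_V V) \<cdot> inv_arrow C (\<l> V))
                         ((incl_V V \<star> eta V) \<cdot> inv_arrow C (\<r> V))"

definition R_AB :: "'o \<Rightarrow> 'o \<Rightarrow> 'o \<Rightarrow> 'm" where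
  "R_AB V A B = img C (between A (copair C (tau V) (\<^bold>1 (Vn V 2))) B
                       \<cdot> multilinear_incl A V (Vn V 2) B)"

text \<open>The subobject \<open>R\<^bsub>i,k\<^esub>\<close> of \<open>V\<^bsub>i + 2 + k\<^esub>\<close>.\<close>

definition R_sub :: "'o \<Rightarrow> nat \<Rightarrow> nat \<Rightarrow> 'm" where
  "R_sub V i k = pow_iso (V_plus V) (i + 2) k
     \<cdot> (pow_iso (V_plus V) i 2 \<star> \<^bold>1 (Vn V k)) \<cdot> R_AB V (Vn V i) (Vn V k)"

definition Rn :: "'o \<Rightarrow> nat \<Rightarrow> 'm" where
  "Rn V n = subobject_sum C (Vn V n) (\<lambda>i. R_sub V i (n - i - 2)) (n - 1)"

definition pi_n :: "'o \<Rightarrow> nat \<Rightarrow> 'm" where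
  "pi_n V n = coker C (Rn V n)"

definition Vt :: "'o \<Rightarrow> nat \<Rightarrow> 'o" where
  "Vt V n = Cod C (pi_n V n)"

definition eta_tilde :: "'o \<Rightarrow> nat \<Rightarrow> 'm" where
  "eta_tilde V n = (THE h. h \<in> Hom C (Vt V n) (Vt V (Suc n)) \<and>
     (\<forall>i\<le>n. h \<cdot> pi_n V n = pi_n V (Suc n) \<cdot> eta_i V n i))"

definition FV :: "'o \<Rightarrow> 'o" where
  "FV V = fst (seq_colim C (eta_tilde V))"

definition j_n :: "'o \<Rightarrow> nat \<Rightarrow> 'm" where
  "j_n V = snd (seq_colim C (eta_tilde V))"

definition mu_nm :: "'o \<Rightarrow> nat \<Rightarrow> nat \<Rightarrow> 'm" where
  "mu_nm V n m = j_n V (n + m) \<cdot> pi_n V (n + m) \<cdot> pow_iso (V_plus V) n m"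

definition mu_tilde :: "'o \<Rightarrow> nat \<Rightarrow> nat \<Rightarrow> 'm" where
  "mu_tilde V n m = (THE h. h \<in> Hom C (Vt V n \<boxtimes> Vt V m) (FV V) \<and>
     h \<cdot> (pi_n V n \<star> pi_n V m) = mu_nm V n m)"

definition mu_tilde_star :: "'o \<Rightarrow> nat \<Rightarrow> 'm" where
  "mu_tilde_star V n = (THE h. h \<in> Hom C (Vt V n \<boxtimes> FV V) (FV V) \<and>
     (\<forall>m. h \<cdot> (\<^bold>1 (Vt V n) \<star> j_n V m) = mu_tilde V n m))"

definition mu_bar :: "'o \<Rightarrow> 'm" where
  "mu_bar V = (THE h. h \<in> Hom C (FV V \<boxtimes> FV V) (FV V) \<and>
     (\<forall>n. h \<cdot> (j_n V n \<star> \<^bold>1 (FV V)) = mu_tilde_star V n))"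

text \<open>The objects \<open>V\<^sub>0\<close> and \<open>V\<^sub>1\<close> agree with their quotients by the zero subobject only up
  to the isomorphisms \<open>\<pi>\<^sub>0\<close> and \<open>\<pi>\<^sub>1\<close>, hence these occur in the next two definitions.\<close>

definition eta_bar :: "'o \<Rightarrow> 'm" where
  "eta_bar V = j_n V 0 \<cdot> pi_n V 0"

definition u_V :: "'o \<Rightarrow> 'm" where
  "u_V V = j_n V 1 \<cdot> pi_n V 1 \<cdot> incl_V V"

end

end

theory Submission
  imports Defs
begin

text \<open>The cokernel of \<open>r : R \<rightarrow> Y\<close> is the coequalizer of the reflexive pair
  \<open>r + id, \<pi>\<^sub>Y : R \<oplus> Y \<rightarrow> Y\<close>. A functor \<open>\<Phi>\<close> that preserves reflexive coequalizers therefore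
  preserves epimorphisms onto cokernels, and a morphism \<open>g\<close> on \<open>\<Phi> Y\<close> factors through \<open>\<Phi> (Coker r)\<close>
  iff \<open>g \<circ> \<Phi> (r + id) = g \<circ> \<Phi> \<pi>\<^sub>Y\<close>; additivity of \<open>\<Phi>\<close> plays no role. This property of \<open>r\<close> passes to
  images and to sums of subobjects. For \<open>\<Phi> = A \<boxtimes> - \<boxtimes> B\<close> the two sides always agree on the summand
  \<open>A \<boxtimes> V\<^sub>2 \<boxtimes> B\<close> of \<open>A \<boxtimes> (V \<oplus> V\<^sub>2) \<boxtimes> B\<close>, so they agree as soon as they do on the multilinear part;
  hence \<open>A \<boxtimes> V\<^sub>2 \<boxtimes> B / R\<^bsub>A,B\<^esub> = A \<boxtimes> Coker \<tau> \<boxtimes> B\<close>. Consequently a morphism on \<open>V\<^sub>n\<close>, or on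
  \<open>V\<^sub>n\<close> tensored with a fixed object, descends along \<open>\<pi>\<^sub>n\<close> iff it coequalizes
  \<open>V\<^sub>i \<boxtimes> (\<tau> + id) \<boxtimes> V\<^sub>k\<close> and \<open>V\<^sub>i \<boxtimes> \<pi> \<boxtimes> V\<^sub>k\<close> for all \<open>i + 2 + k = n\<close>.

  The two insertions of \<open>\<eta>\<close> next to a factor \<open>V\<^sub>+\<close> differ by \<open>\<tau>\<close> composed with the projection
  \<open>V\<^sub>+ \<rightarrow> V\<close>, so all \<open>\<eta>\<^sub>i\<close> agree after \<open>\<pi>\<^bsub>n + 1\<^esub>\<close>. The morphisms \<open>w\<^sub>n = j\<^sub>n \<circ> \<pi>\<^sub>n : V\<^sub>n \<rightarrow> F(V)\<close> and
  their tensor products are jointly epic and multiplicative, which gives the monoid axioms. A morphism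
  \<open>f : V \<rightarrow> M\<close> extends to \<open>V\<^sub>+\<close> by the unit of \<open>M\<close> and to \<open>V\<^sub>n\<close> by multiplication; the extension to
  \<open>V\<^sub>2\<close> annihilates \<open>\<tau>\<close>, so it descends to \<open>F(V)\<close>.\<close>

section \<open>Calculus of arrows: composition, isomorphisms, epimorphisms and colimits\<close>

context category
begin

lemma Hom_iff: "f \<in> Hom C A B \<longleftrightarrow> f \<in> Arr C \<and> Dom C f = A \<and> Cod C f = B"
  by (simp add: Hom_def)

lemma Dom_Cod_Obj [simp]:
  assumes "f \<in> Arr C"
  shows "Dom C f \<in> Obj C" "Cod C f \<in> Obj C"
  using assms by (rule Dom_in_Obj, rule Cod_in_Obj)

lemma Hom_Obj:
  assumes "f \<in> Hom C A B"
  shows "A \<in> Obj C" "B \<in> Obj C"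
  using assms by (auto simp: Hom_iff)

lemma Id_simps [simp]:
  assumes "A \<in> Obj C"
  shows "\<^bold>1 A \<in> Arr C" "Dom C (\<^bold>1 A) = A" "Cod C (\<^bold>1 A) = A"
  using Id_in_Hom[OF assms] by (auto simp: Hom_iff)

lemma Comp_simps [simp]:
  assumes "f \<in> Arr C" "g \<in> Arr C" "Dom C g = Cod C f"
  shows "g \<cdot> f \<in> Arr C" "Dom C (g \<cdot> f) = Dom C f" "Cod C (g \<cdot> f) = Cod C g"
  using Comp_in_Hom[of f "Dom C f" "Cod C f" g "Cod C g"] assms by (auto simp: Hom_iff)

lemma Comp_Id_simps [simp]:
  assumes "f \<in> Arr C"
  shows "Dom C f = A \<Longrightarrow> f \<cdot> \<^bold>1 A = f" "Cod C f = A \<Longrightarrow> \<^bold>1 A \<cdot> f = f"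
  using assms Comp_Id[of f A "Cod C f"] Id_Comp[of f "Dom C f" A] by (auto simp: Hom_iff)

lemma Comp_assoc_simp [simp]:
  assumes "f \<in> Arr C" "g \<in> Arr C" "h \<in> Arr C" "Dom C g = Cod C f" "Dom C h = Cod C g"
  shows "(h \<cdot> g) \<cdot> f = h \<cdot> (g \<cdot> f)"
  using assms Comp_assoc[of f "Dom C f" "Cod C f" g "Cod C g" h "Cod C h"] by (auto simp: Hom_iff)

text \<open>Composites are normalised to right-nested form, where \<open>g \<cdot> f\<close> no
  longer occurs as a subterm once something is composed on the right. This turns an equation for
  \<open>g \<cdot> f\<close> into a rewrite rule for that form.\<close>

lemma reassoc:
  assumes "g \<cdot> f = k" "f \<in> Arr C" "g \<in> Arr C" "Dom C g = Cod C f" "h \<in> Arr C" "Cod C h = Dom C f"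
  shows "g \<cdot> (f \<cdot> h) = k \<cdot> h"
  using assms(1)[symmetric] assms(2-) by simp

lemma inverse_arrows_unique:
  assumes "inverse_arrows C f g" "inverse_arrows C f h"
  shows "g = h"
proof -
  have *: "f \<in> Arr C" "g \<in> Arr C" "h \<in> Arr C" "Dom C g = Cod C f" "Dom C h = Cod C f"
    "Cod C g = Dom C f" "Cod C h = Dom C f" "g \<cdot> f = \<^bold>1 (Dom C f)" "f \<cdot> h = \<^bold>1 (Cod C f)"
    using assms by (auto simp: inverse_arrows_def Hom_iff)
  have "g = g \<cdot> (f \<cdot> h)" using * by simp
  also have "\<dots> = (g \<cdot> f) \<cdot> h" using *(1-7) by simp
  also have "\<dots> = h" using * by simp
  finally show ?thesis .
qed

lemma inv_arrow_eqI:
  assumes "inverse_arrows C f g"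
  shows "inv_arrow C f = g"
  unfolding inv_arrow_def using assms inverse_arrows_unique by blast

lemma inverse_inv_arrow:
  assumes "iso_arrow C f"
  shows "inverse_arrows C f (inv_arrow C f)"
  using assms inv_arrow_eqI unfolding iso_arrow_def by metis

lemma iso_simps [simp]:
  assumes "iso_arrow C f"
  shows "inv_arrow C f \<in> Arr C" "Dom C (inv_arrow C f) = Cod C f" "Cod C (inv_arrow C f) = Dom C f"
    "f \<cdot> inv_arrow C f = \<^bold>1 (Cod C f)" "inv_arrow C f \<cdot> f = \<^bold>1 (Dom C f)"
  using inverse_inv_arrow[OF assms] by (auto simp: inverse_arrows_def Hom_iff)

lemma iso_arrow_Arr: "iso_arrow C f \<Longrightarrow> f \<in> Arr C"
  by (auto simp: iso_arrow_def inverse_arrows_def)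

lemma iso_tail_simps [simp]:
  assumes "iso_arrow C f" "h \<in> Arr C"
  shows "Cod C h = Cod C f \<Longrightarrow> f \<cdot> (inv_arrow C f \<cdot> h) = h"
    "Cod C h = Dom C f \<Longrightarrow> inv_arrow C f \<cdot> (f \<cdot> h) = h"
  using assms iso_arrow_Arr[OF assms(1)] by (simp_all flip: Comp_assoc_simp)

lemma iso_cancel_right:
  assumes "iso_arrow C f" "g \<in> Arr C" "h \<in> Arr C" "Dom C g = Cod C f" "Dom C h = Cod C f" "g \<cdot> f = h \<cdot> f"
  shows "g = h"
proof -
  have "(g \<cdot> f) \<cdot> inv_arrow C f = (h \<cdot> f) \<cdot> inv_arrow C f" using assms(6) by simp
  then show ?thesis using assms(1-5) iso_arrow_Arr[OF assms(1)] by simp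
qed

lemma iso_cancel_left:
  assumes "iso_arrow C f" "g \<in> Arr C" "h \<in> Arr C" "Cod C g = Dom C f" "Cod C h = Dom C f" "f \<cdot> g = f \<cdot> h"
  shows "g = h"
proof -
  have "inv_arrow C f \<cdot> (f \<cdot> g) = inv_arrow C f \<cdot> (f \<cdot> h)" using assms(6) by simp
  then show ?thesis using assms(1-5) by simp
qed

lemma iso_arrowI:
  assumes "f \<in> Arr C" "g \<in> Arr C" "Dom C g = Cod C f" "Cod C g = Dom C f"
    "g \<cdot> f = \<^bold>1 (Dom C f)" "f \<cdot> g = \<^bold>1 (Cod C f)"
  shows "iso_arrow C f"
  using assms by (auto simp: iso_arrow_def inverse_arrows_def Hom_iff)

lemma iso_Id [simp]: "A \<in> Obj C \<Longrightarrow> iso_arrow C (\<^bold>1 A)"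
  by (rule iso_arrowI[where g = "\<^bold>1 A"]) auto

lemma iso_Comp [simp]:
  assumes "iso_arrow C f" "iso_arrow C g" "Dom C g = Cod C f"
  shows "iso_arrow C (g \<cdot> f)"
  using assms iso_arrow_Arr[of f] iso_arrow_Arr[of g]
  by (intro iso_arrowI[where g = "inv_arrow C f \<cdot> inv_arrow C g"]) auto

lemma epicD:
  assumes "epic C f" "g \<cdot> f = h \<cdot> f" "g \<in> Arr C" "h \<in> Arr C" "Dom C g = Cod C f" "Dom C h = Cod C f"
    "Cod C g = Cod C h"
  shows "g = h"
  using assms by (auto simp: epic_def Hom_iff)

lemma coequalizer_epic:
  assumes "coequalizer C d0 d1 q" "d0 \<in> Arr C" "d1 \<in> Arr C" "Dom C d0 = Dom C d1" "Cod C d0 = Cod C d1"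
  shows "epic C q"
  unfolding epic_def
proof (intro conjI allI ballI impI)
  have q: "q \<in> Arr C" "Dom C q = Cod C d0" "q \<cdot> d0 = q \<cdot> d1"
    and u: "\<And>B g. g \<in> Hom C (Cod C d0) B \<Longrightarrow> g \<cdot> d0 = g \<cdot> d1 \<Longrightarrow> \<exists>!h. h \<in> Hom C (Cod C q) B \<and> h \<cdot> q = g"
    using assms(1) by (auto simp: coequalizer_def)
  then show "q \<in> Arr C" by blast
  fix A g h assume gh: "g \<in> Hom C (Cod C q) A" "h \<in> Hom C (Cod C q) A" "g \<cdot> q = h \<cdot> q"
  have "(g \<cdot> q) \<cdot> d0 = (g \<cdot> q) \<cdot> d1" using q gh assms by (simp add: Hom_iff)
  then show "g = h" using u[of "g \<cdot> q" A] gh q by (auto simp: Hom_iff)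
qed

text \<open>Both arrows mediate the same cocone \<open>\<lambda>n. g \<cdot> j n\<close>, so
  uniqueness applies: the colimit legs are jointly epic.\<close>

lemma sequential_colimit_joint:
  assumes "sequential_colimit C x L j" "g \<in> Arr C" "h \<in> Arr C" "Dom C g = L" "Dom C h = L"
    "Cod C g = Cod C h" "\<And>n. g \<cdot> j n = h \<cdot> j n" "sequential_diagram C x"
  shows "g = h"
proof -
  have j: "\<And>n. j n \<in> Arr C \<and> Dom C (j n) = Dom C (x n) \<and> Cod C (j n) = L \<and> j (Suc n) \<cdot> x n = j n"
    and u: "\<And>B g. sequential_cocone C x B g \<Longrightarrow> (\<exists>!h. h \<in> Hom C L B \<and> (\<forall>n. h \<cdot> j n = g n))"
    using assms(1) by (auto simp: sequential_colimit_def sequential_cocone_def Hom_iff)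
  have "sequential_cocone C x (Cod C g) (\<lambda>n. g \<cdot> j n)"
    using assms j by (simp add: sequential_cocone_def Hom_iff sequential_diagram_def)
  then show ?thesis using u[of "Cod C g" "\<lambda>n. g \<cdot> j n"] assms(2-7) by (auto simp: Hom_iff)
qed

lemma sequential_colimit_ex:
  assumes "sequential_colimit C x L j" "sequential_cocone C x B g"
  shows "\<exists>h. h \<in> Arr C \<and> Dom C h = L \<and> Cod C h = B \<and> (\<forall>n. h \<cdot> j n = g n)"
  using assms unfolding sequential_colimit_def Hom_iff by blast

end

section \<open>Addition and subtraction of arrows\<close>

context preadditive_category
begin

lemma hom_group_carrier [simp]: "carrier (hom_group C A B) = Hom C A B"
  "mult (hom_group C A B) = plus_arrow C" "one (hom_group C A B) = zero_arrow C A B"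
  by (simp_all add: hom_group_def)

lemma zero_simps [simp]:
  assumes "A \<in> Obj C" "B \<in> Obj C"
  shows "zero_arrow C A B \<in> Arr C" "Dom C (zero_arrow C A B) = A" "Cod C (zero_arrow C A B) = B"
proof -
  interpret comm_group "hom_group C A B" using assms by (rule comm_group_Hom)
  show "zero_arrow C A B \<in> Arr C" "Dom C (zero_arrow C A B) = A" "Cod C (zero_arrow C A B) = B"
    using one_closed by (auto simp: Hom_iff)
qed

context
  fixes f g
  assumes fg: "f \<in> Arr C" "g \<in> Arr C" "Dom C f = Dom C g" "Cod C f = Cod C g"
begin

interpretation comm_group "hom_group C (Dom C f) (Cod C f)"
  by (rule comm_group_Hom) (use fg in auto)

lemma plus_simps [simp]:
  "plus_arrow C f g \<in> Arr C" "Dom C (plus_arrow C f g) = Dom C g" "Cod C (plus_arrow C f g) = Cod C g"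
  using m_closed[of f g] fg by (auto simp: Hom_iff)

lemma plus_comm: "plus_arrow C f g = plus_arrow C g f"
  using m_comm[of f g] fg by (auto simp: Hom_iff)

lemma plus_assoc:
  assumes "h \<in> Arr C" "Dom C h = Dom C g" "Cod C h = Cod C g"
  shows "plus_arrow C (plus_arrow C f g) h = plus_arrow C f (plus_arrow C g h)"
  using m_assoc[of f g h] fg assms by (auto simp: Hom_iff)

lemma plus_left_cancel:
  assumes "h \<in> Arr C" "Dom C h = Dom C g" "Cod C h = Cod C g" "plus_arrow C f g = plus_arrow C f h"
  shows "g = h"
proof -
  have c: "f \<in> Hom C (Dom C f) (Cod C f)" "g \<in> Hom C (Dom C f) (Cod C f)" "h \<in> Hom C (Dom C f) (Cod C f)"
    using fg assms(1-3) by (simp_all add: Hom_iff)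
  then have "plus_arrow C g f = plus_arrow C h f"
    using assms(4) m_comm by (metis hom_group_carrier(1,2))
  then show ?thesis using right_cancel[of f g h] c by simp
qed

lemma plus_zero [simp]:
  assumes "A = Dom C f" "B = Cod C f"
  shows "plus_arrow C f (zero_arrow C A B) = f" "plus_arrow C (zero_arrow C A B) f = f"
  using r_one[of f] l_one[of f] fg assms by (auto simp: Hom_iff)

lemma minus_simps [simp]:
  "minus_arrow C f g \<in> Arr C" "Dom C (minus_arrow C f g) = Dom C g" "Cod C (minus_arrow C f g) = Cod C g"
  "plus_arrow C (minus_arrow C f g) g = f"
proof -
  have i: "f \<in> carrier (hom_group C (Dom C f) (Cod C f))"
    "g \<in> carrier (hom_group C (Dom C f) (Cod C f))" using fg by (auto simp: Hom_iff)
  have m: "minus_arrow C f g = f \<otimes>\<^bsub>hom_group C (Dom C f) (Cod C f)\<^esub> inv\<^bsub>hom_group C (Dom C f) (Cod C f)\<^esub> g"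
    using fg by (simp add: minus_arrow_def)
  have "minus_arrow C f g \<in> carrier (hom_group C (Dom C f) (Cod C f))"
    unfolding m using i by (intro m_closed inv_closed)
  then show "minus_arrow C f g \<in> Arr C" "Dom C (minus_arrow C f g) = Dom C g"
    "Cod C (minus_arrow C f g) = Cod C g" using fg by (auto simp: Hom_iff)
  show "plus_arrow C (minus_arrow C f g) g = f"
    using m_assoc[OF i(1) inv_closed[OF i(2)] i(2)] l_inv[OF i(2)] r_one[OF i(1)] unfolding m by simp
qed

end

lemma plus_zero' [simp]:
  assumes "f \<in> Arr C" "A = Dom C f" "B = Cod C f"
  shows "plus_arrow C f (zero_arrow C A B) = f" "plus_arrow C (zero_arrow C A B) f = f"
  using assms plus_zero[of f f] by simp_all

lemma Comp_plus_simp [simp]: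
  assumes "f \<in> Arr C" "g \<in> Arr C" "Dom C f = Dom C g" "Cod C f = Cod C g" "h \<in> Arr C" 
  shows "Dom C h = Cod C g \<Longrightarrow> h \<cdot> plus_arrow C f g = plus_arrow C (h \<cdot> f) (h \<cdot> g)"
    "Cod C h = Dom C g \<Longrightarrow> plus_arrow C f g \<cdot> h = plus_arrow C (f \<cdot> h) (g \<cdot> h)"
  using assms Comp_plus[of f "Dom C g" "Cod C g" g h] plus_Comp[of h "Dom C h" "Dom C g" f "Cod C g" g]
  by (auto simp: Hom_iff)

lemma plus_idem_zero:
  assumes "f \<in> Arr C" "plus_arrow C f f = f"
  shows "f = zero_arrow C (Dom C f) (Cod C f)"
  using assms plus_left_cancel[of f f "zero_arrow C (Dom C f) (Cod C f)"] by simp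

lemma zero_Comp [simp]:
  assumes "h \<in> Arr C" "A \<in> Obj C" "B \<in> Obj C"
  shows "Dom C h = B \<Longrightarrow> h \<cdot> zero_arrow C A B = zero_arrow C A (Cod C h)"
    "Cod C h = A \<Longrightarrow> zero_arrow C A B \<cdot> h = zero_arrow C (Dom C h) B"
proof -
  have p: "plus_arrow C (zero_arrow C A B) (zero_arrow C A B) = zero_arrow C A B"
    using assms by simp
  { assume "Dom C h = B"
    then have "plus_arrow C (h \<cdot> zero_arrow C A B) (h \<cdot> zero_arrow C A B) = h \<cdot> zero_arrow C A B"
      using assms p by (simp flip: Comp_plus_simp)
    then show "h \<cdot> zero_arrow C A B = zero_arrow C A (Cod C h)"
      using plus_idem_zero[of "h \<cdot> zero_arrow C A B"] assms \<open>Dom C h = B\<close> by simp }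
  { assume "Cod C h = A"
    then have "plus_arrow C (zero_arrow C A B \<cdot> h) (zero_arrow C A B \<cdot> h) = zero_arrow C A B \<cdot> h"
      using Comp_plus_simp(2)[of "zero_arrow C A B" "zero_arrow C A B" h] assms p
      by (simp del: Comp_plus_simp)
    then show "zero_arrow C A B \<cdot> h = zero_arrow C (Dom C h) B"
      using plus_idem_zero[of "zero_arrow C A B \<cdot> h"] assms \<open>Cod C h = A\<close> by simp }
qed

text \<open>Characterises the difference as the solution of \<open>h + g = f\<close>, so that later
  computations with \<open>minus_arrow\<close> avoid inverses in the hom groups.\<close>

lemma minus_eqI:
  assumes "f \<in> Arr C" "g \<in> Arr C" "Dom C f = Dom C g" "Cod C f = Cod C g"
    "h \<in> Arr C" "Dom C h = Dom C g" "Cod C h = Cod C g" "plus_arrow C h g = f"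
  shows "minus_arrow C f g = h"
proof (rule plus_left_cancel[of g])
  have "plus_arrow C g (minus_arrow C f g) = f"
    using assms(1-4) plus_comm[of "minus_arrow C f g" g] by simp
  also have "\<dots> = plus_arrow C g h" using assms(2,5-8) plus_comm[of h g] by simp
  finally show "plus_arrow C g (minus_arrow C f g) = plus_arrow C g h" .
qed (use assms(1-7) in simp_all)

lemma minus_self:
  assumes "f \<in> Arr C"
  shows "minus_arrow C f f = zero_arrow C (Dom C f) (Cod C f)"
  using assms by (intro minus_eqI) auto

lemma Comp_minus:
  assumes "f \<in> Arr C" "g \<in> Arr C" "Dom C f = Dom C g" "Cod C f = Cod C g" "h \<in> Arr C" 
  shows "Dom C h = Cod C g \<Longrightarrow> h \<cdot> minus_arrow C f g = minus_arrow C (h \<cdot> f) (h \<cdot> g)"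
    "Cod C h = Dom C g \<Longrightarrow> minus_arrow C f g \<cdot> h = minus_arrow C (f \<cdot> h) (g \<cdot> h)"
proof -
  show "Dom C h = Cod C g \<Longrightarrow> h \<cdot> minus_arrow C f g = minus_arrow C (h \<cdot> f) (h \<cdot> g)"
    using assms by (intro minus_eqI[symmetric]) (simp_all flip: Comp_plus_simp)
  show "Cod C h = Dom C g \<Longrightarrow> minus_arrow C f g \<cdot> h = minus_arrow C (f \<cdot> h) (g \<cdot> h)"
    using assms by (intro minus_eqI[symmetric]) (simp_all flip: Comp_plus_simp)
qed

lemma minus_zero_eq:
  assumes "f \<in> Arr C" "g \<in> Arr C" "Dom C f = Dom C g" "Cod C f = Cod C g"
    "minus_arrow C f g = zero_arrow C A B" "A = Dom C g" "B = Cod C g"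
  shows "f = g"
  using minus_simps(4)[of f g] assms by simp

end

section \<open>Abelian categories and functors preserving reflexive coequalizers\<close>

text \<open>Companion of \<open>proj2\<close>, read off from the same chosen tuple
  \<open>biprod C A B\<close>, so that the biproduct equations hold between it and the other
  structure arrows.\<close>

definition proj1 :: "('o, 'm, 'x) preadditive_category_scheme \<Rightarrow> 'o \<Rightarrow> 'o \<Rightarrow> 'm" where
  "proj1 C A B = (case biprod C A B of (S, i1, i2, p1, p2) \<Rightarrow> p1)"

context abelian_category
begin

lemma biproduct_biprod:
  assumes "A \<in> Obj C" "B \<in> Obj C"
  shows "biproduct C A B (dsum C A B) (inj1 C A B) (inj2 C A B) (proj1 C A B) (proj2 C A B)"
proof -
  have "\<exists>t. case t of (S, i1, i2, p1, p2) \<Rightarrow> biproduct C A B S i1 i2 p1 p2"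
    using ex_biproduct[OF assms] by auto
  then have "case biprod C A B of (S, i1, i2, p1, p2) \<Rightarrow> biproduct C A B S i1 i2 p1 p2"
    unfolding biprod_def by (rule someI_ex)
  then show ?thesis
    by (auto simp: dsum_def inj1_def inj2_def proj1_def proj2_def split: prod.splits)
qed

context
  fixes A B
  assumes AB [simp]: "A \<in> Obj C" "B \<in> Obj C"
begin

lemma biprod_simps [simp]:
  "inj1 C A B \<in> Arr C" "Dom C (inj1 C A B) = A" "Cod C (inj1 C A B) = dsum C A B"
  "inj2 C A B \<in> Arr C" "Dom C (inj2 C A B) = B" "Cod C (inj2 C A B) = dsum C A B"
  "proj1 C A B \<in> Arr C" "Dom C (proj1 C A B) = dsum C A B" "Cod C (proj1 C A B) = A"
  "proj2 C A B \<in> Arr C" "Dom C (proj2 C A B) = dsum C A B" "Cod C (proj2 C A B) = B"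
  "proj1 C A B \<cdot> inj1 C A B = \<^bold>1 A" "proj2 C A B \<cdot> inj2 C A B = \<^bold>1 B"
  "proj1 C A B \<cdot> inj2 C A B = zero_arrow C B A" "proj2 C A B \<cdot> inj1 C A B = zero_arrow C A B"
  "plus_arrow C (inj1 C A B \<cdot> proj1 C A B) (inj2 C A B \<cdot> proj2 C A B) = \<^bold>1 (dsum C A B)"
  using biproduct_biprod[OF AB] by (auto simp: biproduct_def Hom_iff)

lemma dsum_Obj [simp]: "dsum C A B \<in> Obj C"
  using Dom_Cod_Obj(2)[of "inj1 C A B"] by simp

lemma biprod_tail_simps [simp]:
  assumes "h \<in> Arr C"
  shows "Cod C h = A \<Longrightarrow> proj1 C A B \<cdot> (inj1 C A B \<cdot> h) = h"
    "Cod C h = B \<Longrightarrow> proj2 C A B \<cdot> (inj2 C A B \<cdot> h) = h"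
    "Cod C h = B \<Longrightarrow> proj1 C A B \<cdot> (inj2 C A B \<cdot> h) = zero_arrow C (Dom C h) A"
    "Cod C h = A \<Longrightarrow> proj2 C A B \<cdot> (inj1 C A B \<cdot> h) = zero_arrow C (Dom C h) B"
  using assms by (simp_all flip: Comp_assoc_simp)

text \<open>Composing with \<open>i1 p1 + i2 p2 = id\<close> recovers an arrow out of the sum from
  its two restrictions.\<close>

lemma dsum_eqI:
  assumes "u \<in> Arr C" "v \<in> Arr C" "Dom C u = dsum C A B" "Dom C v = dsum C A B" "Cod C u = Cod C v"
    "u \<cdot> inj1 C A B = v \<cdot> inj1 C A B" "u \<cdot> inj2 C A B = v \<cdot> inj2 C A B"
  shows "u = v"
proof -
  have *: "w = plus_arrow C ((w \<cdot> inj1 C A B) \<cdot> proj1 C A B) ((w \<cdot> inj2 C A B) \<cdot> proj2 C A B)"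
    if "w \<in> Arr C" "Dom C w = dsum C A B" for w
  proof -
    have "w = w \<cdot> plus_arrow C (inj1 C A B \<cdot> proj1 C A B) (inj2 C A B \<cdot> proj2 C A B)"
      using that by (simp del: Comp_plus_simp)
    then show ?thesis using that by (simp del: biprod_simps(17))
  qed
  show ?thesis using *[of u] *[of v] assms by metis
qed

end

text \<open>The sum on the right has the prescribed restrictions, and \<open>dsum_eqI\<close> shows
  that nothing else does. This explicit formula allows copairings to be split into summands
  later.\<close>

lemma copair_eq:
  assumes "f \<in> Arr C" "g \<in> Arr C" "Cod C f = Cod C g"
  shows "copair C f g = plus_arrow C (f \<cdot> proj1 C (Dom C f) (Dom C g)) (g \<cdot> proj2 C (Dom C f) (Dom C g))"
  unfolding copair_def
proof (rule the_equality)
  show "plus_arrow C (f \<cdot> proj1 C (Dom C f) (Dom C g)) (g \<cdot> proj2 C (Dom C f) (Dom C g))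
      \<in> Hom C (dsum C (Dom C f) (Dom C g)) (Cod C f) \<and>
    plus_arrow C (f \<cdot> proj1 C (Dom C f) (Dom C g)) (g \<cdot> proj2 C (Dom C f) (Dom C g)) \<cdot> inj1 C (Dom C f) (Dom C g) = f \<and>
    plus_arrow C (f \<cdot> proj1 C (Dom C f) (Dom C g)) (g \<cdot> proj2 C (Dom C f) (Dom C g)) \<cdot> inj2 C (Dom C f) (Dom C g) = g"
    (is "?h \<in> _ \<and> _") using assms by (simp add: Hom_iff)
  then have H: "?h \<in> Hom C (dsum C (Dom C f) (Dom C g)) (Cod C f)"
    "?h \<cdot> inj1 C (Dom C f) (Dom C g) = f" "?h \<cdot> inj2 C (Dom C f) (Dom C g) = g" by blast+
  show "h = ?h" if "h \<in> Hom C (dsum C (Dom C f) (Dom C g)) (Cod C f) \<and>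
    h \<cdot> inj1 C (Dom C f) (Dom C g) = f \<and> h \<cdot> inj2 C (Dom C f) (Dom C g) = g" for h
  proof (rule dsum_eqI[of "Dom C f" "Dom C g"])
    show "h \<cdot> inj1 C (Dom C f) (Dom C g) = ?h \<cdot> inj1 C (Dom C f) (Dom C g)"
      "h \<cdot> inj2 C (Dom C f) (Dom C g) = ?h \<cdot> inj2 C (Dom C f) (Dom C g)"
      using that H(2,3) by simp_all
  qed (use that H(1) assms(1,2) in \<open>simp_all add: Hom_iff\<close>)
qed

lemma copair_simps [simp]:
  assumes "f \<in> Arr C" "g \<in> Arr C" "Cod C f = Cod C g"
  shows "copair C f g \<in> Arr C" "Dom C (copair C f g) = dsum C (Dom C f) (Dom C g)"
    "Cod C (copair C f g) = Cod C g"
    "A = Dom C f \<Longrightarrow> B = Dom C g \<Longrightarrow> copair C f g \<cdot> inj1 C A B = f"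
    "A = Dom C f \<Longrightarrow> B = Dom C g \<Longrightarrow> copair C f g \<cdot> inj2 C A B = g"
  using assms by (simp_all add: copair_eq)

lemma is_kernel_ker: "f \<in> Arr C \<Longrightarrow> is_kernel C f (ker C f)"
  unfolding ker_def using ex_kernel by (rule someI_ex)

lemma is_cokernel_coker: "f \<in> Arr C \<Longrightarrow> is_cokernel C f (coker C f)"
  unfolding coker_def using ex_cokernel by (rule someI_ex)

lemma ker_simps [simp]:
  assumes "f \<in> Arr C"
  shows "ker C f \<in> Arr C" "Cod C (ker C f) = Dom C f"
    "f \<cdot> ker C f = zero_arrow C (Dom C (ker C f)) (Cod C f)"
  using is_kernel_ker[OF assms] by (simp_all add: is_kernel_def)

lemma coker_simps [simp]:
  assumes "f \<in> Arr C"
  shows "coker C f \<in> Arr C" "Dom C (coker C f) = Cod C f"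
    "coker C f \<cdot> f = zero_arrow C (Dom C f) (Cod C (coker C f))"
  using is_cokernel_coker[OF assms] by (simp_all add: is_cokernel_def)

lemma coker_tail_simp [simp]:
  assumes "f \<in> Arr C" "h \<in> Arr C" "Cod C h = Dom C f"
  shows "coker C f \<cdot> (f \<cdot> h) = zero_arrow C (Dom C h) (Cod C (coker C f))"
  using assms by (simp flip: Comp_assoc_simp)

lemma ker_factor:
  assumes "f \<in> Arr C" "g \<in> Arr C" "Cod C g = Dom C f" "f \<cdot> g = zero_arrow C (Dom C g) (Cod C f)"
  shows "\<exists>h. h \<in> Arr C \<and> Dom C h = Dom C g \<and> Cod C h = Dom C (ker C f) \<and> ker C f \<cdot> h = g"
proof -
  have "\<exists>!h. h \<in> Hom C (Dom C g) (Dom C (ker C f)) \<and> ker C f \<cdot> h = g"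
    using is_kernel_ker[OF assms(1)] assms(2-) unfolding is_kernel_def by (simp add: Hom_iff)
  then show ?thesis by (auto simp: Hom_iff)
qed

lemma coker_factor:
  assumes "f \<in> Arr C" "g \<in> Arr C" "Dom C g = Cod C f" "g \<cdot> f = zero_arrow C (Dom C f) (Cod C g)"
  shows "\<exists>h. h \<in> Arr C \<and> Dom C h = Cod C (coker C f) \<and> Cod C h = Cod C g \<and> h \<cdot> coker C f = g"
proof -
  have "\<exists>!h. h \<in> Hom C (Cod C (coker C f)) (Cod C g) \<and> h \<cdot> coker C f = g"
    using is_cokernel_coker[OF assms(1)] assms(2-) unfolding is_cokernel_def by (simp add: Hom_iff)
  then show ?thesis by (auto simp: Hom_iff)
qed

lemma ker_cancel:
  assumes "f \<in> Arr C" "g \<in> Arr C" "h \<in> Arr C" "Cod C g = Dom C (ker C f)" "Cod C h = Dom C (ker C f)"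
    "Dom C g = Dom C h" "ker C f \<cdot> g = ker C f \<cdot> h"
  shows "g = h"
proof -
  have "f \<cdot> (ker C f \<cdot> h) = zero_arrow C (Dom C h) (Cod C f)"
    using assms(1-6) by (simp flip: Comp_assoc_simp)
  then have "\<exists>!k. k \<in> Hom C (Dom C h) (Dom C (ker C f)) \<and> ker C f \<cdot> k = ker C f \<cdot> h"
    using is_kernel_ker[OF assms(1)] assms(1-6) unfolding is_kernel_def by (simp add: Hom_iff)
  then show ?thesis using assms by (auto simp: Hom_iff)
qed

lemma coker_cancel:
  assumes "f \<in> Arr C" "g \<in> Arr C" "h \<in> Arr C" "Dom C g = Cod C (coker C f)" "Dom C h = Cod C (coker C f)"
    "Cod C g = Cod C h" "g \<cdot> coker C f = h \<cdot> coker C f"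
  shows "g = h"
proof -
  have "\<exists>!k. k \<in> Hom C (Cod C (coker C f)) (Cod C h) \<and> k \<cdot> coker C f = h \<cdot> coker C f"
    using is_cokernel_coker[OF assms(1)] assms(1-6) unfolding is_cokernel_def by (simp add: Hom_iff)
  then show ?thesis using assms by (auto simp: Hom_iff)
qed

lemma img_simps [simp]:
  assumes "f \<in> Arr C"
  shows "img C f \<in> Arr C" "Cod C (img C f) = Cod C f"
    "coker C f \<cdot> img C f = zero_arrow C (Dom C (img C f)) (Cod C (coker C f))"
  using assms by (simp_all add: img_def)

lemma img_factor:
  assumes "f \<in> Arr C"
  shows "\<exists>e. e \<in> Arr C \<and> Dom C e = Dom C f \<and> Cod C e = Dom C (img C f) \<and> img C f \<cdot> e = f"
  unfolding img_def using assms by (intro ker_factor) auto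

text \<open>\<open>f\<close> factors through its image, which gives one direction. Conversely, an
  arrow killing \<open>f\<close> factors through \<open>coker C f\<close>, and the image is by
  definition the kernel of that cokernel.\<close>

lemma Comp_img_zero_iff:
  assumes "f \<in> Arr C" "g \<in> Arr C" "Dom C g = Cod C f"
  shows "g \<cdot> img C f = zero_arrow C (Dom C (img C f)) (Cod C g) \<longleftrightarrow> g \<cdot> f = zero_arrow C (Dom C f) (Cod C g)"
proof
  assume *: "g \<cdot> img C f = zero_arrow C (Dom C (img C f)) (Cod C g)"
  obtain e where e: "e \<in> Arr C" "Dom C e = Dom C f" "Cod C e = Dom C (img C f)" "img C f \<cdot> e = f"
    using img_factor[OF assms(1)] by blast
  have "g \<cdot> f = (g \<cdot> img C f) \<cdot> e" using assms e(1-3) by (simp add: e(4))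
  then show "g \<cdot> f = zero_arrow C (Dom C f) (Cod C g)" using assms e(1-3) by (simp add: *)
next
  assume "g \<cdot> f = zero_arrow C (Dom C f) (Cod C g)"
  then obtain h where h: "h \<in> Arr C" "Dom C h = Cod C (coker C f)" "Cod C h = Cod C g" "h \<cdot> coker C f = g"
    using coker_factor assms by blast
  have "g \<cdot> img C f = h \<cdot> (coker C f \<cdot> img C f)"
    using assms h(1-3) by (simp add: h(4)[symmetric] del: img_simps(3))
  then show "g \<cdot> img C f = zero_arrow C (Dom C (img C f)) (Cod C g)" using assms h(1-3) by simp
qed

text \<open>The arrow \<open>?e = id - s p\<close> projects onto the kernel of \<open>p\<close>
  along \<open>s\<close>; its factor \<open>h\<close> through \<open>ker C p\<close> exhibits the
  codomain of \<open>s\<close> as a direct sum of that kernel and the domain of \<open>s\<close>.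
  Since only \<open>p s = id\<close> enters, this applies to
  \<open>A \<boxtimes> i \<boxtimes> B\<close> and \<open>A \<boxtimes> \<pi> \<boxtimes> B\<close>,
  whose splitting survives every functor.\<close>

lemma split_epi_complement:
  assumes "s \<in> Arr C" "p \<in> Arr C" "Dom C p = Cod C s" "Cod C p = Dom C s" "p \<cdot> s = \<^bold>1 (Dom C s)"
  shows "iso_arrow C (coker C s \<cdot> ker C p)"
    and "\<exists>h. h \<in> Arr C \<and> Dom C h = Cod C s \<and> Cod C h = Dom C (ker C p) \<and>
      plus_arrow C (ker C p \<cdot> h) (s \<cdot> p) = \<^bold>1 (Cod C s)"
proof -
  let ?e = "minus_arrow C (\<^bold>1 (Cod C s)) (s \<cdot> p)"
  let ?k = "ker C p" and ?q = "coker C s"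
  have e [simp]: "?e \<in> Arr C" "Dom C ?e = Cod C s" "Cod C ?e = Cod C s" using assms by simp_all
  have ps: "p \<cdot> (s \<cdot> h) = h" if "h \<in> Arr C" "Cod C h = Dom C s" for h
    using reassoc[OF assms(5)] that assms by simp
  have "p \<cdot> ?e = zero_arrow C (Cod C s) (Dom C s)"
    using assms by (simp add: Comp_minus ps minus_self)
  then obtain h where h [simp]: "h \<in> Arr C" "Dom C h = Cod C s" "Cod C h = Dom C ?k" and kh: "?k \<cdot> h = ?e"
    using ker_factor[of p ?e] assms by auto
  show "\<exists>h. h \<in> Arr C \<and> Dom C h = Cod C s \<and> Cod C h = Dom C ?k \<and>
      plus_arrow C (?k \<cdot> h) (s \<cdot> p) = \<^bold>1 (Cod C s)"
    using assms kh by (intro exI[of _ h]) simp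
  have pk: "p \<cdot> ?k = zero_arrow C (Dom C ?k) (Dom C s)" using assms by simp
  have "?k \<cdot> (h \<cdot> ?k) = ?e \<cdot> ?k" using assms(1-4) by (simp flip: kh)
  also have "\<dots> = ?k"
    using assms(1-4) pk by (simp add: Comp_minus) (intro minus_eqI; simp)
  finally have khk: "?k \<cdot> (h \<cdot> ?k) = ?k" .
  have hk: "h \<cdot> ?k = \<^bold>1 (Dom C ?k)"
    by (rule ker_cancel[of p]) (use assms(1-4) khk in auto)
  have "?k \<cdot> (h \<cdot> s) = ?e \<cdot> s" using assms(1-4) by (simp flip: kh)
  also have "\<dots> = zero_arrow C (Dom C s) (Cod C s)"
    using assms by (simp add: Comp_minus minus_self)
  finally have khs: "?k \<cdot> (h \<cdot> s) = zero_arrow C (Dom C s) (Cod C s)" .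
  have hs: "h \<cdot> s = zero_arrow C (Dom C s) (Dom C ?k)"
    by (rule ker_cancel[of p]) (use assms(1-4) khs in auto)
  \<comment> \<open>\<open>h\<close> vanishes on \<open>s\<close> and so descends to the cokernel;
    the descended \<open>u\<close> is the inverse of \<open>?q \<cdot> ?k\<close>.\<close>
  obtain u where u [simp]: "u \<in> Arr C" "Dom C u = Cod C ?q" "Cod C u = Dom C ?k" and uq: "u \<cdot> ?q = h"
    using coker_factor[of s h] hs assms by auto
  have 1: "u \<cdot> (?q \<cdot> ?k) = \<^bold>1 (Dom C ?k)"
    using reassoc[OF uq, of ?k] hk assms(1-4) by simp
  have "((?q \<cdot> ?k) \<cdot> u) \<cdot> ?q = ?q \<cdot> ?e"
    using assms(1-4) by (simp add: uq kh)
  also have "\<dots> = \<^bold>1 (Cod C ?q) \<cdot> ?q"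
    using assms(1-4) by (simp add: Comp_minus) (intro minus_eqI; simp)
  finally have qkuq: "((?q \<cdot> ?k) \<cdot> u) \<cdot> ?q = \<^bold>1 (Cod C ?q) \<cdot> ?q" .
  have 2: "(?q \<cdot> ?k) \<cdot> u = \<^bold>1 (Cod C ?q)"
    by (rule coker_cancel[of s]) (use assms(1-4) qkuq in auto)
  show "iso_arrow C (?q \<cdot> ?k)"
    by (rule iso_arrowI[of _ u]) (use assms 1 2 in auto)
qed

lemma zero_subobject_eq:
  assumes "Y \<in> Obj C"
  shows "\<exists>Z \<in> Obj C. zero_subobject C Y = zero_arrow C Z Y"
proof -
  have "zero_object C (SOME Z. zero_object C Z)" using ex_zero_object by (rule someI_ex)
  then show ?thesis unfolding zero_subobject_def zero_object_def by blast
qed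

lemma subobject_sum_simps [simp]:
  assumes "Y \<in> Obj C" "\<And>i. i < k \<Longrightarrow> r i \<in> Arr C \<and> Cod C (r i) = Y"
  shows "subobject_sum C Y r k \<in> Arr C \<and> Cod C (subobject_sum C Y r k) = Y"
  using assms(2)
proof (induction k)
  case 0
  then show ?case using zero_subobject_eq[OF assms(1)] assms(1) by auto
qed simp

text \<open>An arrow killing an image kills the copairing behind it, hence each of the two summands;
  induction peels them off one at a time.\<close>

lemma Comp_subobject_sum_zero:
  assumes "Y \<in> Obj C" "\<And>i. i < k \<Longrightarrow> r i \<in> Arr C \<and> Cod C (r i) = Y" "g \<in> Arr C" "Dom C g = Y"
    "g \<cdot> subobject_sum C Y r k = zero_arrow C (Dom C (subobject_sum C Y r k)) (Cod C g)" "i < k"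
  shows "g \<cdot> r i = zero_arrow C (Dom C (r i)) (Cod C g)"
  using assms(2,5,6)
proof (induction k)
  case (Suc k)
  let ?s = "subobject_sum C Y r k"
  have s [simp]: "?s \<in> Arr C" "Cod C ?s = Y" "r k \<in> Arr C" "Cod C (r k) = Y"
    using subobject_sum_simps[OF assms(1), of k r] Suc.prems(1) by auto
  have z: "g \<cdot> copair C ?s (r k) = zero_arrow C (dsum C (Dom C ?s) (Dom C (r k))) (Cod C g)"
    using Suc.prems(2) Comp_img_zero_iff[of "copair C ?s (r k)" g] assms(1,3,4) by simp
  have "g \<cdot> ?s = (g \<cdot> copair C ?s (r k)) \<cdot> inj1 C (Dom C ?s) (Dom C (r k))"
    using assms(1,3,4) by simp
  then have 1: "g \<cdot> ?s = zero_arrow C (Dom C ?s) (Cod C g)" unfolding z using assms(1,3,4) by simp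
  have "g \<cdot> r k = (g \<cdot> copair C ?s (r k)) \<cdot> inj2 C (Dom C ?s) (Dom C (r k))"
    using assms(1,3,4) by simp
  then have 2: "g \<cdot> r k = zero_arrow C (Dom C (r k)) (Cod C g)" unfolding z using assms(1,3,4) by simp
  show ?case using 1 2 Suc by (cases "i = k") auto
qed simp

text \<open>Both legs restrict to the identity on the summand \<open>Cod C r\<close>, which makes
  \<open>inj2\<close> a common section. On the other summand they are \<open>r\<close> and zero, so
  coequalizing the pair means killing \<open>r\<close>.\<close>

lemma coequalizer_coker:
  assumes "r \<in> Arr C"
  shows "coequalizer C (copair C r (\<^bold>1 (Cod C r))) (proj2 C (Dom C r) (Cod C r)) (coker C r)"
    and "reflexive_pair C (copair C r (\<^bold>1 (Cod C r))) (proj2 C (Dom C r) (Cod C r))"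
proof -
  let ?d0 = "copair C r (\<^bold>1 (Cod C r))" and ?d1 = "proj2 C (Dom C r) (Cod C r)"
  show "reflexive_pair C ?d0 ?d1"
    unfolding reflexive_pair_def
    using assms by (intro exI[of _ "dsum C (Dom C r) (Cod C r)"] exI[of _ "Cod C r"] conjI
        bexI[of _ "inj2 C (Dom C r) (Cod C r)"]) (auto simp: Hom_iff)
  have *: "g \<cdot> ?d0 = g \<cdot> ?d1 \<longleftrightarrow> g \<cdot> r = zero_arrow C (Dom C r) (Cod C g)"
    if g: "g \<in> Arr C" "Dom C g = Cod C r" for g
  proof
    assume "g \<cdot> ?d0 = g \<cdot> ?d1"
    then have "(g \<cdot> ?d0) \<cdot> inj1 C (Dom C r) (Cod C r) = (g \<cdot> ?d1) \<cdot> inj1 C (Dom C r) (Cod C r)" by simp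
    then show "g \<cdot> r = zero_arrow C (Dom C r) (Cod C g)" using g assms by simp
  next
    assume z: "g \<cdot> r = zero_arrow C (Dom C r) (Cod C g)"
    show "g \<cdot> ?d0 = g \<cdot> ?d1"
      by (rule dsum_eqI[of "Dom C r" "Cod C r"]) (use z g assms in auto)
  qed
  have u: "\<exists>!h. h \<in> Hom C (Cod C (coker C r)) B \<and> h \<cdot> coker C r = g"
    if "g \<in> Hom C (Cod C r) B" "g \<cdot> r = zero_arrow C (Dom C r) B" for g B
    using is_cokernel_coker[OF assms] that unfolding is_cokernel_def by blast
  show "coequalizer C ?d0 ?d1 (coker C r)"
    unfolding coequalizer_def
  proof (intro conjI allI ballI impI)
    show "coker C r \<cdot> ?d0 = coker C r \<cdot> ?d1" using *[of "coker C r"] assms by simp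
    show "\<exists>!h. h \<in> Hom C (Cod C (coker C r)) B \<and> h \<cdot> coker C r = g"
      if "g \<in> Hom C (Cod C ?d0) B" "g \<cdot> ?d0 = g \<cdot> ?d1" for g B
      using that u[of g B] *[of g] assms by (simp add: Hom_iff)
  qed (use assms in auto)
qed

end

text \<open>Designed for \<open>A \<boxtimes> -\<close>, \<open>- \<boxtimes> B\<close> and their
  composites, which may fail to be additive: all cokernel arguments have to go through reflexive
  coequalizers.\<close>

locale reflexive_functor = abelian_category C
  for C :: "('o, 'm, 'x) preadditive_category_scheme" (structure) +
  fixes Fo :: "'o \<Rightarrow> 'o" and Fm :: "'m \<Rightarrow> 'm"
  assumes Fm_simps [simp]: "f \<in> Arr C \<Longrightarrow> Fm f \<in> Arr C" "f \<in> Arr C \<Longrightarrow> Dom C (Fm f) = Fo (Dom C f)"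
      "f \<in> Arr C \<Longrightarrow> Cod C (Fm f) = Fo (Cod C f)"
    and Fm_Id [simp]: "A \<in> Obj C \<Longrightarrow> Fm (\<^bold>1 A) = \<^bold>1 (Fo A)"
    and Fm_Comp: "\<lbrakk>f \<in> Arr C; g \<in> Arr C; Dom C g = Cod C f\<rbrakk> \<Longrightarrow> Fm (g \<cdot> f) = Fm g \<cdot> Fm f"
    and preserves: "preserves_reflexive_coequalizers C Fm"
begin

lemma Fo_Obj [simp]: "A \<in> Obj C \<Longrightarrow> Fo A \<in> Obj C"
  using Dom_Cod_Obj(1)[of "Fm (\<^bold>1 A)"] by (simp del: Fm_Id)

lemma coequalizer_Fm_coker:
  assumes "r \<in> Arr C"
  shows "coequalizer C (Fm (copair C r (\<^bold>1 (Cod C r)))) (Fm (proj2 C (Dom C r) (Cod C r))) (Fm (coker C r))"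
  using preserves coequalizer_coker[OF assms] unfolding preserves_reflexive_coequalizers_def by blast

lemma epic_Fm_coker: "r \<in> Arr C \<Longrightarrow> epic C (Fm (coker C r))"
  using coequalizer_epic[OF coequalizer_Fm_coker] by simp

text \<open>Records only the existence of a descent along \<open>Fm (coker C r)\<close>; uniqueness
  is supplied by \<open>epic_Fm_coker\<close>.\<close>

definition factors :: "'m \<Rightarrow> 'm \<Rightarrow> bool" where
  "factors g r \<longleftrightarrow> (\<exists>h. h \<in> Arr C \<and> Dom C h = Fo (Cod C (coker C r)) \<and> Cod C h = Cod C g \<and> h \<cdot> Fm (coker C r) = g)"

lemma factorsI:
  assumes "r \<in> Arr C" "g \<in> Arr C" "Dom C g = Fo (Cod C r)"
    "g \<cdot> Fm (copair C r (\<^bold>1 (Cod C r))) = g \<cdot> Fm (proj2 C (Dom C r) (Cod C r))"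
  shows "factors g r"
proof -
  have "\<exists>!h. h \<in> Hom C (Cod C (Fm (coker C r))) (Cod C g) \<and> h \<cdot> Fm (coker C r) = g"
    using coequalizer_Fm_coker[OF assms(1)] assms by (auto simp: coequalizer_def Hom_iff)
  then show ?thesis using assms by (auto simp: factors_def Hom_iff)
qed

text \<open>If \<open>g = h \<cdot> Fm (coker C r)\<close>, then \<open>g \<cdot> Fm x\<close>
  depends only on \<open>coker C r \<cdot> x\<close>. This is the substitute for linearity: altering
  \<open>x\<close> modulo \<open>r\<close> inside the functor is invisible to
  \<open>g\<close>.\<close>

lemma factors_eq:
  assumes "factors g r" "r \<in> Arr C" "x \<in> Arr C" "y \<in> Arr C" "Cod C x = Cod C r" "Cod C y = Cod C r"
    "coker C r \<cdot> x = coker C r \<cdot> y"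
  shows "g \<cdot> Fm x = g \<cdot> Fm y"
proof -
  obtain h where h: "h \<in> Arr C" "Dom C h = Fo (Cod C (coker C r))" "h \<cdot> Fm (coker C r) = g"
    using assms(1) by (auto simp: factors_def)
  have *: "g \<cdot> Fm z = h \<cdot> Fm (coker C r \<cdot> z)" if "z \<in> Arr C" "Cod C z = Cod C r" for z
    using assms(2) h(1,2) that by (simp add: Fm_Comp h(3)[symmetric])
  show ?thesis using * assms by simp
qed

lemma factors_zero:
  assumes "g \<in> Arr C" "A \<in> Obj C" "Y \<in> Obj C" "Dom C g = Fo Y"
  shows "factors g (zero_arrow C A Y)"
proof -
  have "copair C (zero_arrow C A Y) (\<^bold>1 Y) = proj2 C A Y"
    by (rule dsum_eqI[of A Y]) (use assms in auto)
  then show ?thesis using assms by (intro factorsI) auto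
qed

text \<open>The two relations are removed one after the other by \<open>factors_eq\<close>: the
  first leg is \<open>r1 p1 + (r2 p2 + q)\<close>, which agrees with \<open>r2 p2 + q\<close> modulo
  \<open>r1\<close>, and this agrees with the projection \<open>q\<close> modulo
  \<open>r2\<close>.\<close>

lemma factors_copair:
  assumes [simp]: "g \<in> Arr C" "r1 \<in> Arr C" "r2 \<in> Arr C" "Cod C r1 = Y" "Cod C r2 = Y" "Dom C g = Fo Y"
    and "factors g r1" "factors g r2"
  shows "factors g (copair C r1 r2)"
proof (rule factorsI)
  have Y [simp]: "Y \<in> Obj C" using Dom_Cod_Obj(2)[of r1] by simp
  let ?R1 = "Dom C r1" and ?R2 = "Dom C r2"
  let ?S = "dsum C ?R1 ?R2"
  let ?p = "proj1 C ?S Y" and ?q = "proj2 C ?S Y"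
  let ?x = "plus_arrow C (r2 \<cdot> (proj2 C ?R1 ?R2 \<cdot> ?p)) ?q"
  have "copair C (copair C r1 r2) (\<^bold>1 Y) = plus_arrow C (r1 \<cdot> (proj1 C ?R1 ?R2 \<cdot> ?p)) ?x"
    by (simp add: copair_eq plus_assoc)
  then have "g \<cdot> Fm (copair C (copair C r1 r2) (\<^bold>1 Y)) = g \<cdot> Fm ?x"
    by (simp, intro factors_eq[OF assms(7)]) simp_all
  also have "\<dots> = g \<cdot> Fm ?q"
    by (intro factors_eq[OF assms(8)]) simp_all
  finally show "g \<cdot> Fm (copair C (copair C r1 r2) (\<^bold>1 (Cod C (copair C r1 r2)))) =
    g \<cdot> Fm (proj2 C (Dom C (copair C r1 r2)) (Cod C (copair C r1 r2)))" by simp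
qed auto

text \<open>The cokernel of \<open>r\<close> also kills \<open>img C r\<close>, so the two legs
  belonging to the image already agree modulo \<open>r\<close>.\<close>

lemma factors_img:
  assumes [simp]: "g \<in> Arr C" "r \<in> Arr C" "Dom C g = Fo (Cod C r)" and "factors g r"
  shows "factors g (img C r)"
proof (rule factorsI)
  have "g \<cdot> Fm (copair C (img C r) (\<^bold>1 (Cod C r))) = g \<cdot> Fm (proj2 C (Dom C (img C r)) (Cod C r))"
    by (rule factors_eq[OF assms(4)], simp_all, rule dsum_eqI[of "Dom C (img C r)" "Cod C r"]) simp_all
  then show "g \<cdot> Fm (copair C (img C r) (\<^bold>1 (Cod C (img C r)))) =
    g \<cdot> Fm (proj2 C (Dom C (img C r)) (Cod C (img C r)))" by simp
qed auto

lemma factors_subobject_sum: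
  assumes "g \<in> Arr C" "Y \<in> Obj C" "Dom C g = Fo Y"
    "\<And>i. i < k \<Longrightarrow> r i \<in> Arr C \<and> Cod C (r i) = Y \<and> factors g (r i)"
  shows "factors g (subobject_sum C Y r k)"
  using assms(4)
proof (induction k)
  case 0
  obtain Z where "Z \<in> Obj C" "zero_subobject C Y = zero_arrow C Z Y"
    using zero_subobject_eq[OF assms(2)] by blast
  then show ?case using factors_zero[OF assms(1) _ assms(2,3)] by simp
next
  case (Suc k)
  then have "subobject_sum C Y r k \<in> Arr C \<and> Cod C (subobject_sum C Y r k) = Y"
    using assms(2) by (intro subobject_sum_simps) auto
  then show ?case using Suc assms(1-3) by (auto intro!: factors_img factors_copair[where Y = Y])
qed

end

section \<open>Coherence of the tensor powers\<close>

declare tensor_pow.simps [simp del] pow_iso.simps [simp del]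

context monoidal_abelian_category
begin

lemma tensor_obj_simp [simp]: "A \<in> Obj C \<Longrightarrow> B \<in> Obj C \<Longrightarrow> A \<boxtimes> B \<in> Obj C"
  by (rule tensor_obj)

lemma unit_obj_simp [simp]: "\<I> \<in> Obj C"
  by (rule unit_obj)

lemma tensor_simps [simp]:
  assumes "f \<in> Arr C" "g \<in> Arr C"
  shows "f \<star> g \<in> Arr C" "Dom C (f \<star> g) = Dom C f \<boxtimes> Dom C g" "Cod C (f \<star> g) = Cod C f \<boxtimes> Cod C g"
  using tensor_arr[of f "Dom C f" "Cod C f" g "Dom C g" "Cod C g"] assms by (simp_all add: Hom_iff)

lemma tensor_Id_simp [simp]: "A \<in> Obj C \<Longrightarrow> B \<in> Obj C \<Longrightarrow> \<^bold>1 A \<star> \<^bold>1 B = \<^bold>1 (A \<boxtimes> B)"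
  by (rule tensor_Id)

lemma interchange:
  assumes "f \<in> Arr C" "f' \<in> Arr C" "g \<in> Arr C" "g' \<in> Arr C" "Dom C f' = Cod C f" "Dom C g' = Cod C g"
  shows "(f' \<star> g') \<cdot> (f \<star> g) = (f' \<cdot> f) \<star> (g' \<cdot> g)"
  using assms tensor_Comp[of f "Dom C f" "Cod C f" f' "Cod C f'" g "Dom C g" "Cod C g" g' "Cod C g'"]
  by (simp add: Hom_iff)

lemma interchange_tail:
  assumes "f \<in> Arr C" "f' \<in> Arr C" "g \<in> Arr C" "g' \<in> Arr C" "Dom C f' = Cod C f" "Dom C g' = Cod C g"
    "h \<in> Arr C" "Cod C h = Dom C f \<boxtimes> Dom C g"
  shows "(f' \<star> g') \<cdot> ((f \<star> g) \<cdot> h) = ((f' \<cdot> f) \<star> (g' \<cdot> g)) \<cdot> h"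
  using reassoc[OF interchange] assms by simp

lemmas merge = interchange interchange_tail

text \<open>Distributes one-sided tensoring over composites, where \<open>merge\<close> collects
  tensor factors. As rewrite rules the two directions undo each other, so each computation uses one
  of them.\<close>

lemma whisker:
  assumes "f \<in> Arr C" "g \<in> Arr C" "Dom C g = Cod C f" "A \<in> Obj C"
  shows "\<^bold>1 A \<star> (g \<cdot> f) = (\<^bold>1 A \<star> g) \<cdot> (\<^bold>1 A \<star> f)"
    and "(g \<cdot> f) \<star> \<^bold>1 A = (g \<star> \<^bold>1 A) \<cdot> (f \<star> \<^bold>1 A)"
  using assms by (simp_all add: interchange)

lemma iso_tensor [simp]:
  assumes "iso_arrow C f" "iso_arrow C g"
  shows "iso_arrow C (f \<star> g)"
  by (rule iso_arrowI[where g = "inv_arrow C f \<star> inv_arrow C g"])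
    (use assms iso_arrow_Arr[of f] iso_arrow_Arr[of g] in \<open>simp_all add: interchange\<close>)

lemma assoc_simps [simp]:
  assumes "X \<in> Obj C" "Y \<in> Obj C" "Z \<in> Obj C"
  shows "\<a> X Y Z \<in> Arr C" "Dom C (\<a> X Y Z) = (X \<boxtimes> Y) \<boxtimes> Z" "Cod C (\<a> X Y Z) = X \<boxtimes> (Y \<boxtimes> Z)"
    "iso_arrow C (\<a> X Y Z)"
  using associator[OF assms] by (simp_all add: Hom_iff)

lemma unitor_simps [simp]:
  assumes "X \<in> Obj C"
  shows "\<l> X \<in> Arr C" "Dom C (\<l> X) = \<I> \<boxtimes> X" "Cod C (\<l> X) = X" "iso_arrow C (\<l> X)"
    "\<r> X \<in> Arr C" "Dom C (\<r> X) = X \<boxtimes> \<I>" "Cod C (\<r> X) = X" "iso_arrow C (\<r> X)"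
  using left_unitor[OF assms] right_unitor[OF assms] by (simp_all add: Hom_iff)

lemma assoc_nat:
  assumes "f \<in> Arr C" "g \<in> Arr C" "h \<in> Arr C" "Cod C f = X" "Cod C g = Y" "Cod C h = Z"
  shows "\<a> X Y Z \<cdot> ((f \<star> g) \<star> h) = (f \<star> (g \<star> h)) \<cdot> \<a> (Dom C f) (Dom C g) (Dom C h)"
  using assms associator_natural[of f "Dom C f" X g "Dom C g" Y h "Dom C h" Z] by (simp add: Hom_iff)

lemma assoc_nat_tail:
  assumes "f \<in> Arr C" "g \<in> Arr C" "h \<in> Arr C" "Cod C f = X" "Cod C g = Y" "Cod C h = Z"
    "k \<in> Arr C" "Cod C k = (Dom C f \<boxtimes> Dom C g) \<boxtimes> Dom C h"
  shows "\<a> X Y Z \<cdot> (((f \<star> g) \<star> h) \<cdot> k) = (f \<star> (g \<star> h)) \<cdot> (\<a> (Dom C f) (Dom C g) (Dom C h) \<cdot> k)"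
  using reassoc[OF assoc_nat] assms by auto

lemma assoc_nat_Id:
  assumes "X \<in> Obj C" "Y \<in> Obj C" "h \<in> Arr C" "Cod C h = Z"
  shows "\<a> X Y Z \<cdot> (\<^bold>1 (X \<boxtimes> Y) \<star> h) = (\<^bold>1 X \<star> (\<^bold>1 Y \<star> h)) \<cdot> \<a> X Y (Dom C h)"
    "k \<in> Arr C \<Longrightarrow> Cod C k = (X \<boxtimes> Y) \<boxtimes> Dom C h \<Longrightarrow>
      \<a> X Y Z \<cdot> ((\<^bold>1 (X \<boxtimes> Y) \<star> h) \<cdot> k) = (\<^bold>1 X \<star> (\<^bold>1 Y \<star> h)) \<cdot> (\<a> X Y (Dom C h) \<cdot> k)"
  using assoc_nat[of "\<^bold>1 X" "\<^bold>1 Y" h X Y Z] assoc_nat_tail[of "\<^bold>1 X" "\<^bold>1 Y" h X Y Z k] assms by auto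

lemmas assoc_push = assoc_nat assoc_nat_tail assoc_nat_Id

lemma left_unitor_nat:
  assumes "f \<in> Arr C" "Cod C f = X"
  shows "\<l> X \<cdot> (\<^bold>1 \<I> \<star> f) = f \<cdot> \<l> (Dom C f)"
    "k \<in> Arr C \<Longrightarrow> Cod C k = \<I> \<boxtimes> Dom C f \<Longrightarrow> \<l> X \<cdot> ((\<^bold>1 \<I> \<star> f) \<cdot> k) = f \<cdot> (\<l> (Dom C f) \<cdot> k)"
proof -
  show *: "\<l> X \<cdot> (\<^bold>1 \<I> \<star> f) = f \<cdot> \<l> (Dom C f)"
    using assms left_unitor_natural[of f "Dom C f" X] by (simp add: Hom_iff)
  show "k \<in> Arr C \<Longrightarrow> Cod C k = \<I> \<boxtimes> Dom C f \<Longrightarrow> \<l> X \<cdot> ((\<^bold>1 \<I> \<star> f) \<cdot> k) = f \<cdot> (\<l> (Dom C f) \<cdot> k)"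
    using reassoc[OF *, of k] assms by auto
qed

lemma right_unitor_nat:
  assumes "f \<in> Arr C" "Cod C f = X"
  shows "\<r> X \<cdot> (f \<star> \<^bold>1 \<I>) = f \<cdot> \<r> (Dom C f)"
    "k \<in> Arr C \<Longrightarrow> Cod C k = Dom C f \<boxtimes> \<I> \<Longrightarrow> \<r> X \<cdot> ((f \<star> \<^bold>1 \<I>) \<cdot> k) = f \<cdot> (\<r> (Dom C f) \<cdot> k)"
proof -
  show *: "\<r> X \<cdot> (f \<star> \<^bold>1 \<I>) = f \<cdot> \<r> (Dom C f)"
    using assms right_unitor_natural[of f "Dom C f" X] by (simp add: Hom_iff)
  show "k \<in> Arr C \<Longrightarrow> Cod C k = Dom C f \<boxtimes> \<I> \<Longrightarrow> \<r> X \<cdot> ((f \<star> \<^bold>1 \<I>) \<cdot> k) = f \<cdot> (\<r> (Dom C f) \<cdot> k)"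
    using reassoc[OF *, of k] assms by auto
qed

text \<open>Naturality of the unitors identifies \<open>f\<close> with \<open>f\<close> tensored
  with the unit, up to isomorphisms that cancel.\<close>

lemma unit_tensor_faithful:
  assumes "f \<in> Arr C" "g \<in> Arr C" "Dom C f = Dom C g" "Cod C f = Cod C g"
  shows "\<^bold>1 \<I> \<star> f = \<^bold>1 \<I> \<star> g \<Longrightarrow> f = g" "f \<star> \<^bold>1 \<I> = g \<star> \<^bold>1 \<I> \<Longrightarrow> f = g"
proof -
  assume "\<^bold>1 \<I> \<star> f = \<^bold>1 \<I> \<star> g"
  then have "f \<cdot> \<l> (Dom C f) = g \<cdot> \<l> (Dom C f)"
    using left_unitor_nat(1)[of f "Cod C f"] left_unitor_nat(1)[of g "Cod C g"] assms by simp
  then show "f = g" by (rule iso_cancel_right[rotated -1]) (use assms in simp_all)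
next
  assume "f \<star> \<^bold>1 \<I> = g \<star> \<^bold>1 \<I>"
  then have "f \<cdot> \<r> (Dom C f) = g \<cdot> \<r> (Dom C f)"
    using right_unitor_nat(1)[of f "Cod C f"] right_unitor_nat(1)[of g "Cod C g"] assms by simp
  then show "f = g" by (rule iso_cancel_right[rotated -1]) (use assms in simp_all)
qed

lemma triangle_tail:
  assumes "X \<in> Obj C" "Y \<in> Obj C" "k \<in> Arr C" "Cod C k = (X \<boxtimes> \<I>) \<boxtimes> Y"
  shows "(\<^bold>1 X \<star> \<l> Y) \<cdot> (\<a> X \<I> Y \<cdot> k) = (\<r> X \<star> \<^bold>1 Y) \<cdot> k"
  using reassoc[OF triangle[OF assms(1,2)], of k] assms by simp

text \<open>Kelly's redundant unit axioms, with his proofs.\<close>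

lemma left_unitor_tensor:
  assumes [simp]: "A \<in> Obj C" "B \<in> Obj C"
  shows "\<l> (A \<boxtimes> B) \<cdot> \<a> \<I> A B = \<l> A \<star> \<^bold>1 B"
proof (rule unit_tensor_faithful(1))
  let ?p = "\<a> \<I> (\<I> \<boxtimes> A) B \<cdot> (\<a> \<I> \<I> A \<star> \<^bold>1 B)"
  have "(\<^bold>1 \<I> \<star> (\<l> (A \<boxtimes> B) \<cdot> \<a> \<I> A B)) \<cdot> ?p =
    (\<^bold>1 \<I> \<star> \<l> (A \<boxtimes> B)) \<cdot> ((\<^bold>1 \<I> \<star> \<a> \<I> A B) \<cdot> ?p)" by (simp add: whisker)
  also have "\<dots> = (\<^bold>1 \<I> \<star> \<l> (A \<boxtimes> B)) \<cdot> (\<a> \<I> \<I> (A \<boxtimes> B) \<cdot> \<a> (\<I> \<boxtimes> \<I>) A B)"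
    by (simp add: pentagon)
  also have "\<dots> = \<a> \<I> A B \<cdot> ((\<r> \<I> \<star> \<^bold>1 A) \<star> \<^bold>1 B)"
    by (simp add: triangle_tail assoc_push)
  also have "\<dots> = \<a> \<I> A B \<cdot> (((\<^bold>1 \<I> \<star> \<l> A) \<star> \<^bold>1 B) \<cdot> (\<a> \<I> \<I> A \<star> \<^bold>1 B))"
    by (simp add: triangle flip: whisker)
  also have "\<dots> = (\<^bold>1 \<I> \<star> (\<l> A \<star> \<^bold>1 B)) \<cdot> ?p" by (simp add: assoc_push)
  finally show "\<^bold>1 \<I> \<star> (\<l> (A \<boxtimes> B) \<cdot> \<a> \<I> A B) = \<^bold>1 \<I> \<star> (\<l> A \<star> \<^bold>1 B)"
    by (rule iso_cancel_right[rotated -1]) simp_all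
qed simp_all

lemma right_unitor_tensor:
  assumes [simp]: "A \<in> Obj C" "B \<in> Obj C"
  shows "(\<^bold>1 A \<star> \<r> B) \<cdot> \<a> A B \<I> = \<r> (A \<boxtimes> B)"
proof (rule unit_tensor_faithful(2))
  have "\<a> A B \<I> \<cdot> (((\<^bold>1 A \<star> \<r> B) \<cdot> \<a> A B \<I>) \<star> \<^bold>1 \<I>)
      = (\<^bold>1 A \<star> ((\<^bold>1 B \<star> \<l> \<I>) \<cdot> \<a> B \<I> \<I>)) \<cdot> (\<a> A (B \<boxtimes> \<I>) \<I> \<cdot> (\<a> A B \<I> \<star> \<^bold>1 \<I>))"
    by (simp add: whisker assoc_push triangle del: tensor_Id_simp)
  also have "\<dots> = (\<^bold>1 A \<star> (\<^bold>1 B \<star> \<l> \<I>)) \<cdot> ((\<^bold>1 A \<star> \<a> B \<I> \<I>) \<cdot> \<a> A (B \<boxtimes> \<I>) \<I> \<cdot> (\<a> A B \<I> \<star> \<^bold>1 \<I>))"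
    by (simp add: whisker)
  also have "\<dots> = (\<^bold>1 A \<star> (\<^bold>1 B \<star> \<l> \<I>)) \<cdot> (\<a> A B (\<I> \<boxtimes> \<I>) \<cdot> \<a> (A \<boxtimes> B) \<I> \<I>)"
    by (simp add: pentagon)
  also have "\<dots> = \<a> A B \<I> \<cdot> (\<^bold>1 (A \<boxtimes> B) \<star> \<l> \<I>) \<cdot> \<a> (A \<boxtimes> B) \<I> \<I>"
    by (simp add: assoc_push)
  also have "\<dots> = \<a> A B \<I> \<cdot> (\<r> (A \<boxtimes> B) \<star> \<^bold>1 \<I>)"
    by (simp add: triangle)
  finally show "((\<^bold>1 A \<star> \<r> B) \<cdot> \<a> A B \<I>) \<star> \<^bold>1 \<I> = \<r> (A \<boxtimes> B) \<star> \<^bold>1 \<I>"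
    by (rule iso_cancel_left[rotated -1]) simp_all
qed simp_all

lemma left_unitor_unit: "\<l> \<I> = \<r> \<I>"
proof (rule unit_tensor_faithful(2))
  have "\<l> \<I> \<cdot> \<l> (\<I> \<boxtimes> \<I>) = \<l> \<I> \<cdot> (\<^bold>1 \<I> \<star> \<l> \<I>)"
    by (simp add: left_unitor_nat)
  then have "\<l> (\<I> \<boxtimes> \<I>) = \<^bold>1 \<I> \<star> \<l> \<I>" by (rule iso_cancel_left[rotated -1]) simp_all
  then show "\<l> \<I> \<star> \<^bold>1 \<I> = \<r> \<I> \<star> \<^bold>1 \<I>"
    using left_unitor_tensor[of \<I> \<I>] triangle[of \<I> \<I>] by simp
qed simp_all

end

section \<open>Tensor powers and their concatenation isomorphisms\<close>

locale monoidal_object = monoidal_abelian_category C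
  for C :: "('o, 'm, 'x) monoidal_category_scheme" (structure) +
  fixes W :: 'o
  assumes W_Obj [simp]: "W \<in> Obj C"
begin

abbreviation T :: "nat \<Rightarrow> 'o" where
  "T n \<equiv> tensor_pow C W n"

abbreviation P :: "nat \<Rightarrow> nat \<Rightarrow> 'm" where
  "P n m \<equiv> pow_iso C W n m"

lemma T_simps: "T 0 = \<I>" "T (Suc 0) = W" "T (Suc (Suc n)) = W \<boxtimes> T (Suc n)"
  by (simp_all add: tensor_pow.simps)

lemma T_Obj [simp]: "T n \<in> Obj C"
  by (induction n rule: induct_nat_012) (simp_all add: T_simps)

lemma pow_iso_simps [simp]:
  "P n m \<in> Arr C" "Dom C (P n m) = T n \<boxtimes> T m" "Cod C (P n m) = T (n + m)" "iso_arrow C (P n m)"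
proof -
  have "P n m \<in> Arr C \<and> Dom C (P n m) = T n \<boxtimes> T m \<and> Cod C (P n m) = T (n + m) \<and> iso_arrow C (P n m)"
  proof (induction n rule: induct_nat_012)
    case 1
    then show ?case by (cases m) (simp_all add: pow_iso.simps T_simps)
  qed (simp_all add: pow_iso.simps T_simps)
  then show "P n m \<in> Arr C" "Dom C (P n m) = T n \<boxtimes> T m" "Cod C (P n m) = T (n + m)" "iso_arrow C (P n m)"
    by auto
qed

lemma pow_iso_1_Suc: "P (Suc 0) (Suc m) = \<^bold>1 (T (Suc (Suc m)))"
  by (simp add: pow_iso.simps T_simps)

lemma pow_iso_0_left: "P 0 m = \<l> (T m)"
  by (simp add: pow_iso.simps)

text \<open>The recursion of \<open>pow_iso\<close> prescribes a right unitor only for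
  \<open>n = 1\<close>. At \<open>n = 0\<close> the claim is the coincidence of the two unitors of
  \<open>\<I>\<close>, and the inductive step is \<open>right_unitor_tensor\<close>.\<close>

lemma pow_iso_0_right: "P n 0 = \<r> (T n)"
proof (induction n rule: induct_nat_012)
  case (ge2 n)
  then show ?case by (simp add: pow_iso.simps T_simps right_unitor_tensor)
qed (simp_all add: pow_iso.simps T_simps left_unitor_unit)

text \<open>The instance of coherence that concatenation needs. The induction follows the recursion
  of \<open>pow_iso\<close> in its first argument; the pentagon carries the leading factor
  \<open>W\<close> through the step.\<close>

lemma pow_iso_assoc:
  "P (n + m) k \<cdot> (P n m \<star> \<^bold>1 (T k)) = P n (m + k) \<cdot> ((\<^bold>1 (T n) \<star> P m k) \<cdot> \<a> (T n) (T m) (T k))"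
proof (induction n rule: induct_nat_012)
  case 0
  show ?case by (simp add: pow_iso_0_left T_simps left_unitor_nat left_unitor_tensor)
next
  case 1
  show ?case
  \<comment> \<open>For a single left factor \<open>pow_iso\<close> branches on \<open>m\<close>:
    with \<open>m = 0\<close> the claim is the triangle identity, otherwise the isomorphisms
    \<open>P 1 _\<close> involved are identities.\<close>
  proof (cases m)
    case 0
    then show ?thesis
      by (simp add: pow_iso_0_left T_simps(1) triangle pow_iso_0_right)
  next
    case (Suc m')
    then show ?thesis by (simp add: pow_iso_1_Suc) (simp add: pow_iso.simps T_simps)
  qed
next
  case (ge2 n)
  let ?n = "Suc n"
  have IH: "(\<^bold>1 W \<star> P (?n + m) k) \<cdot> (\<^bold>1 W \<star> (P ?n m \<star> \<^bold>1 (T k))) =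
    (\<^bold>1 W \<star> P ?n (m + k)) \<cdot> ((\<^bold>1 W \<star> (\<^bold>1 (T ?n) \<star> P m k)) \<cdot> (\<^bold>1 W \<star> \<a> (T ?n) (T m) (T k)))"
    using arg_cong[OF ge2(2), of "\<lambda>f. \<^bold>1 W \<star> f"] by (simp add: whisker)
  have "P (Suc ?n + m) k \<cdot> (P (Suc ?n) m \<star> \<^bold>1 (T k)) =
      (\<^bold>1 W \<star> P (?n + m) k) \<cdot> ((\<^bold>1 W \<star> (P ?n m \<star> \<^bold>1 (T k))) \<cdot>
        (\<a> W (T ?n \<boxtimes> T m) (T k) \<cdot> (\<a> W (T ?n) (T m) \<star> \<^bold>1 (T k))))"
    by (simp add: pow_iso.simps T_simps whisker assoc_push)
  also have "\<dots> = (\<^bold>1 W \<star> P ?n (m + k)) \<cdot> ((\<^bold>1 W \<star> (\<^bold>1 (T ?n) \<star> P m k)) \<cdot>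
      ((\<^bold>1 W \<star> \<a> (T ?n) (T m) (T k)) \<cdot> \<a> W (T ?n \<boxtimes> T m) (T k) \<cdot> (\<a> W (T ?n) (T m) \<star> \<^bold>1 (T k))))"
    using reassoc[OF IH] by simp
  also have "\<dots> = (\<^bold>1 W \<star> P ?n (m + k)) \<cdot> ((\<^bold>1 W \<star> (\<^bold>1 (T ?n) \<star> P m k)) \<cdot>
      (\<a> W (T ?n) (T m \<boxtimes> T k) \<cdot> \<a> (W \<boxtimes> T ?n) (T m) (T k)))"
    by (simp add: pentagon)
  also have "\<dots> = P (Suc ?n) (m + k) \<cdot> ((\<^bold>1 (T (Suc ?n)) \<star> P m k) \<cdot> \<a> (T (Suc ?n)) (T m) (T k))"
    by (simp add: pow_iso.simps T_simps assoc_push)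
  finally show ?case .
qed

end

section \<open>Multilinear relations\<close>

lemma (in abelian_category) reflexive_functor_ident: "reflexive_functor C (\<lambda>X. X) (\<lambda>f. f)"
  by unfold_locales (auto simp: preserves_reflexive_coequalizers_def)

text \<open>The first functor carries the common section along, so it sends reflexive pairs to
  reflexive pairs, to which the second functor then applies.\<close>

lemma reflexive_functor_comp:
  assumes "reflexive_functor C Fo Fm" "reflexive_functor C Go Gm"
  shows "reflexive_functor C (\<lambda>X. Go (Fo X)) (\<lambda>f. Gm (Fm f))"
proof -
  interpret F: reflexive_functor C Fo Fm by fact
  interpret G: reflexive_functor C Go Gm by fact
  have "reflexive_pair C (Fm d0) (Fm d1)" if pair: "reflexive_pair C d0 d1" for d0 d1
  proof -
    obtain X1 X0 s where s: "d0 \<in> Hom C X1 X0" "d1 \<in> Hom C X1 X0" "s \<in> Hom C X0 X1"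
      "Comp C d0 s = Id C X0" "Comp C d1 s = Id C X0"
      using pair unfolding reflexive_pair_def by blast
    have X0: "X0 \<in> Obj C" using s(1) by (rule F.Hom_Obj)
    have "Comp C (Fm d0) (Fm s) = Id C (Fo X0)" "Comp C (Fm d1) (Fm s) = Id C (Fo X0)"
      using s X0 F.Fm_Comp[of s d0] F.Fm_Comp[of s d1] by (simp_all add: F.Hom_iff)
    then show ?thesis
      using s unfolding reflexive_pair_def
      by (intro exI[of _ "Fo X1"] exI[of _ "Fo X0"] conjI bexI[of _ "Fm s"]) (auto simp: F.Hom_iff)
  qed
  then show ?thesis
    using F.preserves G.preserves
    by unfold_locales (auto simp: F.Fm_Comp G.Fm_Comp preserves_reflexive_coequalizers_def)
qed

context reflexive_functor
begin

text \<open>Pull \<open>e\<close> out of the copairing: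
  \<open>e r p + q = e (r p + inv e q)\<close>. Modulo \<open>r\<close> the inner sum is
  \<open>inv e q\<close>, and \<open>e\<close> cancels its inverse.\<close>

lemma factors_iso_Comp:
  assumes [simp]: "iso_arrow C e" "e \<in> Arr C" "r \<in> Arr C" "Cod C r = Dom C e" "g \<in> Arr C" "Dom C g = Fo (Cod C e)"
    and f: "factors (g \<cdot> Fm e) r"
  shows "factors g (e \<cdot> r)"
proof (rule factorsI)
  let ?Y = "Cod C e"
  let ?p = "proj1 C (Dom C r) ?Y" and ?q = "proj2 C (Dom C r) ?Y"
  let ?x = "plus_arrow C (r \<cdot> ?p) (inv_arrow C e \<cdot> ?q)"
  have "copair C (e \<cdot> r) (\<^bold>1 ?Y) = e \<cdot> ?x"
    by (simp add: copair_eq)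
  then have "g \<cdot> Fm (copair C (e \<cdot> r) (\<^bold>1 ?Y)) = (g \<cdot> Fm e) \<cdot> Fm ?x"
    by (simp add: Fm_Comp del: Comp_plus_simp)
  also have "\<dots> = (g \<cdot> Fm e) \<cdot> Fm (inv_arrow C e \<cdot> ?q)"
    by (rule factors_eq[OF f]) simp_all
  also have "\<dots> = g \<cdot> Fm (e \<cdot> (inv_arrow C e \<cdot> ?q))"
    by (subst Fm_Comp[of _ e]) simp_all
  finally show "g \<cdot> Fm (copair C (e \<cdot> r) (\<^bold>1 (Cod C (e \<cdot> r)))) =
      g \<cdot> Fm (proj2 C (Dom C (e \<cdot> r)) (Cod C (e \<cdot> r)))"
    by simp
qed simp_all

end

section \<open>The quotients of the tensor powers and their universal property\<close>

locale free_monoid_construction = monoidal_abelian_category C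
  for C :: "('o, 'm, 'x) monoidal_category_scheme" (structure) +
  fixes V :: 'o
  assumes sequential_colimits: "has_sequential_colimits C"
    and tensor_sequential: "tensor_preserves_sequential_colimits C"
    and tensor_reflexive: "tensor_preserves_reflexive_coequalizers C"
    and V_Obj [simp]: "V \<in> Obj C"
begin

abbreviation W :: 'o where "W \<equiv> V_plus C V"

end

sublocale free_monoid_construction \<subseteq> monoidal_object C W
  by unfold_locales (simp add: V_plus_def)

context free_monoid_construction
begin

lemma reflexive_functor_tensor:
  assumes [simp]: "A \<in> Obj C"
  shows "reflexive_functor C (\<lambda>X. A \<boxtimes> X) (\<lambda>f. \<^bold>1 A \<star> f)"
    and "reflexive_functor C (\<lambda>X. X \<boxtimes> A) (\<lambda>f. f \<star> \<^bold>1 A)"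
  using tensor_reflexive by (unfold_locales; simp add: whisker tensor_preserves_reflexive_coequalizers_def)+

lemma reflexive_functor_between:
  assumes "A \<in> Obj C" "B \<in> Obj C"
  shows "reflexive_functor C (\<lambda>X. (A \<boxtimes> X) \<boxtimes> B) (\<lambda>f. between C A f B)"
  using reflexive_functor_comp[OF reflexive_functor_tensor(1)[OF assms(1)] reflexive_functor_tensor(2)[OF assms(2)]] .

abbreviation \<tau> :: 'm where "\<tau> \<equiv> tau C V"
abbreviation \<eta> :: 'm where "\<eta> \<equiv> eta C V"
abbreviation \<iota> :: 'm where "\<iota> \<equiv> incl_V C V"

lemma eta_simps [simp]:
  "\<eta> \<in> Arr C" "Dom C \<eta> = \<I>" "Cod C \<eta> = W" "\<iota> \<in> Arr C" "Dom C \<iota> = V" "Cod C \<iota> = W"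
  by (simp_all add: eta_def incl_V_def V_plus_def)

lemma tau_simps [simp]: "\<tau> \<in> Arr C" "Dom C \<tau> = V" "Cod C \<tau> = W \<boxtimes> W"
  by (simp_all add: tau_def)

lemma T_2: "T 2 = W \<boxtimes> W"
  by (simp add: numeral_2_eq_2 T_simps)

text \<open>Together with \<open>d1\<close> this is the reflexive pair whose coequalizer is the
  cokernel of \<open>\<tau>\<close>; every relation below is expressed through this pair.\<close>

abbreviation d0 :: 'm where "d0 \<equiv> copair C \<tau> (\<^bold>1 (W \<boxtimes> W))"
abbreviation d1 :: 'm where "d1 \<equiv> proj2 C V (W \<boxtimes> W)"

lemma d_simps [simp]:
  "d0 \<in> Arr C" "Dom C d0 = dsum C V (W \<boxtimes> W)" "Cod C d0 = W \<boxtimes> W"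
  by simp_all

lemma coker_tau_d: "coker C \<tau> \<cdot> d0 = coker C \<tau> \<cdot> d1"
  using coequalizer_coker(1)[of \<tau>] by (simp add: coequalizer_def)

context
  fixes A B :: 'o
  assumes AB [simp]: "A \<in> Obj C" "B \<in> Obj C"
begin

interpretation G: reflexive_functor C "\<lambda>X. (A \<boxtimes> X) \<boxtimes> B" "\<lambda>f. between C A f B"
  using AB by (rule reflexive_functor_between)

text \<open>The inclusion is the kernel \<open>?k\<close> followed backwards along the isomorphism
  \<open>?q \<cdot> ?k\<close> of \<open>split_epi_complement\<close>, so the same arrows annihilate
  both.\<close>

lemma multilinear_incl_simps [simp]:
  "multilinear_incl C A V (W \<boxtimes> W) B \<in> Arr C"
  "Cod C (multilinear_incl C A V (W \<boxtimes> W) B) = (A \<boxtimes> dsum C V (W \<boxtimes> W)) \<boxtimes> B"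
  and multilinear_incl_zero_iff: "\<And>g. g \<in> Arr C \<Longrightarrow> Dom C g = (A \<boxtimes> dsum C V (W \<boxtimes> W)) \<boxtimes> B \<Longrightarrow>
     g \<cdot> multilinear_incl C A V (W \<boxtimes> W) B = zero_arrow C (Dom C (multilinear_incl C A V (W \<boxtimes> W) B)) (Cod C g) \<longleftrightarrow>
     g \<cdot> ker C (between C A d1 B) = zero_arrow C (Dom C (ker C (between C A d1 B))) (Cod C g)"
proof -
  let ?k = "ker C (between C A d1 B)" and ?m = "multilinear_incl C A V (W \<boxtimes> W) B"
  let ?q = "coker C (between C A (inj2 C V (W \<boxtimes> W)) B)"
  have iso: "iso_arrow C (?q \<cdot> ?k)"
    by (rule split_epi_complement(1)) (simp_all flip: G.Fm_Comp)
  have m: "?m = ?k \<cdot> inv_arrow C (?q \<cdot> ?k)"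
    by (simp add: multilinear_incl_def multilinear_quot_def Let_def)
  have i: "inv_arrow C (?q \<cdot> ?k) \<in> Arr C" "Dom C (inv_arrow C (?q \<cdot> ?k)) = Cod C ?q"
    "Cod C (inv_arrow C (?q \<cdot> ?k)) = Dom C ?k"
    using iso by simp_all
  show m_simps: "?m \<in> Arr C" "Cod C ?m = (A \<boxtimes> dsum C V (W \<boxtimes> W)) \<boxtimes> B"
    using i by (simp_all add: m)
  have mk: "?m \<cdot> (?q \<cdot> ?k) = ?k"
    using iso i unfolding m by (subst Comp_assoc_simp) simp_all
  fix g assume g [simp]: "g \<in> Arr C" "Dom C g = (A \<boxtimes> dsum C V (W \<boxtimes> W)) \<boxtimes> B"
  show "g \<cdot> ?m = zero_arrow C (Dom C ?m) (Cod C g) \<longleftrightarrow> g \<cdot> ?k = zero_arrow C (Dom C ?k) (Cod C g)"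
  proof
    assume *: "g \<cdot> ?m = zero_arrow C (Dom C ?m) (Cod C g)"
    have "Dom C ?m = Cod C ?q" using i by (simp add: m)
    then have "g \<cdot> ?k = (g \<cdot> ?m) \<cdot> (?q \<cdot> ?k)"
      by (subst mk[symmetric]) (simp add: m_simps)
    then show "g \<cdot> ?k = zero_arrow C (Dom C ?k) (Cod C g)"
      using m_simps \<open>Dom C ?m = Cod C ?q\<close> by (simp add: *)
  next
    assume *: "g \<cdot> ?k = zero_arrow C (Dom C ?k) (Cod C g)"
    have "g \<cdot> ?m = (g \<cdot> ?k) \<cdot> inv_arrow C (?q \<cdot> ?k)" using i by (simp add: m)
    then show "g \<cdot> ?m = zero_arrow C (Dom C ?m) (Cod C g)" using i by (simp add: * m)
  qed
qed

text \<open>Arrows on \<open>A \<boxtimes> (V \<oplus> W \<boxtimes> W) \<boxtimes> B\<close> are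
  determined by their restrictions to the kernel of \<open>?b1\<close> and to its section
  \<open>?s\<close>. The two legs agree on \<open>?s\<close>, and \<open>?b1\<close> vanishes on the
  kernel, so only the multilinear part tests their equality.\<close>

lemma multilinear_incl_eq_iff:
  assumes [simp]: "g \<in> Arr C" "Dom C g = (A \<boxtimes> (W \<boxtimes> W)) \<boxtimes> B"
  shows "g \<cdot> (between C A d0 B \<cdot> multilinear_incl C A V (W \<boxtimes> W) B) =
      zero_arrow C (Dom C (multilinear_incl C A V (W \<boxtimes> W) B)) (Cod C g)
    \<longleftrightarrow> g \<cdot> between C A d0 B = g \<cdot> between C A d1 B"
proof -
  let ?k = "ker C (between C A d1 B)" and ?m = "multilinear_incl C A V (W \<boxtimes> W) B"
  let ?s = "between C A (inj2 C V (W \<boxtimes> W)) B"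
  let ?b0 = "between C A d0 B" and ?b1 = "between C A d1 B"
  have s: "?b0 \<cdot> ?s = ?b1 \<cdot> ?s" by (simp flip: G.Fm_Comp)
  obtain h where h: "h \<in> Arr C" "Dom C h = Cod C ?s" "Cod C h = Dom C ?k"
    "plus_arrow C (?k \<cdot> h) (?s \<cdot> ?b1) = \<^bold>1 (Cod C ?s)"
    using split_epi_complement(2)[of ?s ?b1] by (auto simp flip: G.Fm_Comp)
  have decomp: "u = plus_arrow C ((u \<cdot> ?k) \<cdot> h) ((u \<cdot> ?s) \<cdot> ?b1)"
    if "u \<in> Arr C" "Dom C u = Cod C ?s" for u
  proof -
    have "u = u \<cdot> plus_arrow C (?k \<cdot> h) (?s \<cdot> ?b1)"
      using that h(1-3) unfolding h(4) by simp
    then show ?thesis using that h(1-3) by simp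
  qed
  have "g \<cdot> (?b0 \<cdot> ?m) = zero_arrow C (Dom C ?m) (Cod C g) \<longleftrightarrow>
    (g \<cdot> ?b0) \<cdot> ?m = zero_arrow C (Dom C ?m) (Cod C (g \<cdot> ?b0))" by simp
  also have "\<dots> \<longleftrightarrow> (g \<cdot> ?b0) \<cdot> ?k = zero_arrow C (Dom C ?k) (Cod C g)"
    using multilinear_incl_zero_iff[of "g \<cdot> ?b0"] by simp
  also have "\<dots> \<longleftrightarrow> g \<cdot> ?b0 = g \<cdot> ?b1"
  proof
    assume "(g \<cdot> ?b0) \<cdot> ?k = zero_arrow C (Dom C ?k) (Cod C g)"
    then have "(g \<cdot> ?b0) \<cdot> ?k = (g \<cdot> ?b1) \<cdot> ?k" by simp
    moreover have "(g \<cdot> ?b0) \<cdot> ?s = (g \<cdot> ?b1) \<cdot> ?s" using s by simp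
    ultimately show "g \<cdot> ?b0 = g \<cdot> ?b1"
      using decomp[of "g \<cdot> ?b0"] decomp[of "g \<cdot> ?b1"] by simp
  qed simp
  finally show ?thesis .
qed

lemma R_AB_eq: "R_AB C V A B = img C (between C A d0 B \<cdot> multilinear_incl C A V (W \<boxtimes> W) B)"
  by (simp add: R_AB_def T_2)

lemma R_AB_simps [simp]: "R_AB C V A B \<in> Arr C" "Cod C (R_AB C V A B) = (A \<boxtimes> (W \<boxtimes> W)) \<boxtimes> B"
  by (simp_all add: R_AB_eq)

lemma Comp_R_AB_zero_iff:
  assumes "g \<in> Arr C" "Dom C g = (A \<boxtimes> (W \<boxtimes> W)) \<boxtimes> B"
  shows "g \<cdot> R_AB C V A B = zero_arrow C (Dom C (R_AB C V A B)) (Cod C g)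
    \<longleftrightarrow> g \<cdot> between C A d0 B = g \<cdot> between C A d1 B"
  unfolding R_AB_eq using assms multilinear_incl_eq_iff[of g] by (simp add: Comp_img_zero_iff)

text \<open>Regard \<open>Fm\<close> after \<open>A \<boxtimes> - \<boxtimes> B\<close> as one
  functor: it preserves the coequalizer of \<open>d0\<close> and \<open>d1\<close>, so
  \<open>g\<close> descends to the image of \<open>?c\<close>, the arrow induced by
  \<open>coker C \<tau>\<close>. Since \<open>?c\<close> kills \<open>R_AB\<close>, it cannot
  distinguish the two legs belonging to \<open>R_AB\<close>, and neither can
  \<open>g\<close>.\<close>

lemma factors_R_AB:
  assumes "reflexive_functor C Fo Fm"
    and [simp]: "g \<in> Arr C" "Dom C g = Fo ((A \<boxtimes> (W \<boxtimes> W)) \<boxtimes> B)"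
    and eq: "g \<cdot> Fm (between C A d0 B) = g \<cdot> Fm (between C A d1 B)"
  shows "reflexive_functor.factors C Fo Fm g (R_AB C V A B)"
proof -
  interpret F: reflexive_functor C Fo Fm by fact
  interpret H: reflexive_functor C "\<lambda>X. Fo ((A \<boxtimes> X) \<boxtimes> B)" "\<lambda>f. Fm (between C A f B)"
    using reflexive_functor_comp[OF G.reflexive_functor_axioms assms(1)] .
  have "H.factors g \<tau>" using eq by (intro H.factorsI) simp_all
  then obtain h where h: "h \<in> Arr C" "Dom C h = Fo ((A \<boxtimes> Cod C (coker C \<tau>)) \<boxtimes> B)"
    "h \<cdot> Fm (between C A (coker C \<tau>) B) = g"
    unfolding H.factors_def by blast
  let ?c = "between C A (coker C \<tau>) B" and ?R = "R_AB C V A B"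
  \<comment> \<open>\<open>Comp_R_AB_zero_iff\<close> turns the vanishing into the equation
    \<open>coker_tau_d\<close> under the functor
    \<open>A \<boxtimes> - \<boxtimes> B\<close>.\<close>
  have "?c \<cdot> ?R = zero_arrow C (Dom C ?R) (Cod C ?c)"
    by (subst Comp_R_AB_zero_iff) (simp_all flip: G.Fm_Comp add: coker_tau_d del: copair_simps)
  then have z: "?c \<cdot> ?R = zero_arrow C (Dom C ?R) ((A \<boxtimes> Cod C (coker C \<tau>)) \<boxtimes> B)" by simp
  have *: "?c \<cdot> copair C ?R (\<^bold>1 (Cod C ?R)) = ?c \<cdot> proj2 C (Dom C ?R) (Cod C ?R)"
    by (rule dsum_eqI[of "Dom C ?R" "Cod C ?R"]) (simp_all add: z)
  have **: "g \<cdot> Fm z = h \<cdot> Fm (?c \<cdot> z)" if "z \<in> Arr C" "Cod C z = (A \<boxtimes> (W \<boxtimes> W)) \<boxtimes> B" for z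
    using h(1,2) that by (simp add: F.Fm_Comp h(3)[symmetric])
  show ?thesis
    by (rule F.factorsI) (use * ** in simp_all)
qed

end

text \<open>Canonical rebracketing of a tensor power with two marked middle factors, preceded by
  \<open>i\<close> and followed by \<open>k\<close> factors.\<close>

definition mid2_iso :: "nat \<Rightarrow> nat \<Rightarrow> 'm" where
  "mid2_iso i k = P (Suc (Suc i)) k \<cdot> (P i (Suc (Suc 0)) \<star> \<^bold>1 (T k))"

lemma mid2_iso_simps [simp]:
  "mid2_iso i k \<in> Arr C" "Dom C (mid2_iso i k) = (T i \<boxtimes> (W \<boxtimes> W)) \<boxtimes> T k" "Cod C (mid2_iso i k) = T (Suc (Suc (i + k)))"
  "iso_arrow C (mid2_iso i k)"
  by (simp_all add: mid2_iso_def T_simps)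

lemma R_sub_eq: "R_sub C V i k = mid2_iso i k \<cdot> R_AB C V (T i) (T k)"
  by (simp add: R_sub_def mid2_iso_def T_simps numeral_2_eq_2)

abbreviation \<pi> :: "nat \<Rightarrow> 'm" where "\<pi> n \<equiv> pi_n C V n"

lemma R_sub_simps:
  assumes "i < n - 1"
  shows "R_sub C V i (n - i - 2) \<in> Arr C \<and> Cod C (R_sub C V i (n - i - 2)) = T n"
proof -
  \<comment> \<open>With truncated subtraction, \<open>i < n - 1\<close> says exactly
    \<open>i + 2 \<le> n\<close>; in particular there is no such \<open>i\<close> for
    \<open>n = 0\<close> or \<open>n = 1\<close>.\<close>
  obtain k where "n = Suc (Suc (i + k))"
    using assms by (intro that[of "n - i - 2"]) simp
  then show ?thesis by (simp add: R_sub_eq)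
qed

lemma Rn_simps [simp]: "Rn C V n \<in> Arr C" "Cod C (Rn C V n) = T n"
  using subobject_sum_simps[of "T n" "n - 1" "\<lambda>i. R_sub C V i (n - i - 2)"] R_sub_simps
  by (auto simp: Rn_def)

lemma pi_simps [simp]: "\<pi> n \<in> Arr C" "Dom C (\<pi> n) = T n" "Cod C (\<pi> n) = Vt C V n"
  by (simp_all add: pi_n_def Vt_def)

lemma Vt_Obj [simp]: "Vt C V n \<in> Obj C"
  using Dom_Cod_Obj(2)[of "\<pi> n"] by simp

text \<open>As a cokernel, \<open>\<pi> n\<close> kills the whole sum and therefore each
  \<open>R_sub\<close>; \<open>Comp_R_AB_zero_iff\<close> converts this into coequalizing a
  pair.\<close>

lemma pi_relation:
  "\<pi> (Suc (Suc (i + k))) \<cdot> (mid2_iso i k \<cdot> between C (T i) d0 (T k)) = \<pi> (Suc (Suc (i + k))) \<cdot> (mid2_iso i k \<cdot> between C (T i) d1 (T k))"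
proof -
  define n where "n = Suc (Suc (i + k))"
  have k: "n - i - 2 = k" "i < n - 1" by (simp_all add: n_def)
  have "\<pi> n \<cdot> subobject_sum C (T n) (\<lambda>i. R_sub C V i (n - i - 2)) (n - 1) =
      zero_arrow C (Dom C (Rn C V n)) (Cod C (\<pi> n))"
    unfolding Rn_def[symmetric] pi_n_def by simp
  then have "\<pi> n \<cdot> R_sub C V i (n - i - 2) = zero_arrow C (Dom C (R_sub C V i (n - i - 2))) (Cod C (\<pi> n))"
    using R_sub_simps[of _ n] k(2)
    by (intro Comp_subobject_sum_zero[of "T n" "n - 1" "\<lambda>i. R_sub C V i (n - i - 2)"]) (simp_all add: Rn_def)
  then have "(\<pi> n \<cdot> mid2_iso i k) \<cdot> R_AB C V (T i) (T k) = zero_arrow C (Dom C (R_AB C V (T i) (T k))) (Cod C (\<pi> n \<cdot> mid2_iso i k))"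
    by (simp add: R_sub_eq k n_def)
  then have "(\<pi> n \<cdot> mid2_iso i k) \<cdot> between C (T i) d0 (T k) = (\<pi> n \<cdot> mid2_iso i k) \<cdot> between C (T i) d1 (T k)"
    by (subst (asm) Comp_R_AB_zero_iff) (simp_all add: n_def)
  then show ?thesis by (simp add: n_def)
qed

text \<open>Descent along \<open>Fm (\<pi> n)\<close> is assembled from the pieces of
  \<open>Rn\<close>: \<open>factors_R_AB\<close> for each relation, \<open>factors_iso_Comp\<close>
  for the rebracketing, \<open>factors_subobject_sum\<close> for the sum. The general
  \<open>Fm\<close> makes it available with further tensor factors present.\<close>

lemma pi_factor:
  assumes "reflexive_functor C Fo Fm" "g \<in> Arr C" "Dom C g = Fo (T n)"
    and eq: "\<And>i k. n = Suc (Suc (i + k)) \<Longrightarrow>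
      g \<cdot> Fm (mid2_iso i k \<cdot> between C (T i) d0 (T k)) = g \<cdot> Fm (mid2_iso i k \<cdot> between C (T i) d1 (T k))"
  shows "\<exists>h. h \<in> Arr C \<and> Dom C h = Fo (Vt C V n) \<and> Cod C h = Cod C g \<and> h \<cdot> Fm (\<pi> n) = g"
proof -
  interpret F: reflexive_functor C Fo Fm by fact
  have "F.factors g (Rn C V n)"
    unfolding Rn_def
  proof (rule F.factors_subobject_sum)
    fix i assume i: "i < n - 1"
    then obtain k where n: "n = Suc (Suc (i + k))"
      by (intro that[of "n - i - 2"]) simp
    have "F.factors g (R_sub C V i k)"
      unfolding R_sub_eq
    proof (rule F.factors_iso_Comp)
      show "F.factors (g \<cdot> Fm (mid2_iso i k)) (R_AB C V (T i) (T k))"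
        using assms(2,3) eq[OF n] n
        by (intro factors_R_AB[OF _ _ assms(1)]) (simp_all add: F.Fm_Comp del: copair_simps)
    qed (use assms(2,3) n in simp_all)
    then show "R_sub C V i (n - i - 2) \<in> Arr C \<and> Cod C (R_sub C V i (n - i - 2)) = T n \<and>
        F.factors g (R_sub C V i (n - i - 2))"
      using R_sub_simps[OF i] n by simp
  qed (use assms(2,3) in simp_all)
  then show ?thesis unfolding F.factors_def by (simp add: pi_n_def Vt_def)
qed

lemma epic_Fm_pi: "reflexive_functor C Fo Fm \<Longrightarrow> epic C (Fm (\<pi> n))"
  unfolding pi_n_def by (rule reflexive_functor.epic_Fm_coker) simp_all

lemma epic_pi:
  assumes "A \<in> Obj C"
  shows "epic C (\<pi> n)" "epic C (\<^bold>1 A \<star> \<pi> n)" "epic C (\<pi> n \<star> \<^bold>1 A)"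
  using epic_Fm_pi[OF reflexive_functor_ident] epic_Fm_pi[OF reflexive_functor_tensor(1)[OF assms]]
    epic_Fm_pi[OF reflexive_functor_tensor(2)[OF assms]] by simp_all

end

context category
begin

lemma epic_Comp:
  assumes "epic C f" "epic C g" "Dom C g = Cod C f"
  shows "epic C (g \<cdot> f)"
proof -
  have [simp]: "f \<in> Arr C" "g \<in> Arr C" using assms by (auto simp: epic_def)
  show ?thesis
    unfolding epic_def
  proof (intro conjI allI ballI impI)
    fix A u v
    assume "u \<in> Hom C (Cod C (g \<cdot> f)) A" "v \<in> Hom C (Cod C (g \<cdot> f)) A" "u \<cdot> (g \<cdot> f) = v \<cdot> (g \<cdot> f)"
    then have uv: "u \<in> Arr C" "v \<in> Arr C" "Dom C u = Cod C g" "Dom C v = Cod C g" "Cod C u = Cod C v"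
      "(u \<cdot> g) \<cdot> f = (v \<cdot> g) \<cdot> f" using assms by (auto simp: Hom_iff)
    have "u \<cdot> g = v \<cdot> g" by (rule epicD[OF assms(1) uv(6)]) (use uv assms(3) in auto)
    then show "u = v" by (rule epicD[OF assms(2)]) (use uv in auto)
  qed (use assms in simp)
qed

end

context monoidal_abelian_category
begin

lemma inv_unitor_nat:
  assumes "f \<in> Arr C" "X = Cod C f"
  shows "inv_arrow C (\<l> X) \<cdot> f = (\<^bold>1 \<I> \<star> f) \<cdot> inv_arrow C (\<l> (Dom C f))"
    and "inv_arrow C (\<r> X) \<cdot> f = (f \<star> \<^bold>1 \<I>) \<cdot> inv_arrow C (\<r> (Dom C f))"
proof -
  show "inv_arrow C (\<l> X) \<cdot> f = (\<^bold>1 \<I> \<star> f) \<cdot> inv_arrow C (\<l> (Dom C f))"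
    by (rule iso_cancel_left[of "\<l> X"]) (use assms in \<open>simp_all add: left_unitor_nat\<close>)
  show "inv_arrow C (\<r> X) \<cdot> f = (f \<star> \<^bold>1 \<I>) \<cdot> inv_arrow C (\<r> (Dom C f))"
    by (rule iso_cancel_left[of "\<r> X"]) (use assms in \<open>simp_all add: right_unitor_nat\<close>)
qed

lemma inv_unitor_nat_tail:
  assumes "f \<in> Arr C" "X = Cod C f" "k \<in> Arr C" "Cod C k = Dom C f"
  shows "inv_arrow C (\<l> X) \<cdot> (f \<cdot> k) = (\<^bold>1 \<I> \<star> f) \<cdot> (inv_arrow C (\<l> (Dom C f)) \<cdot> k)"
    and "inv_arrow C (\<r> X) \<cdot> (f \<cdot> k) = (f \<star> \<^bold>1 \<I>) \<cdot> (inv_arrow C (\<r> (Dom C f)) \<cdot> k)"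
  using reassoc[OF inv_unitor_nat(1)[OF assms(1,2)], of k] reassoc[OF inv_unitor_nat(2)[OF assms(1,2)], of k]
    assms by simp_all

lemma inv_iso_tensor:
  assumes [simp]: "iso_arrow C f" "A \<in> Obj C"
  shows "(\<^bold>1 A \<star> f) \<cdot> (\<^bold>1 A \<star> inv_arrow C f) = \<^bold>1 (A \<boxtimes> Cod C f)"
    and "(f \<star> \<^bold>1 A) \<cdot> (inv_arrow C f \<star> \<^bold>1 A) = \<^bold>1 (Cod C f \<boxtimes> A)"
  using iso_arrow_Arr[of f] by (simp_all add: interchange)

lemma assoc_inv_unitor:
  assumes [simp]: "A \<in> Obj C" "B \<in> Obj C"
  shows "\<a> A B \<I> \<cdot> inv_arrow C (\<r> (A \<boxtimes> B)) = \<^bold>1 A \<star> inv_arrow C (\<r> B)"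
    and "\<a> A \<I> B \<cdot> (inv_arrow C (\<r> A) \<star> \<^bold>1 B) = \<^bold>1 A \<star> inv_arrow C (\<l> B)"
    and "\<a> \<I> A B \<cdot> (inv_arrow C (\<l> A) \<star> \<^bold>1 B) = inv_arrow C (\<l> (A \<boxtimes> B))"
proof -
  show "\<a> A B \<I> \<cdot> inv_arrow C (\<r> (A \<boxtimes> B)) = \<^bold>1 A \<star> inv_arrow C (\<r> B)"
    by (rule iso_cancel_left[of "\<^bold>1 A \<star> \<r> B"])
      (simp_all add: inv_iso_tensor reassoc[OF right_unitor_tensor])
  show "\<a> A \<I> B \<cdot> (inv_arrow C (\<r> A) \<star> \<^bold>1 B) = \<^bold>1 A \<star> inv_arrow C (\<l> B)"
    by (rule iso_cancel_left[of "\<^bold>1 A \<star> \<l> B"])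
      (simp_all add: inv_iso_tensor reassoc[OF triangle])
  show "\<a> \<I> A B \<cdot> (inv_arrow C (\<l> A) \<star> \<^bold>1 B) = inv_arrow C (\<l> (A \<boxtimes> B))"
    by (rule iso_cancel_left[of "\<l> (A \<boxtimes> B)"])
      (simp_all add: inv_iso_tensor reassoc[OF left_unitor_tensor])
qed

text \<open>Both sides equal \<open>f \<star> g\<close>; the orientation moves the arrow on the left
  factor outwards.\<close>

lemma whisker_exchange:
  assumes "f \<in> Arr C" "g \<in> Arr C" "A = Cod C f" "B = Dom C g"
  shows "(\<^bold>1 A \<star> g) \<cdot> (f \<star> \<^bold>1 B) = (f \<star> \<^bold>1 (Cod C g)) \<cdot> (\<^bold>1 (Dom C f) \<star> g)"
    and "k \<in> Arr C \<Longrightarrow> Cod C k = Dom C f \<boxtimes> Dom C g \<Longrightarrow>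
      (\<^bold>1 A \<star> g) \<cdot> ((f \<star> \<^bold>1 B) \<cdot> k) = (f \<star> \<^bold>1 (Cod C g)) \<cdot> ((\<^bold>1 (Dom C f) \<star> g) \<cdot> k)"
  using assms by (simp_all add: merge)

end

context monoidal_object
begin

lemma T_small [simp]: "T 0 = \<I>" "T (Suc 0) = W" "T (Suc (Suc 0)) = W \<boxtimes> W"
  by (simp_all add: T_simps)

lemma pow_iso_assoc_tail:
  assumes "h \<in> Arr C" "Cod C h = (T n \<boxtimes> T m) \<boxtimes> T k"
  shows "P (n + m) k \<cdot> ((P n m \<star> \<^bold>1 (T k)) \<cdot> h) =
    P n (m + k) \<cdot> ((\<^bold>1 (T n) \<star> P m k) \<cdot> (\<a> (T n) (T m) (T k) \<cdot> h))"
  using reassoc[OF pow_iso_assoc[of n m k], of h] assms by simp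

end

section \<open>Relations under concatenation\<close>

context free_monoid_construction
begin

text \<open>Coequalizing the single pair \<open>d0\<close>, \<open>d1\<close> makes \<open>g\<close>
  factor through \<open>A \<boxtimes> Coker \<tau> \<boxtimes> B\<close>, hence it identifies all
  pairs that agree modulo \<open>\<tau>\<close>.\<close>

lemma between_relation:
  assumes [simp]: "A \<in> Obj C" "B \<in> Obj C" "g \<in> Arr C" "Dom C g = (A \<boxtimes> (W \<boxtimes> W)) \<boxtimes> B"
    and eq: "g \<cdot> between C A d0 B = g \<cdot> between C A d1 B"
    and xy: "x \<in> Arr C" "y \<in> Arr C" "Cod C x = W \<boxtimes> W" "Cod C y = W \<boxtimes> W" "coker C \<tau> \<cdot> x = coker C \<tau> \<cdot> y"
  shows "g \<cdot> between C A x B = g \<cdot> between C A y B"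
proof -
  interpret G: reflexive_functor C "\<lambda>X. (A \<boxtimes> X) \<boxtimes> B" "\<lambda>f. between C A f B"
    by (rule reflexive_functor_between) simp_all
  have "G.factors g \<tau>" using eq by (intro G.factorsI) simp_all
  then show ?thesis by (rule G.factors_eq) (use xy in simp_all)
qed

text \<open>A relation in the left block stays at position \<open>i\<close> after concatenation and
  only gains \<open>m\<close> trailing factors. The remaining arrow on the right involves
  \<open>d\<close> only through its domain, so it is the same for \<open>d0\<close> and
  \<open>d1\<close>.\<close>

lemma pow_iso_mid2_iso_left:
  assumes [simp]: "d \<in> Arr C" "Cod C d = W \<boxtimes> W"
  shows "P (Suc (Suc (i + k))) m \<cdot> ((mid2_iso i k \<cdot> between C (T i) d (T k)) \<star> \<^bold>1 (T m)) =
    (mid2_iso i (k + m) \<cdot> between C (T i) d (T (k + m))) \<cdot>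
      ((\<^bold>1 (T i \<boxtimes> Dom C d) \<star> P k m) \<cdot> \<a> (T i \<boxtimes> Dom C d) (T k) (T m))"
proof -
  have "P (Suc (Suc (i + k))) m \<cdot> ((mid2_iso i k \<cdot> between C (T i) d (T k)) \<star> \<^bold>1 (T m)) =
     P (Suc (Suc i) + k) m \<cdot> ((P (Suc (Suc i)) k \<star> \<^bold>1 (T m)) \<cdot> (((P i (Suc (Suc 0)) \<star> \<^bold>1 (T k)) \<star> \<^bold>1 (T m)) \<cdot>
      (((\<^bold>1 (T i) \<star> d) \<star> \<^bold>1 (T k)) \<star> \<^bold>1 (T m))))"
    by (simp add: mid2_iso_def whisker)
  also have "\<dots> = (mid2_iso i (k + m) \<cdot> between C (T i) d (T (k + m))) \<cdot>
      ((\<^bold>1 (T i \<boxtimes> Dom C d) \<star> P k m) \<cdot> \<a> (T i \<boxtimes> Dom C d) (T k) (T m))"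
    by (subst pow_iso_assoc_tail) (simp_all add: mid2_iso_def assoc_push whisker_exchange)
  finally show ?thesis .
qed

text \<open>Here the relation moves to position \<open>n + i\<close>. The associators are kept on
  the left-hand side so that no inverse associators arise; being invertible, they cancel in
  \<open>balanced_right\<close>.\<close>

lemma pow_iso_mid2_iso_right:
  assumes [simp]: "d \<in> Arr C" "Cod C d = W \<boxtimes> W"
  shows "P n (Suc (Suc (i + k))) \<cdot> ((\<^bold>1 (T n) \<star> (mid2_iso i k \<cdot> between C (T i) d (T k))) \<cdot>
      (\<a> (T n) (T i \<boxtimes> Dom C d) (T k) \<cdot> (\<a> (T n) (T i) (Dom C d) \<star> \<^bold>1 (T k)))) =
    (mid2_iso (n + i) k \<cdot> between C (T (n + i)) d (T k)) \<cdot> ((P n i \<star> \<^bold>1 (Dom C d)) \<star> \<^bold>1 (T k))"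
proof -
  let ?two = "Suc (Suc 0)"
  \<comment> \<open>Coherence for blocks of lengths \<open>n\<close>, \<open>i\<close> and two,
    tensored with the trailing factors.\<close>
  have i2: "(P n (i + ?two) \<star> \<^bold>1 (T k)) \<cdot> (((\<^bold>1 (T n) \<star> P i ?two) \<star> \<^bold>1 (T k)) \<cdot> (\<a> (T n) (T i) (W \<boxtimes> W) \<star> \<^bold>1 (T k)))
      = (P (n + i) ?two \<star> \<^bold>1 (T k)) \<cdot> ((P n i \<star> \<^bold>1 (W \<boxtimes> W)) \<star> \<^bold>1 (T k))"
    using arg_cong[OF pow_iso_assoc[of n i ?two], of "\<lambda>f. f \<star> \<^bold>1 (T k)"] by (simp add: whisker)
  have nat: "(\<a> (T n) (T i) (W \<boxtimes> W) \<star> \<^bold>1 (T k)) \<cdot> between C (T n \<boxtimes> T i) d (T k) =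
      ((\<^bold>1 (T n) \<star> (\<^bold>1 (T i) \<star> d)) \<star> \<^bold>1 (T k)) \<cdot> (\<a> (T n) (T i) (Dom C d) \<star> \<^bold>1 (T k))"
    using arg_cong[OF assoc_nat_Id(1)[of "T n" "T i" d "W \<boxtimes> W"], of "\<lambda>f. f \<star> \<^bold>1 (T k)"]
    by (simp add: whisker)
  have "P n (Suc (Suc (i + k))) \<cdot> ((\<^bold>1 (T n) \<star> (mid2_iso i k \<cdot> between C (T i) d (T k))) \<cdot>
      (\<a> (T n) (T i \<boxtimes> Dom C d) (T k) \<cdot> (\<a> (T n) (T i) (Dom C d) \<star> \<^bold>1 (T k)))) =
    P n (Suc (Suc i) + k) \<cdot> ((\<^bold>1 (T n) \<star> P (Suc (Suc i)) k) \<cdot> (\<a> (T n) (T (Suc (Suc i))) (T k) \<cdot>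
      (((\<^bold>1 (T n) \<star> P i ?two) \<star> \<^bold>1 (T k)) \<cdot>
      ((\<a> (T n) (T i) (W \<boxtimes> W) \<star> \<^bold>1 (T k)) \<cdot> between C (T n \<boxtimes> T i) d (T k)))))"
    by (simp add: mid2_iso_def whisker assoc_push nat)
  also have "\<dots> = P (n + Suc (Suc i)) k \<cdot> (((P n (i + ?two) \<star> \<^bold>1 (T k)) \<cdot> (((\<^bold>1 (T n) \<star> P i ?two) \<star> \<^bold>1 (T k)) \<cdot>
      (\<a> (T n) (T i) (W \<boxtimes> W) \<star> \<^bold>1 (T k)))) \<cdot> between C (T n \<boxtimes> T i) d (T k))"
    using pow_iso_assoc_tail[of "((\<^bold>1 (T n) \<star> P i ?two) \<star> \<^bold>1 (T k)) \<cdot>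
      ((\<a> (T n) (T i) (W \<boxtimes> W) \<star> \<^bold>1 (T k)) \<cdot> between C (T n \<boxtimes> T i) d (T k))" n "Suc (Suc i)" k]
    by simp
  also have "\<dots> = (mid2_iso (n + i) k \<cdot> between C (T (n + i)) d (T k)) \<cdot> ((P n i \<star> \<^bold>1 (Dom C d)) \<star> \<^bold>1 (T k))"
    unfolding i2 by (simp add: mid2_iso_def merge)
  finally show ?thesis .
qed

text \<open>The elementary criterion for descending along \<open>\<pi> n\<close>: sufficient by
  \<open>balanced_factor\<close>, necessary by \<open>balanced_pi\<close> and
  \<open>balanced_Comp\<close>.\<close>

definition balanced :: "nat \<Rightarrow> 'm \<Rightarrow> bool" where
  "balanced n g \<longleftrightarrow> g \<in> Arr C \<and> Dom C g = T n \<and> (\<forall>i k. n = Suc (Suc (i + k)) \<longrightarrow>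
     g \<cdot> (mid2_iso i k \<cdot> between C (T i) d0 (T k)) = g \<cdot> (mid2_iso i k \<cdot> between C (T i) d1 (T k)))"

lemma balanced_pi: "balanced n (\<pi> n)"
  using pi_relation by (auto simp: balanced_def simp del: copair_simps)

lemma balanced_Comp:
  assumes "balanced n g" "h \<in> Arr C" "Dom C h = Cod C g"
  shows "balanced n (h \<cdot> g)"
  using assms by (simp add: balanced_def del: copair_simps)

lemma balanced_factor:
  assumes "balanced n g"
  shows "\<exists>h. h \<in> Arr C \<and> Dom C h = Vt C V n \<and> Cod C h = Cod C g \<and> h \<cdot> \<pi> n = g"
  by (rule pi_factor[OF reflexive_functor_ident]) (use assms in \<open>auto simp: balanced_def\<close>)

text \<open>With \<open>balanced_right\<close>, this says that relations in either block are
  relations of the concatenation, which lets multiplication descend in each variable.\<close>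

lemma balanced_left:
  assumes "balanced (n + m) g" "n = Suc (Suc (i + k))"
  shows "(g \<cdot> P n m) \<cdot> ((mid2_iso i k \<cdot> between C (T i) d0 (T k)) \<star> \<^bold>1 (T m)) =
    (g \<cdot> P n m) \<cdot> ((mid2_iso i k \<cdot> between C (T i) d1 (T k)) \<star> \<^bold>1 (T m))"
proof -
  have g [simp]: "g \<in> Arr C" "Dom C g = T (Suc (Suc (i + (k + m))))"
    and eq: "g \<cdot> (mid2_iso i (k + m) \<cdot> between C (T i) d0 (T (k + m))) = g \<cdot> (mid2_iso i (k + m) \<cdot> between C (T i) d1 (T (k + m)))"
    using assms by (auto simp: balanced_def add.assoc simp del: copair_simps)
  let ?t = "(\<^bold>1 (T i \<boxtimes> dsum C V (W \<boxtimes> W)) \<star> P k m) \<cdot> \<a> (T i \<boxtimes> dsum C V (W \<boxtimes> W)) (T k) (T m)"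
  have "(g \<cdot> P n m) \<cdot> ((mid2_iso i k \<cdot> between C (T i) d (T k)) \<star> \<^bold>1 (T m)) =
      (g \<cdot> (mid2_iso i (k + m) \<cdot> between C (T i) d (T (k + m)))) \<cdot> ?t"
    if [simp]: "d \<in> Arr C" "Dom C d = dsum C V (W \<boxtimes> W)" "Cod C d = W \<boxtimes> W" for d
    using pow_iso_mid2_iso_left[of d i k m] assms(2) by (simp add: add.assoc)
  from this[of d0] this[of d1] show ?thesis by (simp only: eq d_simps biprod_simps V_Obj W_Obj tensor_obj_simp)
qed

lemma balanced_right:
  assumes "balanced (n + m) g" "m = Suc (Suc (i + k))"
  shows "(g \<cdot> P n m) \<cdot> (\<^bold>1 (T n) \<star> (mid2_iso i k \<cdot> between C (T i) d0 (T k))) =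
    (g \<cdot> P n m) \<cdot> (\<^bold>1 (T n) \<star> (mid2_iso i k \<cdot> between C (T i) d1 (T k)))"
proof -
  have g [simp]: "g \<in> Arr C" "Dom C g = T (Suc (Suc (n + i + k)))"
    and eq: "g \<cdot> (mid2_iso (n + i) k \<cdot> between C (T (n + i)) d0 (T k)) = g \<cdot> (mid2_iso (n + i) k \<cdot> between C (T (n + i)) d1 (T k))"
    using assms by (auto simp: balanced_def add.assoc simp del: copair_simps)
  let ?D = "dsum C V (W \<boxtimes> W)"
  let ?t = "\<a> (T n) (T i \<boxtimes> ?D) (T k) \<cdot> (\<a> (T n) (T i) ?D \<star> \<^bold>1 (T k))"
  have "((g \<cdot> P n m) \<cdot> (\<^bold>1 (T n) \<star> (mid2_iso i k \<cdot> between C (T i) d (T k)))) \<cdot> ?t =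
      (g \<cdot> (mid2_iso (n + i) k \<cdot> between C (T (n + i)) d (T k))) \<cdot> ((P n i \<star> \<^bold>1 ?D) \<star> \<^bold>1 (T k))"
    if [simp]: "d \<in> Arr C" "Dom C d = ?D" "Cod C d = W \<boxtimes> W" for d
    using pow_iso_mid2_iso_right[of d n i k] assms(2) by (simp add: add.assoc)
  from this[of d0] this[of d1]
  have "((g \<cdot> P n m) \<cdot> (\<^bold>1 (T n) \<star> (mid2_iso i k \<cdot> between C (T i) d0 (T k)))) \<cdot> ?t =
     ((g \<cdot> P n m) \<cdot> (\<^bold>1 (T n) \<star> (mid2_iso i k \<cdot> between C (T i) d1 (T k)))) \<cdot> ?t"
    by (simp only: eq d_simps biprod_simps V_Obj W_Obj tensor_obj_simp)
  then show ?thesis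
    by (rule iso_cancel_right[rotated -1]) (use assms(2) in \<open>simp_all add: add.assoc\<close>)
qed

end

section \<open>The colimit\<close>

context free_monoid_construction
begin

text \<open>Compare on \<open>W = \<I> \<oplus> V\<close>. On \<open>\<I>\<close> both sides are
  \<open>\<eta> \<star> \<eta>\<close> up to the two unitors of \<open>\<I>\<close>, which coincide;
  on \<open>V\<close> their difference is \<open>coker C \<tau> \<cdot> \<tau> = 0\<close>.\<close>

lemma eta_tensor_relation:
  "coker C \<tau> \<cdot> ((\<eta> \<star> \<^bold>1 W) \<cdot> inv_arrow C (\<l> W)) = coker C \<tau> \<cdot> ((\<^bold>1 W \<star> \<eta>) \<cdot> inv_arrow C (\<r> W))"
    (is "coker C \<tau> \<cdot> ?x = coker C \<tau> \<cdot> ?y")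
proof (rule dsum_eqI[of \<I> V])
  have [simp]: "dsum C \<I> V = W" "inj1 C \<I> V = \<eta>" "inj2 C \<I> V = \<iota>"
    by (simp_all add: V_plus_def eta_def incl_V_def)
  show "(coker C \<tau> \<cdot> ?x) \<cdot> inj1 C \<I> V = (coker C \<tau> \<cdot> ?y) \<cdot> inj1 C \<I> V"
    by (simp add: inv_unitor_nat merge left_unitor_unit)
  let ?a = "(\<eta> \<star> \<iota>) \<cdot> inv_arrow C (\<l> V)" and ?b = "(\<iota> \<star> \<eta>) \<cdot> inv_arrow C (\<r> V)"
  have "minus_arrow C (coker C \<tau> \<cdot> ?a) (coker C \<tau> \<cdot> ?b) = coker C \<tau> \<cdot> minus_arrow C ?a ?b"
    by (rule Comp_minus(1)[symmetric]) simp_all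
  also have "\<dots> = zero_arrow C V (Cod C (coker C \<tau>))"
    unfolding tau_def[symmetric] by simp
  finally have "minus_arrow C (coker C \<tau> \<cdot> ?a) (coker C \<tau> \<cdot> ?b) = zero_arrow C V (Cod C (coker C \<tau>))" .
  then have "coker C \<tau> \<cdot> ?a = coker C \<tau> \<cdot> ?b"
    by (rule minus_zero_eq[rotated 4]) simp_all
  then show "(coker C \<tau> \<cdot> ?x) \<cdot> inj2 C \<I> V = (coker C \<tau> \<cdot> ?y) \<cdot> inj2 C \<I> V"
    by (simp add: inv_unitor_nat merge)
qed (simp_all add: V_plus_def[symmetric])

text \<open>This is the last insertion \<open>eta_i C V i i\<close> without the trailing power
  \<open>T 0\<close>, see \<open>eta_i_last\<close>; a general insertion acts as
  \<open>append_eta\<close> on the first \<open>i\<close> factors.\<close>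

definition append_eta :: "nat \<Rightarrow> 'm" where
  "append_eta i = P i 1 \<cdot> (\<^bold>1 (T i) \<star> \<eta>) \<cdot> inv_arrow C (\<r> (T i))"

lemma append_eta_simps [simp]:
  "append_eta i \<in> Arr C" "Dom C (append_eta i) = T i" "Cod C (append_eta i) = T (Suc i)"
  by (simp_all add: append_eta_def)

lemma eta_i_simps [simp]:
  assumes "i \<le> n"
  shows "eta_i C V n i \<in> Arr C" "Dom C (eta_i C V n i) = T n" "Cod C (eta_i C V n i) = T (Suc n)"
  using assms by (simp_all add: eta_i_def)

lemma eta_i_pow_iso:
  "eta_i C V (i + k) i \<cdot> P i k = P (Suc i) k \<cdot> (append_eta i \<star> \<^bold>1 (T k))"
  by (simp add: eta_i_def append_eta_def whisker)

lemma eta_i_last: "eta_i C V n n = append_eta n"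
proof -
  have "eta_i C V n n \<cdot> P n 0 = append_eta n \<cdot> P n 0"
    using eta_i_pow_iso[of n 0] by (simp add: pow_iso_0_right right_unitor_nat)
  then show ?thesis by (rule iso_cancel_right[rotated -1]) simp_all
qed

lemma eta_i_0: "eta_i C V n 0 = P 1 n \<cdot> ((\<eta> \<star> \<^bold>1 (T n)) \<cdot> inv_arrow C (\<l> (T n)))"
proof -
  have "append_eta 0 = \<eta>"
    by (simp add: append_eta_def pow_iso_0_left left_unitor_nat flip: left_unitor_unit)
  then have "eta_i C V n 0 \<cdot> P 0 n = (P 1 n \<cdot> ((\<eta> \<star> \<^bold>1 (T n)) \<cdot> inv_arrow C (\<l> (T n)))) \<cdot> P 0 n"
    using eta_i_pow_iso[of 0 n] by (simp add: pow_iso_0_left)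
  then show ?thesis by (rule iso_cancel_right[rotated -1]) simp_all
qed

text \<open>Appending a unit to the right block appends it to the concatenation. This gives the
  cocone condition for multiplication in the second variable; \<open>prepend_eta_pow_iso\<close>
  serves the first.\<close>

lemma append_eta_pow_iso:
  "P n (Suc m) \<cdot> (\<^bold>1 (T n) \<star> append_eta m) = append_eta (n + m) \<cdot> P n m"
proof -
  have "append_eta (n + m) \<cdot> P n m = P (n + m) 1 \<cdot> ((P n m \<star> \<^bold>1 W) \<cdot>
      ((\<^bold>1 (T n \<boxtimes> T m) \<star> \<eta>) \<cdot> inv_arrow C (\<r> (T n \<boxtimes> T m))))"
    by (simp add: append_eta_def inv_unitor_nat inv_unitor_nat_tail merge)
  also have "\<dots> = P n (Suc m) \<cdot> ((\<^bold>1 (T n) \<star> P m 1) \<cdot> (\<a> (T n) (T m) W \<cdot>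
      ((\<^bold>1 (T n \<boxtimes> T m) \<star> \<eta>) \<cdot> inv_arrow C (\<r> (T n \<boxtimes> T m)))))"
    using pow_iso_assoc_tail[of "(\<^bold>1 (T n \<boxtimes> T m) \<star> \<eta>) \<cdot> inv_arrow C (\<r> (T n \<boxtimes> T m))" n m 1]
    by simp
  also have "\<dots> = P n (Suc m) \<cdot> (\<^bold>1 (T n) \<star> append_eta m)"
    by (simp add: append_eta_def whisker assoc_push assoc_inv_unitor)
  finally show ?thesis by simp
qed

lemma prepend_eta_pow_iso:
  "P (Suc n) m \<cdot> (eta_i C V n 0 \<star> \<^bold>1 (T m)) = eta_i C V (n + m) 0 \<cdot> P n m"
proof -
  have "P (Suc n) m \<cdot> (eta_i C V n 0 \<star> \<^bold>1 (T m)) =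
      P (1 + n) m \<cdot> ((P 1 n \<star> \<^bold>1 (T m)) \<cdot> (((\<eta> \<star> \<^bold>1 (T n)) \<star> \<^bold>1 (T m)) \<cdot> (inv_arrow C (\<l> (T n)) \<star> \<^bold>1 (T m))))"
    by (simp add: eta_i_0 whisker)
  also have "\<dots> = P 1 (n + m) \<cdot> ((\<^bold>1 W \<star> P n m) \<cdot> ((\<eta> \<star> \<^bold>1 (T n \<boxtimes> T m)) \<cdot> inv_arrow C (\<l> (T n \<boxtimes> T m))))"
    by (subst pow_iso_assoc_tail) (simp_all add: assoc_push assoc_inv_unitor)
  also have "\<dots> = eta_i C V (n + m) 0 \<cdot> P n m"
    by (simp add: eta_i_0 inv_unitor_nat whisker_exchange)
  finally show ?thesis .
qed

text \<open>The rebracketing with one marked factor \<open>W\<close>, on whose two sides the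
  insertions numbered \<open>i\<close> and \<open>Suc i\<close> take place.\<close>

definition mid1_iso :: "nat \<Rightarrow> nat \<Rightarrow> 'm" where
  "mid1_iso i k = P (Suc i) k \<cdot> (P i 1 \<star> \<^bold>1 (T k))"

lemma mid1_iso_simps [simp]:
  "mid1_iso i k \<in> Arr C" "Dom C (mid1_iso i k) = (T i \<boxtimes> W) \<boxtimes> T k" "Cod C (mid1_iso i k) = T (Suc (i + k))"
  "iso_arrow C (mid1_iso i k)"
  by (simp_all add: mid1_iso_def)

lemma eta_i_Suc_mid1_iso:
  "eta_i C V (Suc (i + k)) (Suc i) \<cdot> mid1_iso i k =
    mid2_iso i k \<cdot> between C (T i) ((\<^bold>1 W \<star> \<eta>) \<cdot> inv_arrow C (\<r> W)) (T k)"
proof -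
  have *: "append_eta (Suc i) \<cdot> P i 1 = P i (Suc (Suc 0)) \<cdot> (\<^bold>1 (T i) \<star> ((\<^bold>1 W \<star> \<eta>) \<cdot> inv_arrow C (\<r> W)))"
    using append_eta_pow_iso[of i 1] by (simp add: append_eta_def pow_iso_1_Suc[of 0, simplified])
  have "eta_i C V (Suc (i + k)) (Suc i) \<cdot> mid1_iso i k =
      P (Suc (Suc i)) k \<cdot> ((append_eta (Suc i) \<cdot> P i 1) \<star> \<^bold>1 (T k))"
    using reassoc[OF eta_i_pow_iso[of "Suc i" k], of "P i 1 \<star> \<^bold>1 (T k)"]
    by (simp add: mid1_iso_def whisker)
  also have "\<dots> = mid2_iso i k \<cdot> between C (T i) ((\<^bold>1 W \<star> \<eta>) \<cdot> inv_arrow C (\<r> W)) (T k)"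
    unfolding * by (simp add: mid2_iso_def whisker)
  finally show ?thesis .
qed

text \<open>Seen from the marked factor, this insertion puts \<open>\<eta>\<close> before
  \<open>W\<close>, whereas \<open>eta_i_Suc_mid1_iso\<close> puts it behind. Neighbouring
  insertions thus differ only by the two middle arrows of
  \<open>eta_tensor_relation\<close>.\<close>

lemma eta_i_mid1_iso:
  "eta_i C V (Suc (i + k)) i \<cdot> mid1_iso i k =
    mid2_iso i k \<cdot> between C (T i) ((\<eta> \<star> \<^bold>1 W) \<cdot> inv_arrow C (\<l> W)) (T k)"
proof -
  \<comment> \<open>First without trailing factors: the triangle identity, in the form of
    \<open>assoc_inv_unitor\<close>, converts appending to the first \<open>i\<close> factors into
    prepending to \<open>W\<close>.\<close>
  have "P (Suc i) 1 \<cdot> (append_eta i \<star> \<^bold>1 W) = P (i + 1) 1 \<cdot> ((P i 1 \<star> \<^bold>1 (T 1)) \<cdot>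
      (((\<^bold>1 (T i) \<star> \<eta>) \<star> \<^bold>1 W) \<cdot> (inv_arrow C (\<r> (T i)) \<star> \<^bold>1 W)))"
    by (simp add: append_eta_def whisker)
  also have "\<dots> = P i (Suc (Suc 0)) \<cdot> (\<^bold>1 (T i) \<star> ((\<eta> \<star> \<^bold>1 W) \<cdot> inv_arrow C (\<l> W)))"
    by (subst pow_iso_assoc_tail)
      (simp_all add: assoc_push assoc_inv_unitor whisker pow_iso_1_Suc[of 0, simplified])
  finally have *: "P (Suc i) 1 \<cdot> (append_eta i \<star> \<^bold>1 W) =
    P i (Suc (Suc 0)) \<cdot> (\<^bold>1 (T i) \<star> ((\<eta> \<star> \<^bold>1 W) \<cdot> inv_arrow C (\<l> W)))" .
  have "eta_i C V (Suc (i + k)) i \<cdot> mid1_iso i k =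
      eta_i C V (i + Suc k) i \<cdot> (P i (Suc k) \<cdot> ((\<^bold>1 (T i) \<star> P 1 k) \<cdot> \<a> (T i) W (T k)))"
    using pow_iso_assoc[of i 1 k] by (simp add: mid1_iso_def)
  also have "\<dots> = P (Suc i) (Suc k) \<cdot> ((append_eta i \<star> \<^bold>1 (T (Suc k))) \<cdot> ((\<^bold>1 (T i) \<star> P 1 k) \<cdot> \<a> (T i) W (T k)))"
    using reassoc[OF eta_i_pow_iso[of i "Suc k"], of "(\<^bold>1 (T i) \<star> P 1 k) \<cdot> \<a> (T i) W (T k)"] by simp
  also have "\<dots> = P (Suc i) (1 + k) \<cdot> ((\<^bold>1 (T (Suc i)) \<star> P 1 k) \<cdot> (\<a> (T (Suc i)) (T 1) (T k) \<cdot>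
      ((append_eta i \<star> \<^bold>1 W) \<star> \<^bold>1 (T k))))"
    by (simp add: assoc_push whisker_exchange)
  also have "\<dots> = P (Suc (Suc i)) k \<cdot> ((P (Suc i) 1 \<cdot> (append_eta i \<star> \<^bold>1 W)) \<star> \<^bold>1 (T k))"
    using pow_iso_assoc_tail[of "(append_eta i \<star> \<^bold>1 W) \<star> \<^bold>1 (T k)" "Suc i" 1 k] by (simp add: whisker)
  also have "\<dots> = mid2_iso i k \<cdot> between C (T i) ((\<eta> \<star> \<^bold>1 W) \<cdot> inv_arrow C (\<l> W)) (T k)"
    unfolding * by (simp add: mid2_iso_def whisker)
  finally show ?thesis .
qed

text \<open>Neighbouring insertions are identified by \<open>between_relation\<close> and
  \<open>eta_tensor_relation\<close>, after cancelling \<open>mid1_iso\<close>; induction links each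
  to the first.\<close>

lemma balanced_eta_i:
  assumes "balanced (Suc n) g" "i \<le> n"
  shows "g \<cdot> eta_i C V n i = g \<cdot> eta_i C V n 0"
  using assms(2)
proof (induction i)
  case (Suc i)
  then obtain k where n: "n = Suc (i + k)" by (auto dest!: le_Suc_ex)
  have g: "g \<in> Arr C" "Dom C g = T (Suc (Suc (i + k)))"
    "g \<cdot> (mid2_iso i k \<cdot> between C (T i) d0 (T k)) = g \<cdot> (mid2_iso i k \<cdot> between C (T i) d1 (T k))"
    using assms(1) by (auto simp: balanced_def n simp del: copair_simps)
  let ?x = "(\<eta> \<star> \<^bold>1 W) \<cdot> inv_arrow C (\<l> W)" and ?y = "(\<^bold>1 W \<star> \<eta>) \<cdot> inv_arrow C (\<r> W)"
  have rel: "(g \<cdot> mid2_iso i k) \<cdot> between C (T i) ?x (T k) = (g \<cdot> mid2_iso i k) \<cdot> between C (T i) ?y (T k)"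
    by (rule between_relation) (use g eta_tensor_relation in \<open>simp_all del: copair_simps\<close>)
  have "(g \<cdot> eta_i C V n (Suc i)) \<cdot> mid1_iso i k = (g \<cdot> eta_i C V n i) \<cdot> mid1_iso i k"
    using g(1,2) rel by (simp add: n eta_i_mid1_iso eta_i_Suc_mid1_iso)
  then have "g \<cdot> eta_i C V n (Suc i) = g \<cdot> eta_i C V n i"
    by (rule iso_cancel_right[rotated -1]) (use g(1,2) n in simp_all)
  then show ?case using Suc by simp
qed simp

text \<open>Naturality of the left unitor moves a relation past the prepended \<open>\<eta>\<close>,
  where it sits in the right block of \<open>P 1 n\<close>; \<open>balanced_right\<close> finishes.
  It follows that \<open>eta_tilde\<close> exists.\<close>

lemma balanced_Comp_eta_0:
  assumes "balanced (Suc n) g"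
  shows "balanced n (g \<cdot> eta_i C V n 0)"
  unfolding balanced_def
proof (intro conjI allI impI)
  have g: "g \<in> Arr C" "Dom C g = T (Suc n)" using assms by (auto simp: balanced_def)
  then show "g \<cdot> eta_i C V n 0 \<in> Arr C" "Dom C (g \<cdot> eta_i C V n 0) = T n" by simp_all
  fix i k assume n: "n = Suc (Suc (i + k))"
  let ?D = "dsum C V (W \<boxtimes> W)"
  have *: "(g \<cdot> eta_i C V n 0) \<cdot> (mid2_iso i k \<cdot> between C (T i) d (T k)) =
    ((g \<cdot> P 1 n) \<cdot> (\<^bold>1 (T 1) \<star> (mid2_iso i k \<cdot> between C (T i) d (T k)))) \<cdot>
      ((\<eta> \<star> \<^bold>1 ((T i \<boxtimes> ?D) \<boxtimes> T k)) \<cdot> inv_arrow C (\<l> ((T i \<boxtimes> ?D) \<boxtimes> T k)))"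
    if "d \<in> Arr C" "Dom C d = ?D" "Cod C d = W \<boxtimes> W" for d
    using g n that by (simp add: eta_i_0 inv_unitor_nat inv_unitor_nat_tail whisker whisker_exchange)
  show "(g \<cdot> eta_i C V n 0) \<cdot> (mid2_iso i k \<cdot> between C (T i) d0 (T k)) =
    (g \<cdot> eta_i C V n 0) \<cdot> (mid2_iso i k \<cdot> between C (T i) d1 (T k))"
    using *[of d0] *[of d1] balanced_right[of 1 n g i k] assms n
    by (simp only: d_simps biprod_simps V_Obj W_Obj tensor_obj_simp plus_1_eq_Suc)
qed

lemma eta_tilde_spec:
  "eta_tilde C V n \<in> Hom C (Vt C V n) (Vt C V (Suc n)) \<and>
    (\<forall>i\<le>n. eta_tilde C V n \<cdot> \<pi> n = \<pi> (Suc n) \<cdot> eta_i C V n i)"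
  unfolding eta_tilde_def
proof (rule theI')
  obtain h where h: "h \<in> Arr C" "Dom C h = Vt C V n" "Cod C h = Vt C V (Suc n)"
    "h \<cdot> \<pi> n = \<pi> (Suc n) \<cdot> eta_i C V n 0"
    using balanced_factor[OF balanced_Comp_eta_0[OF balanced_pi[of "Suc n"]]] by auto
  have 1: "h \<in> Hom C (Vt C V n) (Vt C V (Suc n)) \<and> (\<forall>i\<le>n. h \<cdot> \<pi> n = \<pi> (Suc n) \<cdot> eta_i C V n i)"
  proof (intro conjI allI impI)
    fix i assume "i \<le> n"
    then show "h \<cdot> \<pi> n = \<pi> (Suc n) \<cdot> eta_i C V n i"
      using h(4) balanced_eta_i[OF balanced_pi, of i n] by (simp only:)
  qed (use h(1-3) in \<open>simp add: Hom_iff\<close>)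
  have "h' = h" if "h' \<in> Hom C (Vt C V n) (Vt C V (Suc n)) \<and> (\<forall>i\<le>n. h' \<cdot> \<pi> n = \<pi> (Suc n) \<cdot> eta_i C V n i)" for h'
  proof (rule epicD[OF epic_pi(1)[of \<I> n]])
    show "h' \<cdot> \<pi> n = h \<cdot> \<pi> n" using that h(4) by simp
  qed (use h(1-3) that in \<open>simp_all add: Hom_iff\<close>)
  with 1 show "\<exists>!h. h \<in> Hom C (Vt C V n) (Vt C V (Suc n)) \<and> (\<forall>i\<le>n. h \<cdot> \<pi> n = \<pi> (Suc n) \<cdot> eta_i C V n i)"
    by blast
qed

lemma eta_tilde_simps [simp]:
  "eta_tilde C V n \<in> Arr C" "Dom C (eta_tilde C V n) = Vt C V n" "Cod C (eta_tilde C V n) = Vt C V (Suc n)"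
  using eta_tilde_spec[of n] by (auto simp: Hom_iff)

lemma eta_tilde_pi: "i \<le> n \<Longrightarrow> eta_tilde C V n \<cdot> \<pi> n = \<pi> (Suc n) \<cdot> eta_i C V n i"
  using eta_tilde_spec[of n] by blast

section \<open>The colimit and equality of arrows out of its tensor powers\<close>

abbreviation F :: 'o where "F \<equiv> FV C V"
abbreviation j :: "nat \<Rightarrow> 'm" where "j n \<equiv> j_n C V n"

lemma sequential_diagram_eta_tilde: "sequential_diagram C (eta_tilde C V)"
  by (simp add: sequential_diagram_def)

lemma sequential_colimit_F: "sequential_colimit C (eta_tilde C V) F (j_n C V)"
proof -
  have "\<exists>t. case t of (L, c) \<Rightarrow> sequential_colimit C (eta_tilde C V) L c"
    using sequential_colimits sequential_diagram_eta_tilde unfolding has_sequential_colimits_def by auto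
  then have "case seq_colim C (eta_tilde C V) of (L, c) \<Rightarrow> sequential_colimit C (eta_tilde C V) L c"
    unfolding seq_colim_def by (rule someI_ex)
  then show ?thesis by (simp add: FV_def j_n_def split: prod.splits)
qed

lemma j_simps [simp]: "j n \<in> Arr C" "Dom C (j n) = Vt C V n" "Cod C (j n) = F" "j (Suc n) \<cdot> eta_tilde C V n = j n"
  using sequential_colimit_F by (auto simp: sequential_colimit_def sequential_cocone_def Hom_iff)

lemma F_Obj [simp]: "F \<in> Obj C"
  using Dom_Cod_Obj(2)[of "j 0"] by simp

definition w :: "nat \<Rightarrow> 'm" where
  "w n = j n \<cdot> \<pi> n"

lemma w_simps [simp]: "w n \<in> Arr C" "Dom C (w n) = T n" "Cod C (w n) = F"
  by (simp_all add: w_def)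

lemma balanced_w: "balanced n (w n)"
  unfolding w_def by (intro balanced_Comp balanced_pi) simp_all

lemma w_eta_i:
  assumes "i \<le> n"
  shows "w (Suc n) \<cdot> eta_i C V n i = w n"
proof -
  have "w (Suc n) \<cdot> eta_i C V n i = (j (Suc n) \<cdot> eta_tilde C V n) \<cdot> \<pi> n"
    using assms by (simp add: w_def eta_tilde_pi[of i n] del: j_simps(4))
  then show ?thesis by (simp add: w_def)
qed

text \<open>Refers to the two kinds of colimits in the construction, not to all colimits.\<close>

definition cocontinuous :: "('o \<Rightarrow> 'o) \<Rightarrow> ('m \<Rightarrow> 'm) \<Rightarrow> bool" where
  "cocontinuous Fo Fm \<longleftrightarrow> reflexive_functor C Fo Fm \<and> preserves_sequential_colimits C Fo Fm"

lemma cocontinuous_comp: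
  assumes "cocontinuous Fo Fm" "cocontinuous Go Gm"
  shows "cocontinuous (\<lambda>X. Go (Fo X)) (\<lambda>f. Gm (Fm f))"
proof -
  interpret F: reflexive_functor C Fo Fm using assms(1) by (simp add: cocontinuous_def)
  have "sequential_diagram C (\<lambda>n. Fm (x n))" if "sequential_diagram C x" for x
    using that by (simp add: sequential_diagram_def)
  then show ?thesis
    using assms reflexive_functor_comp
    by (auto simp: cocontinuous_def preserves_sequential_colimits_def)
qed

lemma cocontinuous_tensor:
  assumes "A \<in> Obj C"
  shows "cocontinuous (\<lambda>X. X) (\<lambda>f. f)" "cocontinuous (\<lambda>X. A \<boxtimes> X) (\<lambda>f. \<^bold>1 A \<star> f)"
    "cocontinuous (\<lambda>X. X \<boxtimes> A) (\<lambda>f. f \<star> \<^bold>1 A)"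
  using assms reflexive_functor_tensor[of A] reflexive_functor_ident tensor_sequential
  by (simp_all add: cocontinuous_def tensor_preserves_sequential_colimits_def preserves_sequential_colimits_def)

lemma cocontinuous_colimit:
  assumes "cocontinuous Fo Fm"
  shows "sequential_colimit C (\<lambda>n. Fm (eta_tilde C V n)) (Fo F) (\<lambda>n. Fm (j n))"
  using assms sequential_diagram_eta_tilde sequential_colimit_F
  unfolding cocontinuous_def preserves_sequential_colimits_def by blast

text \<open>The arrows \<open>Fm (j n)\<close> are jointly epic as colimit legs and each
  \<open>Fm (\<pi> n)\<close> is epic, so the composites \<open>Fm (w n)\<close> are jointly
  epic.\<close>

lemma cocontinuous_eqI:
  assumes "cocontinuous Fo Fm" "u \<in> Arr C" "v \<in> Arr C" "Dom C u = Fo F" "Dom C v = Fo F" "Cod C u = Cod C v"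
    "\<And>n. u \<cdot> Fm (w n) = v \<cdot> Fm (w n)"
  shows "u = v"
proof -
  interpret F: reflexive_functor C Fo Fm using assms(1) by (simp add: cocontinuous_def)
  show ?thesis
  proof (rule sequential_colimit_joint[OF cocontinuous_colimit[OF assms(1)] assms(2-6)])
    fix n
    show "u \<cdot> Fm (j n) = v \<cdot> Fm (j n)"
      by (rule epicD[OF epic_Fm_pi[OF F.reflexive_functor_axioms, of n]])
        (use assms in \<open>simp_all add: w_def F.Fm_Comp\<close>)
  qed (simp add: sequential_diagram_def)
qed

lemmas F_eqI = cocontinuous_eqI[OF cocontinuous_tensor(1)[OF unit_obj_simp]]
lemmas tensor_F_eqI = cocontinuous_eqI[OF cocontinuous_tensor(2)]
lemmas F_tensor_eqI = cocontinuous_eqI[OF cocontinuous_tensor(3)]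

text \<open>One tensor factor is tested at a time, the other being held fixed, since only one-sided
  tensor functors are cocontinuous.\<close>

lemma F_F_eqI:
  assumes "u \<in> Arr C" "v \<in> Arr C" "Dom C u = F \<boxtimes> F" "Dom C v = F \<boxtimes> F" "Cod C u = Cod C v"
    "\<And>n m. u \<cdot> (w n \<star> w m) = v \<cdot> (w n \<star> w m)"
  shows "u = v"
proof (rule F_tensor_eqI[OF _ assms(1-5)])
  fix n
  show "u \<cdot> (w n \<star> \<^bold>1 F) = v \<cdot> (w n \<star> \<^bold>1 F)"
    by (rule tensor_F_eqI[where A = "T n"]) (use assms in \<open>simp_all add: interchange\<close>)
qed simp

text \<open>The last factor is tested first, then the first, then the middle one; factors already
  tested are replaced by powers \<open>T k\<close> and \<open>T n\<close>.\<close>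

lemma F_F_F_eqI:
  assumes "u \<in> Arr C" "v \<in> Arr C" "Dom C u = (F \<boxtimes> F) \<boxtimes> F" "Dom C v = (F \<boxtimes> F) \<boxtimes> F" "Cod C u = Cod C v"
    "\<And>n m k. u \<cdot> ((w n \<star> w m) \<star> w k) = v \<cdot> ((w n \<star> w m) \<star> w k)"
  shows "u = v"
proof (rule tensor_F_eqI[OF _ assms(1-5)])
  fix k
  show "u \<cdot> (\<^bold>1 (F \<boxtimes> F) \<star> w k) = v \<cdot> (\<^bold>1 (F \<boxtimes> F) \<star> w k)"
  proof (rule cocontinuous_eqI[OF cocontinuous_comp[OF cocontinuous_tensor(3)[of F] cocontinuous_tensor(3)[of "T k"]]])
    fix n
    show "(u \<cdot> (\<^bold>1 (F \<boxtimes> F) \<star> w k)) \<cdot> ((w n \<star> \<^bold>1 F) \<star> \<^bold>1 (T k)) =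
      (v \<cdot> (\<^bold>1 (F \<boxtimes> F) \<star> w k)) \<cdot> ((w n \<star> \<^bold>1 F) \<star> \<^bold>1 (T k))"
      by (rule cocontinuous_eqI[OF cocontinuous_comp[OF cocontinuous_tensor(2)[of "T n"] cocontinuous_tensor(3)[of "T k"]]])
        (use assms in \<open>simp_all add: merge\<close>)
  qed (use assms in simp_all)
qed simp

end

section \<open>Multiplication and universal property\<close>

context free_monoid_construction
begin

lemma epic_pi_pi: "epic C (\<pi> n \<star> \<pi> m)"
proof -
  have "\<pi> n \<star> \<pi> m = (\<^bold>1 (Vt C V n) \<star> \<pi> m) \<cdot> (\<pi> n \<star> \<^bold>1 (T m))"
    by (simp add: interchange)
  then show ?thesis
    using epic_Comp[OF epic_pi(3)[of "T m" n] epic_pi(2)[of "Vt C V n" m]] by simp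
qed

lemma mu_nm_eq: "mu_nm C V n m = w (n + m) \<cdot> P n m"
  by (simp add: mu_nm_def w_def)

text \<open>Descends one variable at a time: \<open>h\<close> along \<open>\<pi> n\<close> by
  \<open>balanced_left\<close>, then \<open>k\<close> along \<open>\<pi> m\<close>. The relations
  for the second descent are checked after precomposing with the epimorphism
  \<open>\<pi> n \<star> id\<close>, where \<open>balanced_right\<close> applies.\<close>

lemma mu_tilde_spec:
  "mu_tilde C V n m \<in> Hom C (Vt C V n \<boxtimes> Vt C V m) F \<and> mu_tilde C V n m \<cdot> (\<pi> n \<star> \<pi> m) = mu_nm C V n m"
  unfolding mu_tilde_def
proof (rule theI')
  let ?g = "w (n + m) \<cdot> P n m"
  have "\<exists>h. h \<in> Arr C \<and> Dom C h = Vt C V n \<boxtimes> T m \<and> Cod C h = Cod C ?g \<and> h \<cdot> (\<pi> n \<star> \<^bold>1 (T m)) = ?g"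
    by (rule pi_factor[OF reflexive_functor_tensor(2)]) (simp_all only: balanced_left[OF balanced_w], simp_all)
  then obtain h where h [simp]: "h \<in> Arr C" "Dom C h = Vt C V n \<boxtimes> T m" "Cod C h = F"
    and h_eq: "h \<cdot> (\<pi> n \<star> \<^bold>1 (T m)) = ?g" by auto
  have "\<exists>k. k \<in> Arr C \<and> Dom C k = Vt C V n \<boxtimes> Vt C V m \<and> Cod C k = Cod C h \<and> k \<cdot> (\<^bold>1 (Vt C V n) \<star> \<pi> m) = h"
  proof (rule pi_factor[OF reflexive_functor_tensor(1)])
    fix i k assume m: "m = Suc (Suc (i + k))"
    let ?e = "\<lambda>d. mid2_iso i k \<cdot> between C (T i) d (T k)"
    let ?D = "(T i \<boxtimes> dsum C V (W \<boxtimes> W)) \<boxtimes> T k"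
    have *: "(h \<cdot> (\<^bold>1 (Vt C V n) \<star> ?e d)) \<cdot> (\<pi> n \<star> \<^bold>1 ?D) = ?g \<cdot> (\<^bold>1 (T n) \<star> ?e d)"
      if [simp]: "d \<in> Arr C" "Dom C d = dsum C V (W \<boxtimes> W)" "Cod C d = W \<boxtimes> W" for d
    proof -
      have "(h \<cdot> (\<^bold>1 (Vt C V n) \<star> ?e d)) \<cdot> (\<pi> n \<star> \<^bold>1 ?D) = (h \<cdot> (\<pi> n \<star> \<^bold>1 (T m))) \<cdot> (\<^bold>1 (T n) \<star> ?e d)"
        by (simp add: m interchange)
      then show ?thesis by (simp only: h_eq)
    qed
    show "h \<cdot> (\<^bold>1 (Vt C V n) \<star> ?e d0) = h \<cdot> (\<^bold>1 (Vt C V n) \<star> ?e d1)"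
    proof (rule epicD[OF epic_pi(3)[of ?D n]])
      show "(h \<cdot> (\<^bold>1 (Vt C V n) \<star> ?e d0)) \<cdot> (\<pi> n \<star> \<^bold>1 ?D) = (h \<cdot> (\<^bold>1 (Vt C V n) \<star> ?e d1)) \<cdot> (\<pi> n \<star> \<^bold>1 ?D)"
        using *[of d0] *[of d1] balanced_right[OF balanced_w m]
        by (simp only: d_simps biprod_simps V_Obj W_Obj tensor_obj_simp)
    qed (simp_all add: m)
  qed simp_all
  then obtain k where k [simp]: "k \<in> Arr C" "Dom C k = Vt C V n \<boxtimes> Vt C V m" "Cod C k = F"
    and k_eq: "k \<cdot> (\<^bold>1 (Vt C V n) \<star> \<pi> m) = h" by auto
  have "k \<cdot> (\<pi> n \<star> \<pi> m) = (k \<cdot> (\<^bold>1 (Vt C V n) \<star> \<pi> m)) \<cdot> (\<pi> n \<star> \<^bold>1 (T m))"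
    by (simp add: interchange)
  then have 1: "k \<cdot> (\<pi> n \<star> \<pi> m) = mu_nm C V n m" by (simp only: k_eq h_eq mu_nm_eq)
  have "k' = k" if "k' \<in> Hom C (Vt C V n \<boxtimes> Vt C V m) F \<and> k' \<cdot> (\<pi> n \<star> \<pi> m) = mu_nm C V n m" for k'
    by (rule epicD[OF epic_pi_pi]) (use 1 that in \<open>simp_all add: Hom_iff\<close>)
  with 1 show "\<exists>!h. h \<in> Hom C (Vt C V n \<boxtimes> Vt C V m) F \<and> h \<cdot> (\<pi> n \<star> \<pi> m) = mu_nm C V n m"
    by (intro ex1I[of _ k]) (simp_all add: Hom_iff)
qed

lemma mu_tilde_simps [simp]:
  "mu_tilde C V n m \<in> Arr C" "Dom C (mu_tilde C V n m) = Vt C V n \<boxtimes> Vt C V m" "Cod C (mu_tilde C V n m) = F"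
  using mu_tilde_spec[of n m] by (auto simp: Hom_iff)

lemma mu_tilde_pi: "mu_tilde C V n m \<cdot> (\<pi> n \<star> \<pi> m) = w (n + m) \<cdot> P n m"
  using mu_tilde_spec[of n m] by (simp add: mu_nm_eq)

text \<open>\<open>eta_tilde\<close> is induced by every insertion, so the convenient one can be
  chosen: the last in the second variable, the first in the first variable. Each is compatible with
  concatenation and is absorbed by \<open>w\<close>.\<close>

lemma mu_tilde_eta_tilde:
  "mu_tilde C V n (Suc m) \<cdot> (\<^bold>1 (Vt C V n) \<star> eta_tilde C V m) = mu_tilde C V n m"
  "mu_tilde C V (Suc n) m \<cdot> (eta_tilde C V n \<star> \<^bold>1 (Vt C V m)) = mu_tilde C V n m"
proof -
  have "(mu_tilde C V n (Suc m) \<cdot> (\<^bold>1 (Vt C V n) \<star> eta_tilde C V m)) \<cdot> (\<pi> n \<star> \<pi> m) =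
      (mu_tilde C V n (Suc m) \<cdot> (\<pi> n \<star> \<pi> (Suc m))) \<cdot> (\<^bold>1 (T n) \<star> append_eta m)"
    by (simp add: interchange eta_tilde_pi[of m m] eta_i_last)
  also have "\<dots> = w (Suc (n + m)) \<cdot> (eta_i C V (n + m) (n + m) \<cdot> P n m)"
    unfolding mu_tilde_pi by (simp add: append_eta_pow_iso eta_i_last)
  also have "\<dots> = mu_tilde C V n m \<cdot> (\<pi> n \<star> \<pi> m)"
    by (subst reassoc[OF w_eta_i]) (simp_all add: mu_tilde_pi)
  finally show "mu_tilde C V n (Suc m) \<cdot> (\<^bold>1 (Vt C V n) \<star> eta_tilde C V m) = mu_tilde C V n m"
    by (rule epicD[OF epic_pi_pi]) simp_all
  have "(mu_tilde C V (Suc n) m \<cdot> (eta_tilde C V n \<star> \<^bold>1 (Vt C V m))) \<cdot> (\<pi> n \<star> \<pi> m) =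
      (mu_tilde C V (Suc n) m \<cdot> (\<pi> (Suc n) \<star> \<pi> m)) \<cdot> (eta_i C V n 0 \<star> \<^bold>1 (T m))"
    by (simp add: interchange eta_tilde_pi[of 0 n])
  also have "\<dots> = w (Suc (n + m)) \<cdot> (eta_i C V (n + m) 0 \<cdot> P n m)"
    unfolding mu_tilde_pi by (simp add: prepend_eta_pow_iso)
  also have "\<dots> = mu_tilde C V n m \<cdot> (\<pi> n \<star> \<pi> m)"
    by (subst reassoc[OF w_eta_i]) (simp_all add: mu_tilde_pi)
  finally show "mu_tilde C V (Suc n) m \<cdot> (eta_tilde C V n \<star> \<^bold>1 (Vt C V m)) = mu_tilde C V n m"
    by (rule epicD[OF epic_pi_pi]) simp_all
qed

lemma mu_tilde_star_spec:
  "mu_tilde_star C V n \<in> Hom C (Vt C V n \<boxtimes> F) F \<and>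
    (\<forall>m. mu_tilde_star C V n \<cdot> (\<^bold>1 (Vt C V n) \<star> j m) = mu_tilde C V n m)"
proof -
  have "sequential_cocone C (\<lambda>m. \<^bold>1 (Vt C V n) \<star> eta_tilde C V m) F (mu_tilde C V n)"
    by (simp add: sequential_cocone_def Hom_iff mu_tilde_eta_tilde)
  then have "\<exists>!h. h \<in> Hom C (Vt C V n \<boxtimes> F) F \<and> (\<forall>m. h \<cdot> (\<^bold>1 (Vt C V n) \<star> j m) = mu_tilde C V n m)"
    using cocontinuous_colimit[OF cocontinuous_tensor(2)[of "Vt C V n"]]
    unfolding sequential_colimit_def by auto
  then show ?thesis unfolding mu_tilde_star_def by (rule theI')
qed

lemma mu_tilde_star_simps [simp]:
  "mu_tilde_star C V n \<in> Arr C" "Dom C (mu_tilde_star C V n) = Vt C V n \<boxtimes> F"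
  "Cod C (mu_tilde_star C V n) = F"
  "mu_tilde_star C V n \<cdot> (\<^bold>1 (Vt C V n) \<star> j m) = mu_tilde C V n m"
  using mu_tilde_star_spec[of n] by (auto simp: Hom_iff)

lemma mu_tilde_star_eta_tilde:
  "mu_tilde_star C V (Suc n) \<cdot> (eta_tilde C V n \<star> \<^bold>1 F) = mu_tilde_star C V n"
proof (rule sequential_colimit_joint[OF cocontinuous_colimit[OF cocontinuous_tensor(2)[of "Vt C V n"]]])
  fix m
  have "(mu_tilde_star C V (Suc n) \<cdot> (eta_tilde C V n \<star> \<^bold>1 F)) \<cdot> (\<^bold>1 (Vt C V n) \<star> j m) =
    (mu_tilde_star C V (Suc n) \<cdot> (\<^bold>1 (Vt C V (Suc n)) \<star> j m)) \<cdot> (eta_tilde C V n \<star> \<^bold>1 (Vt C V m))"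
    by (simp add: interchange del: mu_tilde_star_simps(4))
  then show "(mu_tilde_star C V (Suc n) \<cdot> (eta_tilde C V n \<star> \<^bold>1 F)) \<cdot> (\<^bold>1 (Vt C V n) \<star> j m) =
    mu_tilde_star C V n \<cdot> (\<^bold>1 (Vt C V n) \<star> j m)"
    by (simp only: mu_tilde_star_simps(4) mu_tilde_eta_tilde)
qed (simp_all add: sequential_diagram_def)

abbreviation \<mu> :: 'm where "\<mu> \<equiv> mu_bar C V"

lemma mu_bar_spec: "\<mu> \<in> Hom C (F \<boxtimes> F) F \<and> (\<forall>n. \<mu> \<cdot> (j n \<star> \<^bold>1 F) = mu_tilde_star C V n)"
proof -
  have "sequential_cocone C (\<lambda>n. eta_tilde C V n \<star> \<^bold>1 F) F (mu_tilde_star C V)"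
    by (simp add: sequential_cocone_def Hom_iff mu_tilde_star_eta_tilde)
  then have "\<exists>!h. h \<in> Hom C (F \<boxtimes> F) F \<and> (\<forall>n. h \<cdot> (j n \<star> \<^bold>1 F) = mu_tilde_star C V n)"
    using cocontinuous_colimit[OF cocontinuous_tensor(3)[of F]]
    unfolding sequential_colimit_def by auto
  then show ?thesis unfolding mu_bar_def by (rule theI')
qed

lemma mu_bar_simps [simp]: "\<mu> \<in> Arr C" "Dom C \<mu> = F \<boxtimes> F" "Cod C \<mu> = F"
  using mu_bar_spec by (auto simp: Hom_iff)

text \<open>Unwinds the successive descents in the definition of \<open>\<mu>\<close>: on tensor
  powers multiplication is concatenation.\<close>

lemma mu_bar_w: "\<mu> \<cdot> (w n \<star> w m) = w (n + m) \<cdot> P n m"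
proof -
  have "\<mu> \<cdot> (w n \<star> w m) = ((\<mu> \<cdot> (j n \<star> \<^bold>1 F)) \<cdot> (\<^bold>1 (Vt C V n) \<star> j m)) \<cdot> (\<pi> n \<star> \<pi> m)"
    by (simp add: w_def interchange)
  also have "\<mu> \<cdot> (j n \<star> \<^bold>1 F) = mu_tilde_star C V n" using mu_bar_spec by blast
  finally show ?thesis by (simp add: mu_tilde_pi)
qed

lemma eta_bar_eq: "eta_bar C V = w 0"
  by (simp add: eta_bar_def w_def)

text \<open>Tested on the jointly epic arrows built from \<open>w\<close>, associativity is
  \<open>pow_iso_assoc\<close> and the unit laws are the values of \<open>pow_iso\<close> at
  zero.\<close>

lemma monoid_object_F: "monoid_object C F \<mu> (eta_bar C V)"
  unfolding monoid_object_def
proof (intro conjI)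
  show "\<mu> \<cdot> (\<mu> \<star> \<^bold>1 F) = \<mu> \<cdot> (\<^bold>1 F \<star> \<mu>) \<cdot> \<a> F F F"
  proof (rule F_F_F_eqI)
    fix n m k
    have "(\<mu> \<cdot> (\<mu> \<star> \<^bold>1 F)) \<cdot> ((w n \<star> w m) \<star> w k) = \<mu> \<cdot> ((\<mu> \<cdot> (w n \<star> w m)) \<star> w k)"
      by (simp add: interchange)
    also have "\<dots> = (\<mu> \<cdot> (w (n + m) \<star> w k)) \<cdot> (P n m \<star> \<^bold>1 (T k))"
      unfolding mu_bar_w[of n m] by (simp add: interchange)
    also have "\<dots> = w (n + m + k) \<cdot> (P (n + m) k \<cdot> (P n m \<star> \<^bold>1 (T k)))"
      unfolding mu_bar_w by simp
    also have "\<dots> = (w (n + (m + k)) \<cdot> P n (m + k)) \<cdot> ((\<^bold>1 (T n) \<star> P m k) \<cdot> \<a> (T n) (T m) (T k))"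
      unfolding pow_iso_assoc by (simp add: add.assoc)
    also have "\<dots> = (\<mu> \<cdot> (w n \<star> w (m + k))) \<cdot> ((\<^bold>1 (T n) \<star> P m k) \<cdot> \<a> (T n) (T m) (T k))"
      by (simp only: mu_bar_w)
    also have "\<dots> = (\<mu> \<cdot> (w n \<star> (w (m + k) \<cdot> P m k))) \<cdot> \<a> (T n) (T m) (T k)"
      by (simp add: merge)
    also have "\<dots> = (\<mu> \<cdot> (w n \<star> (\<mu> \<cdot> (w m \<star> w k)))) \<cdot> \<a> (T n) (T m) (T k)"
      by (simp only: mu_bar_w)
    also have "\<dots> = (\<mu> \<cdot> (\<^bold>1 F \<star> \<mu>) \<cdot> \<a> F F F) \<cdot> ((w n \<star> w m) \<star> w k)"
      by (simp add: merge assoc_push)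
    finally show "(\<mu> \<cdot> (\<mu> \<star> \<^bold>1 F)) \<cdot> ((w n \<star> w m) \<star> w k) = (\<mu> \<cdot> (\<^bold>1 F \<star> \<mu>) \<cdot> \<a> F F F) \<cdot> ((w n \<star> w m) \<star> w k)" .
  qed simp_all
  show "\<mu> \<cdot> (eta_bar C V \<star> \<^bold>1 F) = \<l> F"
    by (rule tensor_F_eqI[where A = \<I>])
      (simp_all add: eta_bar_eq interchange mu_bar_w pow_iso_0_left left_unitor_nat)
  show "\<mu> \<cdot> (\<^bold>1 F \<star> eta_bar C V) = \<r> F"
    by (rule F_tensor_eqI[where A = \<I>])
      (simp_all add: eta_bar_eq interchange mu_bar_w pow_iso_0_right right_unitor_nat)
qed (simp_all add: Hom_iff eta_bar_eq)

lemma w_1_eta: "w 1 \<cdot> \<eta> = w 0"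
proof -
  have "eta_i C V 0 0 = \<eta>"
    by (simp add: eta_i_last append_eta_def pow_iso_0_left left_unitor_nat flip: left_unitor_unit)
  then show ?thesis using w_eta_i[of 0 0] by simp
qed

text \<open>Peels off one factor \<open>w 1\<close>, showing that the monoid is generated by
  \<open>w 1\<close>; uniqueness of extensions rests on this.\<close>

lemma w_Suc_Suc: "w (Suc (Suc n)) = \<mu> \<cdot> (w 1 \<star> w (Suc n))"
  unfolding mu_bar_w by (simp add: pow_iso_1_Suc)

lemma W_eqI:
  assumes "u \<in> Arr C" "v \<in> Arr C" "Dom C u = W" "Dom C v = W" "Cod C u = Cod C v"
    "u \<cdot> \<eta> = v \<cdot> \<eta>" "u \<cdot> \<iota> = v \<cdot> \<iota>"
  shows "u = v"
  by (rule dsum_eqI[of \<I> V]) (use assms in \<open>simp_all add: V_plus_def eta_def incl_V_def\<close>)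

section \<open>Extension of an arrow into a monoid\<close>

context
  fixes M :: 'o and \<nu> \<epsilon> f :: 'm
  assumes monoid: "monoid_object C M \<nu> \<epsilon>" and f_Hom: "f \<in> Hom C V M"
begin

lemma M_simps [simp]:
  "M \<in> Obj C" "\<nu> \<in> Arr C" "Dom C \<nu> = M \<boxtimes> M" "Cod C \<nu> = M" "\<epsilon> \<in> Arr C" "Dom C \<epsilon> = \<I>" "Cod C \<epsilon> = M"
  "f \<in> Arr C" "Dom C f = V" "Cod C f = M"
  using monoid f_Hom by (auto simp: monoid_object_def Hom_iff)

lemma M_assoc: "\<nu> \<cdot> (\<nu> \<star> \<^bold>1 M) = \<nu> \<cdot> ((\<^bold>1 M \<star> \<nu>) \<cdot> \<a> M M M)"
  and M_unit: "\<nu> \<cdot> (\<epsilon> \<star> \<^bold>1 M) = \<l> M" "\<nu> \<cdot> (\<^bold>1 M \<star> \<epsilon>) = \<r> M"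
  using monoid by (auto simp: monoid_object_def)

definition ext1 :: 'm where
  "ext1 = copair C \<epsilon> f"

lemma ext1_simps [simp]: "ext1 \<in> Arr C" "Dom C ext1 = W" "Cod C ext1 = M" "ext1 \<cdot> \<eta> = \<epsilon>" "ext1 \<cdot> \<iota> = f"
  by (simp_all add: ext1_def V_plus_def eta_def incl_V_def)

text \<open>The clauses follow those of \<open>tensor_pow\<close>; with no trailing unit, the value
  at one is \<open>ext1\<close> itself.\<close>

fun ext :: "nat \<Rightarrow> 'm" where
  "ext 0 = \<epsilon>"
| "ext (Suc 0) = ext1"
| "ext (Suc (Suc n)) = \<nu> \<cdot> (ext1 \<star> ext (Suc n))"

declare ext.simps(3) [simp del]

lemma ext_simps [simp]: "ext n \<in> Arr C" "Dom C (ext n) = T n" "Cod C (ext n) = M"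
proof -
  have "ext n \<in> Arr C \<and> Dom C (ext n) = T n \<and> Cod C (ext n) = M"
    by (induction n rule: induct_nat_012) (simp_all add: ext.simps(3) T_simps)
  then show "ext n \<in> Arr C" "Dom C (ext n) = T n" "Cod C (ext n) = M" by blast+
qed

lemma M_unit_left:
  assumes "g \<in> Arr C" "Cod C g = M"
  shows "\<nu> \<cdot> (\<epsilon> \<star> g) = g \<cdot> \<l> (Dom C g)"
proof -
  have "\<nu> \<cdot> (\<epsilon> \<star> g) = (\<nu> \<cdot> (\<epsilon> \<star> \<^bold>1 M)) \<cdot> (\<^bold>1 \<I> \<star> g)" using assms by (simp add: interchange)
  then show ?thesis unfolding M_unit using assms by (simp add: left_unitor_nat)
qed

lemma M_unit_right:
  assumes "g \<in> Arr C" "Cod C g = M"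
  shows "\<nu> \<cdot> (g \<star> \<epsilon>) = g \<cdot> \<r> (Dom C g)"
proof -
  have "\<nu> \<cdot> (g \<star> \<epsilon>) = (\<nu> \<cdot> (\<^bold>1 M \<star> \<epsilon>)) \<cdot> (g \<star> \<^bold>1 \<I>)" using assms by (simp add: interchange)
  then show ?thesis unfolding M_unit using assms by (simp add: right_unitor_nat)
qed

lemma M_assoc_tensor:
  assumes "a \<in> Arr C" "b \<in> Arr C" "c \<in> Arr C" "Cod C a = M" "Cod C b = M" "Cod C c = M"
  shows "\<nu> \<cdot> ((\<nu> \<cdot> (a \<star> b)) \<star> c) = \<nu> \<cdot> ((a \<star> (\<nu> \<cdot> (b \<star> c))) \<cdot> \<a> (Dom C a) (Dom C b) (Dom C c))"
proof -
  have "\<nu> \<cdot> ((\<nu> \<cdot> (a \<star> b)) \<star> c) = (\<nu> \<cdot> (\<nu> \<star> \<^bold>1 M)) \<cdot> ((a \<star> b) \<star> c)"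
    using assms by (simp add: interchange)
  then show ?thesis unfolding M_assoc using assms by (simp add: assoc_push merge)
qed

text \<open>Multiplicativity of the extensions, by induction along \<open>pow_iso\<close>: the unit
  laws of \<open>M\<close> treat empty blocks and associativity the step.\<close>

lemma ext_pow_iso: "ext (n + m) \<cdot> P n m = \<nu> \<cdot> (ext n \<star> ext m)"
proof (induction n rule: induct_nat_012)
  case 0
  show ?case by (simp add: pow_iso_0_left M_unit_left)
next
  case 1
  show ?case
    by (cases m) (simp_all add: pow_iso_0_right M_unit_right pow_iso_1_Suc ext.simps(3) T_simps)
next
  case (ge2 n)
  have "ext (Suc (Suc n) + m) \<cdot> P (Suc (Suc n)) m =
      (\<nu> \<cdot> (ext1 \<star> (ext (Suc n + m) \<cdot> P (Suc n) m))) \<cdot> \<a> W (T (Suc n)) (T m)"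
    by (simp add: ext.simps(3) pow_iso.simps merge)
  also have "\<dots> = \<nu> \<cdot> (ext (Suc (Suc n)) \<star> ext m)"
    unfolding ge2(2) by (simp add: ext.simps(3) M_assoc_tensor)
  finally show ?case .
qed

text \<open>By the two unit laws of \<open>M\<close>, both terms of \<open>\<tau>\<close> are sent
  to \<open>f\<close>, so their difference is killed.\<close>

lemma ext_tau: "ext (Suc (Suc 0)) \<cdot> d0 = ext (Suc (Suc 0)) \<cdot> d1"
proof -
  let ?a = "(\<eta> \<star> \<iota>) \<cdot> inv_arrow C (\<l> V)" and ?b = "(\<iota> \<star> \<eta>) \<cdot> inv_arrow C (\<r> V)"
  let ?e = "ext (Suc (Suc 0))"
  have e [simp]: "?e \<in> Arr C" "Dom C ?e = W \<boxtimes> W" "Cod C ?e = M" by simp_all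
  have a: "?e \<cdot> ?a = f" by (simp add: ext.simps(3) merge) (simp add: M_unit_left reassoc[OF M_unit_left])
  have b: "?e \<cdot> ?b = f" by (simp add: ext.simps(3) merge) (simp add: M_unit_right reassoc[OF M_unit_right])
  have "?e \<cdot> \<tau> = minus_arrow C (?e \<cdot> ?a) (?e \<cdot> ?b)"
    unfolding tau_def by (rule Comp_minus(1)) simp_all
  also have "\<dots> = zero_arrow C V M" unfolding a b by (simp add: minus_self)
  finally have "?e \<cdot> \<tau> = zero_arrow C V M" .
  then show ?thesis
    by - (rule dsum_eqI[of V "W \<boxtimes> W"], simp_all)
qed

text \<open>Multiplicativity splits \<open>ext n\<close> into three blocks and isolates the
  extension on the two marked factors, where \<open>ext_tau\<close> applies.\<close>

lemma balanced_ext: "balanced n (ext n)"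
  unfolding balanced_def
proof (intro conjI allI impI)
  fix i k assume n: "n = Suc (Suc (i + k))"
  have e2: "ext (Suc (Suc i)) \<cdot> P i (Suc (Suc 0)) = \<nu> \<cdot> (ext i \<star> ext (Suc (Suc 0)))"
    using ext_pow_iso[of i "Suc (Suc 0)"] by simp
  have *: "ext n \<cdot> (mid2_iso i k \<cdot> between C (T i) d (T k)) =
      \<nu> \<cdot> ((\<nu> \<cdot> (ext i \<star> (ext (Suc (Suc 0)) \<cdot> d))) \<star> ext k)"
    if [simp]: "d \<in> Arr C" "Dom C d = dsum C V (W \<boxtimes> W)" "Cod C d = W \<boxtimes> W" for d
  proof -
    have "ext n \<cdot> (mid2_iso i k \<cdot> between C (T i) d (T k)) =
      (ext (Suc (Suc i) + k) \<cdot> P (Suc (Suc i)) k) \<cdot> ((P i (Suc (Suc 0)) \<star> \<^bold>1 (T k)) \<cdot> between C (T i) d (T k))"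
      by (simp add: mid2_iso_def n)
    also have "\<dots> = \<nu> \<cdot> (((ext (Suc (Suc i)) \<cdot> P i (Suc (Suc 0))) \<cdot> (\<^bold>1 (T i) \<star> d)) \<star> ext k)"
      unfolding ext_pow_iso by (simp add: merge)
    also have "\<dots> = \<nu> \<cdot> ((\<nu> \<cdot> (ext i \<star> (ext (Suc (Suc 0)) \<cdot> d))) \<star> ext k)"
      unfolding e2 by (simp add: merge)
    finally show ?thesis .
  qed
  show "ext n \<cdot> (mid2_iso i k \<cdot> between C (T i) d0 (T k)) = ext n \<cdot> (mid2_iso i k \<cdot> between C (T i) d1 (T k))"
    using *[of d0] *[of d1] by (simp only: ext_tau d_simps biprod_simps V_Obj W_Obj tensor_obj_simp)
qed simp_all

lemma ext_eta_0: "ext (Suc n) \<cdot> eta_i C V n 0 = ext n"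
proof -
  have "ext (Suc n) \<cdot> eta_i C V n 0 = (ext (1 + n) \<cdot> P 1 n) \<cdot> ((\<eta> \<star> \<^bold>1 (T n)) \<cdot> inv_arrow C (\<l> (T n)))"
    by (simp add: eta_i_0)
  then show ?thesis
    unfolding ext_pow_iso by (simp add: merge reassoc[OF M_unit_left])
qed

text \<open>Each \<open>ext n\<close> descends to the quotient. Compatibility with
  \<open>eta_tilde\<close> is checked after the epimorphism \<open>\<pi> n\<close>, where it is
  \<open>ext_eta_0\<close>, and the colimit yields \<open>\<phi>\<close>.\<close>

lemma ex_extension: "\<exists>\<phi>. \<phi> \<in> Arr C \<and> Dom C \<phi> = F \<and> Cod C \<phi> = M \<and> (\<forall>n. \<phi> \<cdot> w n = ext n)"
proof -
  have "\<forall>n. \<exists>h. h \<in> Arr C \<and> Dom C h = Vt C V n \<and> Cod C h = M \<and> h \<cdot> \<pi> n = ext n"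
    using balanced_factor[OF balanced_ext] by simp
  then obtain h where h [simp]: "\<And>n. h n \<in> Arr C" "\<And>n. Dom C (h n) = Vt C V n" "\<And>n. Cod C (h n) = M"
    and h_pi: "\<And>n. h n \<cdot> \<pi> n = ext n" by metis
  have "h (Suc n) \<cdot> eta_tilde C V n = h n" for n
  proof (rule epicD[OF epic_pi(1)[of \<I> n]])
    have "(h (Suc n) \<cdot> eta_tilde C V n) \<cdot> \<pi> n = (h (Suc n) \<cdot> \<pi> (Suc n)) \<cdot> eta_i C V n 0"
      by (simp add: eta_tilde_pi[of 0 n])
    then show "(h (Suc n) \<cdot> eta_tilde C V n) \<cdot> \<pi> n = h n \<cdot> \<pi> n"
      by (simp only: h_pi ext_eta_0)
  qed simp_all
  then have "sequential_cocone C (eta_tilde C V) M h"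
    by (simp add: sequential_cocone_def Hom_iff)
  then obtain \<phi> where \<phi>: "\<phi> \<in> Arr C" "Dom C \<phi> = F" "Cod C \<phi> = M" "\<And>n. \<phi> \<cdot> j n = h n"
    using sequential_colimit_ex[OF sequential_colimit_F] by metis
  have "\<phi> \<cdot> w n = ext n" for n
    using \<phi>(1-3) reassoc[OF \<phi>(4)[of n], of "\<pi> n"] by (simp add: w_def h_pi)
  with \<phi> show ?thesis by blast
qed

lemma u_V_eq: "u_V C V = w 1 \<cdot> \<iota>"
  by (simp add: u_V_def w_def)

text \<open>On \<open>W\<close> the morphism is forced by the unit on \<open>\<I>\<close> and by
  \<open>f\<close> on \<open>V\<close>; multiplicativity and \<open>w_Suc_Suc\<close> force it on
  all higher powers.\<close>

lemma monoid_morphism_ext: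
  assumes "monoid_morphism C F \<mu> (eta_bar C V) M \<nu> \<epsilon> \<phi>" "\<phi> \<cdot> u_V C V = f"
  shows "\<phi> \<cdot> w n = ext n"
proof -
  have \<phi> [simp]: "\<phi> \<in> Arr C" "Dom C \<phi> = F" "Cod C \<phi> = M"
    and \<phi>_mu: "\<phi> \<cdot> \<mu> = \<nu> \<cdot> (\<phi> \<star> \<phi>)" and \<phi>_0: "\<phi> \<cdot> w 0 = \<epsilon>"
    using assms(1) by (auto simp: monoid_morphism_def Hom_iff eta_bar_eq)
  have \<phi>_1: "\<phi> \<cdot> w 1 = ext1"
  proof (rule W_eqI)
    show "(\<phi> \<cdot> w 1) \<cdot> \<eta> = ext1 \<cdot> \<eta>" using w_1_eta \<phi>_0 by simp
    show "(\<phi> \<cdot> w 1) \<cdot> \<iota> = ext1 \<cdot> \<iota>" using assms(2) by (simp add: u_V_eq)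
  qed simp_all
  show ?thesis
  proof (induction n rule: induct_nat_012)
    case (ge2 n)
    have "\<phi> \<cdot> w (Suc (Suc n)) = (\<phi> \<cdot> \<mu>) \<cdot> (w 1 \<star> w (Suc n))" by (simp add: w_Suc_Suc)
    also have "\<dots> = \<nu> \<cdot> ((\<phi> \<cdot> w 1) \<star> (\<phi> \<cdot> w (Suc n)))" unfolding \<phi>_mu by (simp add: merge)
    finally show ?case by (simp only: \<phi>_1 ge2 ext.simps(3))
  qed (use \<phi>_0 \<phi>_1 in simp_all)
qed

text \<open>Multiplicativity of the extension is tested on pairs \<open>w n \<star> w m\<close>,
  where it is \<open>ext_pow_iso\<close>; uniqueness holds because the \<open>w n\<close> are
  jointly epic.\<close>

lemma ex1_extension:
  "\<exists>!\<phi>. monoid_morphism C F \<mu> (eta_bar C V) M \<nu> \<epsilon> \<phi> \<and> \<phi> \<cdot> u_V C V = f"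
proof -
  obtain \<phi> where \<phi> [simp]: "\<phi> \<in> Arr C" "Dom C \<phi> = F" "Cod C \<phi> = M" and \<phi>_w: "\<And>n. \<phi> \<cdot> w n = ext n"
    using ex_extension by blast
  have "\<phi> \<cdot> \<mu> = \<nu> \<cdot> (\<phi> \<star> \<phi>)"
  proof (rule F_F_eqI)
    fix n m
    have "(\<phi> \<cdot> \<mu>) \<cdot> (w n \<star> w m) = (\<phi> \<cdot> w (n + m)) \<cdot> P n m" by (simp add: mu_bar_w)
    also have "\<dots> = (\<nu> \<cdot> (\<phi> \<star> \<phi>)) \<cdot> (w n \<star> w m)"
      unfolding \<phi>_w ext_pow_iso by (simp add: interchange \<phi>_w)
    finally show "(\<phi> \<cdot> \<mu>) \<cdot> (w n \<star> w m) = (\<nu> \<cdot> (\<phi> \<star> \<phi>)) \<cdot> (w n \<star> w m)" .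
  qed simp_all
  moreover have "\<phi> \<cdot> u_V C V = f"
    using reassoc[OF \<phi>_w[of 1], of \<iota>] by (simp add: u_V_eq)
  ultimately have 1: "monoid_morphism C F \<mu> (eta_bar C V) M \<nu> \<epsilon> \<phi> \<and> \<phi> \<cdot> u_V C V = f"
    by (simp add: monoid_morphism_def Hom_iff eta_bar_eq \<phi>_w)
  show ?thesis
  proof (rule ex1I[where a = \<phi>])
    show "monoid_morphism C F \<mu> (eta_bar C V) M \<nu> \<epsilon> \<phi> \<and> \<phi> \<cdot> u_V C V = f" by (rule 1)
    fix \<psi> assume \<psi>: "monoid_morphism C F \<mu> (eta_bar C V) M \<nu> \<epsilon> \<psi> \<and> \<psi> \<cdot> u_V C V = f"
    then have "\<psi> \<in> Arr C" "Dom C \<psi> = F" "Cod C \<psi> = M" by (auto simp: monoid_morphism_def Hom_iff)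
    then show "\<psi> = \<phi>"
      using F_eqI[of \<psi> \<phi>] monoid_morphism_ext[of \<psi>] \<psi> \<phi>_w by simp
  qed
qed

end

lemma free_monoid_on_F: "free_monoid_on C V F \<mu> (eta_bar C V) (u_V C V)"
  unfolding free_monoid_on_def
proof (intro conjI allI impI)
  show "\<exists>!\<phi>. monoid_morphism C F \<mu> (eta_bar C V) M \<mu>' \<eta>' \<phi> \<and> \<phi> \<cdot> u_V C V = f"
    if "monoid_object C M \<mu>' \<eta>' \<and> f \<in> Hom C V M" for M \<mu>' \<eta>' f
    using ex1_extension[of M \<mu>' \<eta>' f] that by blast
qed (simp_all add: monoid_object_F Hom_iff u_V_def)

end

theorem theorem10:
  fixes C :: "('o, 'm, 'x) monoidal_category_scheme" and V :: 'o
  assumes "monoidal_abelian_category C"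
    and "has_sequential_colimits C"
    and "tensor_preserves_sequential_colimits C"
    and "tensor_preserves_reflexive_coequalizers C"
    and "V \<in> Obj C"
  shows "free_monoid_on C V (FV C V) (mu_bar C V) (eta_bar C V) (u_V C V)"
proof -
  interpret free_monoid_construction C V
    using assms by (simp add: free_monoid_construction_def free_monoid_construction_axioms_def)
  show ?thesis by (rule free_monoid_on_F)
qed

end
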